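(* Let $p,q\in\mathbb{N}_0$ with $p\ge 2$, let $a\in\mathbb{C}\setminus\{0\}$ with a fixed argument $\arg a$, let $\varphi\in\mathcal{O}(D)$, and let $\widehat u(t,z)=\sum_{n\ge 0}u_n(z)t^n$, $u_n\in\mathcal{O}(D)$, be the unique formal power series solution of the Cauchy problem $$\partial_t u(t,z)=a(\partial_t t)^p\,t^q\,u(t,z),\qquad u(0,z)=\varphi(z).$$ Let $m(u)=\bigl(\Gamma(1+\tfrac{u}{q+1})\bigr)^{p-1}$ and let $e_m$ be the corresponding kernel function of order $\frac{q+1}{p-1}$. Suppose that $d\in\mathbb{R}$ and $d\ne\frac{2k\pi-\arg a}{q+1}$ for all $k\in\mathbb{Z}$. Then $\widehat u(t,z)$ is $\frac{q+1}{p-1}$-summable in the direction $d$, and for every $\varepsilon>0$ there exists $\tilde r>0$ such that its $\frac{q+1}{p-1}$-sum $u\in\mathcal{O}\bigl(S_d(\tfrac{\pi(p-1)}{q+1}-\varepsilon,\tilde r)\times D\bigr)$ is given by $$u(t,z)=u^d(t,z)=(T_{m,d}\,\widehat{\mathcal{B}}_m\widehat u)(t,z)=\int_{e^{id}\mathbb{R}_+}e_m\Bigl(\frac{s}{t}\Bigr)\frac{\varphi(z)}{1-a(q+1)^{p-1}s^{q+1}}\,\frac{ds}{s}.$$ Moreover, if $d_k:=\frac{2k\pi-\arg a}{q+1}$ for $k=0,\ldots,q$, then the sets $\mathcal{L}_{d_k}$ are Stokes lines for $\widehat u$, and the jump across $\mathcal{L}_{d_k}$ is given by $$J_{\mathcal{L}_{d_k}}\widehat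 u(t,z)=2\pi i\,\frac{\varphi(z)}{q+1}\;\frac{e_m\Bigl(\bigl(\frac1a\bigr)^{\frac1{q+1}}(q+1)^{-\frac{p-1}{q+1}}e^{-\frac{2\pi i k}{q+1}}\,t^{-1}\Bigr)}{\bigl(\frac1a\bigr)^{\frac1{q+1}}(q+1)^{-\frac{p-1}{q+1}}e^{-\frac{2\pi i k}{q+1}}}.$$
   Context: Sectors and discs. $\tilde{\mathbb{C}}$ is the universal covering space of $\mathbb{C}\setminus\{0\}$. For $d\in\mathbb{R}$, $\alpha>0$, $R>0$, $S_d(\alpha,R)=\{z\in\tilde{\mathbb{C}}: z=\rho e^{i\phi},\ \rho\in(0,R),\ \phi\in(d-\alpha/2,d+\alpha/2)\}$; $S_d(\alpha)$ is the same with $R=+\infty$ (unbounded sector). $D$ denotes a disc $\{|z|<\rho\}\subset\mathbb{C}$ centred at the origin whose radius is not essential (it may be different at different occurrences). $\widehat S_d(\alpha)=S_d(\alpha)\cup D$, abbreviated $\widehat S_d$ when the opening is inessential. $\mathcal{O}(G)$ (resp. $\mathcal{O}(G,\mathbb{E})$) is the set of holomorphic functions on $G$ with values in $\mathbb{C}$ (resp. in a complex Banach space $\mathbb{E}$). Growth. For an unbounded sector $S$, $v\in\mathcal{O}^{\kappa}(S,\mathbb{E})$ means that $v\in\mathcal{O}(S,\mathbb{E})$ and for every proper subsector $S^*$ of $S$ (i.e. $\overline{S^*}\setminus\{0\}\subseteq S$) there are $C_1,C_2>0$ with $\|v(x)\|_{\mathbb{E}}\le C_1e^{C_2|x|^{\kappa}}$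 on $S^*$; similarly for disc-sectors. Kernel function. With $\kappa=\frac{q+1}{p-1}$, the function $m(u)=(\Gamma(1+\frac{u}{q+1}))^{p-1}$ is a moment function of order $1/\kappa$. Its kernel function $e_m$ (uniquely determined by $m$) is the function $e_m\in\mathcal{O}(S_0(\pi/\kappa))$, positive on $\mathbb{R}_+$, with $e_m(z)/z$ integrable at the origin, exponentially flat of order $\kappa$ (for every $\varepsilon>0$ there are $A,B>0$ with $|e_m(z)|\le Ae^{-(|z|/B)^{\kappa}}$ on $S_0(\pi/\kappa-\varepsilon)$), and satisfying $m(u)=\int_0^\infty x^{u-1}e_m(x)\,dx$ for $\operatorname{Re}u\ge0$. Moment Borel and Laplace transforms. For a moment function $m$, $\widehat{\mathcal{B}}_m\bigl(\sum_j u_jt^j\bigr)=\sum_j\frac{u_j}{m(j)}t^j$. For $v\in\mathcal{O}^{\kappa}(\widehat S_d,\mathbb{E})$, $(T_{m,d}v)(t)=\int_{e^{id}\mathbb{R}_+}e_m(s/t)\,v(s)\,\frac{ds}{s}$. The convergent series $\widehat{\mathcal{B}}_m\widehat u$ is identified with its sum and analytic continuation. Summability. For $\kappa>0$ put $\Gamma_{1/\kappa}(u)=\Gamma(1+u/\kappa)$. A formal series $\widehat u\in\mathbb{E}[[t]]$ is $\kappa$-summable in a direction $d$ if there are $\varepsilon>0$ and a disc-sector $\widehat S_d(\varepsilon)$ such that $v=\widehat{\mathcal{B}}_{\Gamma_{1/\kappa}}\widehat u\in\mathcal{O}^{\kappa}(\widehat S_d(\varepsilon),\mathbb{E})$; its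 $\kappa$-sum in the direction $d$ is $u^d(t)=(T_{\Gamma_{1/\kappa},\theta}v)(t)$ for $\theta\in(d-\varepsilon/2,d+\varepsilon/2)$. Here $\widehat u(t,z)$ is regarded as a power series in $t$ with coefficients in a Banach space $\mathbb{E}$ of functions holomorphic on a disc $D$ (e.g. holomorphic on $D$ and continuous on $\overline D$, with the sup norm). Stokes lines and jumps. $\widehat u$ is $\kappa$-summable if it is $\kappa$-summable in all directions except, modulo $2\pi$, finitely many, called the singular directions. For a singular direction $d$, $\mathcal{L}_d=\{t\in\tilde{\mathbb{C}}:\arg t=d\}$ is called a Stokes line for $\widehat u$, and $J_{\mathcal{L}_d}\widehat u:=u^{d^+}-u^{d^-}$ is the jump across it, where $d^+$ (resp. $d^-$) is a direction close to $d$ and greater (resp. less) than $d$, and $u^{d^\pm}$ are the $\kappa$-sums in the directions $d^\pm$. Other conventions. $(\partial_t t)$ is the operator $f\mapsto\partial_t(tf)$. $\bigl(\frac1a\bigr)^{\frac1{q+1}}=|a|^{-\frac1{q+1}}e^{-i\arg a/(q+1)}$.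
   Formalization: The printed jump formula is false: the division by (1/a)^{1/(q+1)}(q+1)^{-(p-1)/(q+1)}e^{-2πik/(q+1)} is dropped and the exponent inside e_m becomes +2πik/(q+1), so the pole has argument d_k; the Stokes line claim assumes φ is not identically 0 (for φ=0 there are none). *)

theory Defs
  imports "HOL-Complex_Analysis.Complex_Analysis" "HOL-Computational_Algebra.Formal_Power_Series"
begin

(* The universal covering of the punctured plane is represented by its global logarithmic
   coordinate: a complex number w stands for the point t with |t| = exp (Re w) and
   arg t = Im w, whose projection to the plane is exp w.  Hence the quotient s / t of two points
   becomes the difference of their coordinates, and, since exp is locally biholomorphic,
   holomorphy on the covering is holomorphy in w. *)
type_synonym cover = complex

(* the point r e^(i theta) of the covering, for r > 0 *)
definition cpoint :: "real \<Rightarrow> real \<Rightarrow> cover" where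
  "cpoint r \<theta> = Complex (ln r) \<theta>"

definition unbounded_sector :: "real \<Rightarrow> real \<Rightarrow> cover set" where
  "unbounded_sector d \<alpha> = {t. Im t \<in> {d - \<alpha>/2 <..< d + \<alpha>/2}}"

definition sector :: "real \<Rightarrow> real \<Rightarrow> real \<Rightarrow> cover set" where
  "sector d \<alpha> R = {t \<in> unbounded_sector d \<alpha>. exp (Re t) < R}"

(* Integrals over the ray with direction d with respect to ds/s; on s = r e^(id) one has
   ds/s = dr/r. *)
definition ray_integrable :: "real \<Rightarrow> (cover \<Rightarrow> complex) \<Rightarrow> bool" where
  "ray_integrable d f \<longleftrightarrow>
     set_integrable lborel {0<..} (\<lambda>r. f (cpoint r d) / of_real r)"

definition ray_integral :: "real \<Rightarrow> (cover \<Rightarrow> complex) \<Rightarrow> complex" where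
  "ray_integral d f = (LINT r:{0<..}|lborel. f (cpoint r d) / of_real r)"

(* The Banach space E of functions continuous on the closed disc of radius rho and holomorphic
   inside, with the sup norm.  Only values on the closed disc matter, and all statements
   about the norm are written as uniform statements over that disc. *)
definition disc_space :: "real \<Rightarrow> (complex \<Rightarrow> complex) set" where
  "disc_space \<rho> = {f. continuous_on (cball 0 \<rho>) f \<and> f holomorphic_on ball 0 \<rho>}"

(* E-valued holomorphy on an open set: the difference quotients converge in the norm of E. *)
definition E_holomorphic_on ::
    "real \<Rightarrow> (cover \<Rightarrow> complex \<Rightarrow> complex) \<Rightarrow> cover set \<Rightarrow> bool" where
  "E_holomorphic_on \<rho> v G \<longleftrightarrow>
     (\<forall>w\<in>G. v w \<in> disc_space \<rho> \<and>
        (\<exists>g\<in>disc_space \<rho>.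
           uniform_limit (cball 0 \<rho>) (\<lambda>h z. (v (w + h) z - v w z) / h) g (at 0)))"

(* Membership in O^kappa on the unbounded sector. *)
definition O_growth ::
    "real \<Rightarrow> real \<Rightarrow> real \<Rightarrow> real \<Rightarrow> (cover \<Rightarrow> complex \<Rightarrow> complex) set" where
  "O_growth \<rho> \<kappa> d \<alpha> =
     {v. E_holomorphic_on \<rho> v (unbounded_sector d \<alpha>) \<and>
         (\<forall>d' \<alpha>'. 0 < \<alpha>' \<and> {d' - \<alpha>'/2 .. d' + \<alpha>'/2} \<subseteq> {d - \<alpha>/2 <..< d + \<alpha>/2} \<longrightarrow>
            (\<exists>C1>0. \<exists>C2>0. \<forall>w\<in>unbounded_sector d' \<alpha>'. \<forall>z\<in>cball 0 \<rho>.
               cmod (v w z) \<le> C1 * exp (C2 * exp (Re w) powr \<kappa>)))}"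

(* The series with coefficients c converges in E on some disc around the origin, and v is the
   analytic continuation of its sum to the disc-sector, of growth order kappa there.  On a smaller
   disc around the origin the growth condition is automatic. *)
definition continuations ::
    "real \<Rightarrow> real \<Rightarrow> real \<Rightarrow> real \<Rightarrow> (nat \<Rightarrow> complex \<Rightarrow> complex) \<Rightarrow>
     (cover \<Rightarrow> complex \<Rightarrow> complex) set" where
  "continuations \<rho> \<kappa> d \<alpha> c =
     {v \<in> O_growth \<rho> \<kappa> d \<alpha>.
        \<exists>r>0. \<exists>f.
          (\<forall>s\<in>ball 0 r. uniform_limit (cball 0 \<rho>) (\<lambda>N z. \<Sum>n<N. c n z * s ^ n) (f s) sequentially) \<and>
          (\<forall>w\<in>sector d \<alpha> r. \<forall>z\<in>cball 0 \<rho>. v w z = f (exp w) z)}"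

definition continuable ::
    "real \<Rightarrow> real \<Rightarrow> real \<Rightarrow> (nat \<Rightarrow> complex \<Rightarrow> complex) \<Rightarrow> bool" where
  "continuable \<rho> \<kappa> d c \<longleftrightarrow> (\<exists>\<alpha>>0. continuations \<rho> \<kappa> d \<alpha> c \<noteq> {})"

(* By the identity theorem, the values over the ray with direction d do not depend on the
   choice of v and of the opening alpha. *)
definition continuation ::
    "real \<Rightarrow> real \<Rightarrow> real \<Rightarrow> (nat \<Rightarrow> complex \<Rightarrow> complex) \<Rightarrow> (cover \<Rightarrow> complex \<Rightarrow> complex)" where
  "continuation \<rho> \<kappa> d c = (SOME v. \<exists>\<alpha>>0. v \<in> continuations \<rho> \<kappa> d \<alpha> c)"

(* Kernel functions.  Integrability of e(z)/z at the origin is required along every ray of the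
   sector. *)
definition is_kernel :: "real \<Rightarrow> (complex \<Rightarrow> complex) \<Rightarrow> (cover \<Rightarrow> complex) \<Rightarrow> bool" where
  "is_kernel \<kappa> m e \<longleftrightarrow>
     e holomorphic_on unbounded_sector 0 (pi/\<kappa>) \<and>
     (\<forall>x>0. e (cpoint x 0) \<in> \<real> \<and> 0 < Re (e (cpoint x 0))) \<and>
     (\<forall>\<tau> R. \<bar>\<tau>\<bar> < pi/\<kappa>/2 \<and> 0 < R \<longrightarrow>
        set_integrable lborel {0<..<R} (\<lambda>x. e (cpoint x \<tau>) / of_real x)) \<and>
     (\<forall>\<epsilon>>0. \<exists>A>0. \<exists>B>0. \<forall>w\<in>unbounded_sector 0 (pi/\<kappa> - \<epsilon>).
        cmod (e w) \<le> A * exp (- ((exp (Re w) / B) powr \<kappa>))) \<and>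
     (\<forall>u. 0 \<le> Re u \<longrightarrow>
        set_integrable lborel {0<..} (\<lambda>x. of_real x powr (u - 1) * e (cpoint x 0)) \<and>
        m u = (LINT x:{0<..}|lborel. of_real x powr (u - 1) * e (cpoint x 0)))"

(* The kernel function of m is unique on the sector with direction 0 and opening pi/kappa. *)
definition kernel_fun :: "real \<Rightarrow> (complex \<Rightarrow> complex) \<Rightarrow> cover \<Rightarrow> complex" where
  "kernel_fun \<kappa> m = (SOME e. is_kernel \<kappa> m e)"

definition moment_borel ::
    "(complex \<Rightarrow> complex) \<Rightarrow> (nat \<Rightarrow> complex \<Rightarrow> complex) \<Rightarrow> (nat \<Rightarrow> complex \<Rightarrow> complex)" where
  "moment_borel m u = (\<lambda>n z. u n z / m (of_nat n))"

(* The Laplace transform is meaningful where the kernel is defined along the whole ray and the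
   integral converges. *)
definition laplace_converges ::
    "real \<Rightarrow> (complex \<Rightarrow> complex) \<Rightarrow> real \<Rightarrow> (cover \<Rightarrow> complex \<Rightarrow> complex) \<Rightarrow>
     cover \<Rightarrow> complex \<Rightarrow> bool" where
  "laplace_converges \<kappa> m d v t z \<longleftrightarrow>
     \<bar>Im t - d\<bar> < pi/\<kappa>/2 \<and> ray_integrable d (\<lambda>s. kernel_fun \<kappa> m (s - t) * v s z)"

definition moment_laplace ::
    "real \<Rightarrow> (complex \<Rightarrow> complex) \<Rightarrow> real \<Rightarrow> (cover \<Rightarrow> complex \<Rightarrow> complex) \<Rightarrow>
     cover \<Rightarrow> complex \<Rightarrow> complex" where
  "moment_laplace \<kappa> m d v t z = ray_integral d (\<lambda>s. kernel_fun \<kappa> m (s - t) * v s z)"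

definition Gamma_moment :: "real \<Rightarrow> complex \<Rightarrow> complex" where
  "Gamma_moment \<kappa> u = Gamma (1 + u / of_real \<kappa>)"

definition summable_in_direction ::
    "real \<Rightarrow> real \<Rightarrow> (nat \<Rightarrow> complex \<Rightarrow> complex) \<Rightarrow> real \<Rightarrow> bool" where
  "summable_in_direction \<rho> \<kappa> u d \<longleftrightarrow> continuable \<rho> \<kappa> d (moment_borel (Gamma_moment \<kappa>) u)"

(* The integral defining the sum in the direction d may be taken along any ray with direction
   theta close to d; the different choices are analytic continuations of each other in t.
   Taking theta = d gives the sum for |arg t - d| < pi/(2 kappa) and |t| small. *)
definition sum_converges ::
    "real \<Rightarrow> real \<Rightarrow> (nat \<Rightarrow> complex \<Rightarrow> complex) \<Rightarrow> real \<Rightarrow> cover \<Rightarrow> complex \<Rightarrow> bool" where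
  "sum_converges \<rho> \<kappa> u d t z \<longleftrightarrow>
     laplace_converges \<kappa> (Gamma_moment \<kappa>) d
       (continuation \<rho> \<kappa> d (moment_borel (Gamma_moment \<kappa>) u)) t z"

definition sum_in_direction ::
    "real \<Rightarrow> real \<Rightarrow> (nat \<Rightarrow> complex \<Rightarrow> complex) \<Rightarrow> real \<Rightarrow> cover \<Rightarrow> complex \<Rightarrow> complex" where
  "sum_in_direction \<rho> \<kappa> u d t z =
     moment_laplace \<kappa> (Gamma_moment \<kappa>) d
       (continuation \<rho> \<kappa> d (moment_borel (Gamma_moment \<kappa>) u)) t z"

definition kappa_summable :: "real \<Rightarrow> real \<Rightarrow> (nat \<Rightarrow> complex \<Rightarrow> complex) \<Rightarrow> bool" where
  "kappa_summable \<rho> \<kappa> u \<longleftrightarrow>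
     (\<exists>F. finite F \<and>
        (\<forall>d. \<not> summable_in_direction \<rho> \<kappa> u d \<longrightarrow> (\<exists>f\<in>F. \<exists>k::int. d = f + 2 * pi * of_int k)))"

definition singular_direction ::
    "real \<Rightarrow> real \<Rightarrow> (nat \<Rightarrow> complex \<Rightarrow> complex) \<Rightarrow> real \<Rightarrow> bool" where
  "singular_direction \<rho> \<kappa> u d \<longleftrightarrow>
     kappa_summable \<rho> \<kappa> u \<and> \<not> summable_in_direction \<rho> \<kappa> u d"

definition direction_line :: "real \<Rightarrow> cover set" where
  "direction_line d = {t. Im t = d}"

definition stokes_line ::
    "real \<Rightarrow> real \<Rightarrow> (nat \<Rightarrow> complex \<Rightarrow> complex) \<Rightarrow> cover set \<Rightarrow> bool" where
  "stokes_line \<rho> \<kappa> u L \<longleftrightarrow> (\<exists>d. singular_direction \<rho> \<kappa> u d \<and> L = direction_line d)"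

(* J is, on G, the jump across the line with direction d: the difference of the sums in any two
   directions dp and dm sufficiently close to d with dm < d < dp. *)
definition has_jump ::
    "real \<Rightarrow> real \<Rightarrow> (nat \<Rightarrow> complex \<Rightarrow> complex) \<Rightarrow> real \<Rightarrow> cover set \<Rightarrow>
     (cover \<Rightarrow> complex \<Rightarrow> complex) \<Rightarrow> bool" where
  "has_jump \<rho> \<kappa> u d G J \<longleftrightarrow>
     (\<exists>\<delta>>0. \<forall>dp\<in>{d <..< d + \<delta>}. \<forall>dm\<in>{d - \<delta> <..< d}.
        summable_in_direction \<rho> \<kappa> u dp \<and> summable_in_direction \<rho> \<kappa> u dm \<and>
        (\<forall>t\<in>G. \<forall>z\<in>ball 0 \<rho>.
           sum_converges \<rho> \<kappa> u dp t z \<and> sum_converges \<rho> \<kappa> u dm t z \<and>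
           J t z = sum_in_direction \<rho> \<kappa> u dp t z - sum_in_direction \<rho> \<kappa> u dm t z))"

(* Holomorphy in two variables: complex differentiability at every point. *)
definition holomorphic2_on ::
    "(complex \<Rightarrow> complex \<Rightarrow> complex) \<Rightarrow> (complex \<times> complex) set \<Rightarrow> bool" where
  "holomorphic2_on f G \<longleftrightarrow>
     (\<forall>x\<in>G. \<exists>A B. ((\<lambda>(w, z). f w z) has_derivative (\<lambda>(h, k). A * h + B * k)) (at x))"

(* u n z is the coefficient of t^n; the equation is one of formal power series in t for every
   z in the disc of radius R. *)
definition formal_solution ::
    "nat \<Rightarrow> nat \<Rightarrow> complex \<Rightarrow> real \<Rightarrow> (complex \<Rightarrow> complex) \<Rightarrow> (nat \<Rightarrow> complex \<Rightarrow> complex) \<Rightarrow> bool" where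
  "formal_solution p q a R \<phi> u \<longleftrightarrow>
     (\<forall>n. u n holomorphic_on ball 0 R) \<and>
     (\<forall>z\<in>ball 0 R. \<forall>U. U = Abs_fps (\<lambda>n. u n z) \<longrightarrow>
        fps_deriv U =
          fps_const a * ((\<lambda>f. fps_deriv (fps_X * f)) ^^ p) (fps_X ^ q * U) \<and>
        fps_nth U 0 = \<phi> z)"

(* The direction d_k of the k-th root of a (q+1)^(p-1) s^(q+1) = 1, where arga is the chosen
   argument of a. *)
definition root_direction :: "nat \<Rightarrow> real \<Rightarrow> int \<Rightarrow> real" where
  "root_direction q arga k = (2 * of_int k * pi - arga) / (real q + 1)"

(* That root, as a point of the covering:
   (1/a)^(1/(q+1)) (q+1)^(-(p-1)/(q+1)) e^(2 pi i k/(q+1)).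
   The factor has to be e^(+2 pi i k/(q+1)) in order that the argument be d_k.  The integrand
   e(s/t) / (1 - a (q+1)^(p-1) s^(q+1)) * 1/s has there the residue -e(root/t)/(q+1): the factor
   1/s cancels against the derivative of s^(q+1), so the jump carries no factor 1/root. *)
definition root_point :: "nat \<Rightarrow> nat \<Rightarrow> complex \<Rightarrow> real \<Rightarrow> int \<Rightarrow> cover" where
  "root_point p q a arga k =
     cpoint (cmod a powr (- (1 / (real q + 1))) * (real q + 1) powr (- ((real p - 1) / (real q + 1))))
            (root_direction q arga k)"

end

theory Submission
  imports Defs "HOL-Probability.Probability" "HOL-Complex_Analysis.Complex_Analysis"
    "HOL-Real_Asymp.Real_Asymp"
begin

text \<open>Everything is written in the logarithmic coordinate w = log s, in which rays become horizontal lines and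
  Laplace transforms become convolutions. Put n = q + 1, k = p - 1 and z = u / n. The quotient of the moments
  m(u) and Gamma(1 + u/\<kappa>) is the product over 1 \<le> i < k of
  Gamma(1 + i z) Gamma(1 + z) / Gamma(1 + (i+1) z) = (1 + (i+1) z) * integral of (y^i (1 - y))^z over 0 < y < 1,
  and multiplying a Mellin transform by such a factor means averaging over real translations of w and applying a
  first order differential operator. These operators turn the explicit kernel of Gamma(1 + u/\<kappa>) into a kernel of m,
  while their adjoints turn the m-Borel transform \<phi> / (1 - a n^k s^n) into the Borel transform of order 1/\<kappa>;
  moving them across the Laplace integral (Fubini and integration by parts) identifies the two sums.
  Fourier uniqueness makes kernels unique, and shows that the constructed kernel is positive because it is a convolution
  power on the real line. The jump is found by subtracting from the integrand an explicit function with the same pole.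
  The singular directions are genuine since the Borel transform has coefficients proportional to (j!)^k / (k j)!,
  and its series diverges to infinity at the positive end of its disc of convergence.\<close>

section \<open>Integrals along rays and horizontal lines\<close>

text \<open>Summability is defined through Gamma(1 + u/\<kappa>), while the closed formula belongs
  to \<open>m\<close>. For p > 2 the first comes with an elementary kernel and the second with an
  elementary Borel transform, so the two sums cannot be compared by direct computation; one pair has
  to be transported into the other. Euler's integral of (y^i (1 - y))^z has Gamma(2 + (i+1) z) in
  the denominator instead of Gamma(1 + (i+1) z); the differential operator repairs exactly this
  factor. The averages shift w by nonpositive amounts: functions are evaluated nearer to the origin
  at the same argument, so singularity-free strips and boundedness survive, and the Borel transform
  of order 1/\<kappa> is continued without further study of its singularities. Dually, kernels are
  evaluated farther out, where flatness pays for the shift. The derivative enters the kernel with a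
  negative sign, which hides positivity; and \<open>kernel_fun\<close> is a choice, so existence and
  uniqueness must precede any statement on sums. The space variable is a parameter: each coefficient
  is a number times \<phi>.\<close>

lemma distr_ln_lborel:
  "distr (density lborel (\<lambda>r. indicator {0<..} r * ennreal (1 / r))) borel ln = lborel"
proof -
  let ?N = "density lborel (\<lambda>r::real. indicator {0<..} r * ennreal (1 / r))"
  have main: "emeasure (distr ?N borel ln) {l<..<u} = ennreal (u - l)" if lu: "l \<le> u" for l u :: real
  proof -
  have [measurable]: "ln -` {l<..<u} \<in> sets borel"
    using measurable_sets[of "ln::real\<Rightarrow>real" borel borel "{l<..<u}"] by simp
  have "emeasure (distr ?N borel ln) {l<..<u} = emeasure ?N (ln -` {l<..<u})"
    by (subst emeasure_distr) auto
  also have "\<dots> = (\<integral>\<^sup>+r. indicator {0<..} r * ennreal (1 / r) * indicator (ln -` {l<..<u}) r \<partial>lborel)"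
    by (subst emeasure_density) auto
  \<comment> \<open>The two endpoints are null, so the open interval may be replaced by the closed
    one required by the fundamental theorem of calculus used next.\<close>
  also have "\<dots> = (\<integral>\<^sup>+r. ennreal (1 / r) * indicator {exp l..exp u} r \<partial>lborel)"
  proof (rule nn_integral_cong_AE)
    have "AE r in lborel. r \<noteq> exp l \<and> r \<noteq> exp u"
      using AE_lborel_singleton[of "exp l"] AE_lborel_singleton[of "exp u"] by eventually_elim auto
    then show "AE r in lborel. indicator {0<..} r * ennreal (1 / r) * indicator (ln -` {l<..<u}) r
        = ennreal (1 / r) * indicator {exp l..exp u} r"
    proof eventually_elim
      case (elim r)
      show ?case
      proof (cases "r > 0")
        case True
        then have "l < ln r \<longleftrightarrow> exp l < r" "ln r < u \<longleftrightarrow> r < exp u"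
          by (metis exp_less_cancel_iff exp_ln)+
        then show ?thesis using elim True by (auto simp: indicator_def)
      next
        case False
        then have "\<not> exp l \<le> r" by (meson exp_gt_zero less_le_trans)
        then show ?thesis using False by (auto simp: indicator_def)
      qed
    qed
  qed
  also have "\<dots> = ennreal (ln (exp u) - ln (exp l))"
  proof (rule nn_integral_FTC_Icc)
    fix x assume "x \<in> {exp l..exp u}"
    then have "0 < x" using exp_gt_zero[of l] by (metis atLeastAtMost_iff less_le_trans)
    then show "(ln has_real_derivative 1 / x) (at x)" "0 \<le> 1 / x"
      by (auto intro!: derivative_eq_intros)
  qed (use lu in auto)
  finally show ?thesis by simp
  qed
  show ?thesis
    by (rule lborel_eqI[symmetric]) (auto simp: main)
qed

text \<open>The measure dr/r is carried to Lebesgue measure by the logarithm. Ray integrals, Mellin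
  transforms, Euler's Gamma integral and the integral of 1 / (1 + r^2) all reach the real line
  through this substitution.\<close>

lemma integral_ln_substitution:
  fixes g :: "real \<Rightarrow> complex"
  assumes [measurable]: "g \<in> borel_measurable borel"
  shows "set_integrable lborel {0<..} (\<lambda>r. g (ln r) / of_real r) \<longleftrightarrow> integrable lborel g"
    and "(LINT r:{0<..}|lborel. g (ln r) / of_real r) = (\<integral>x. g x \<partial>lborel)"
proof -
  have eq: "(\<lambda>r. indicator {0<..} r * ennreal (1 / r)) = (\<lambda>r. ennreal (indicator {0<..} r / r))"
    by (auto simp: indicator_def fun_eq_iff)
  have nn: "AE r in lborel. 0 \<le> (indicator {0<..} r / r :: real)"
    by (auto simp: indicator_def)
  let ?N = "density lborel (\<lambda>r::real. ennreal (indicator {0<..} r / r))"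
  have d: "distr ?N borel ln = lborel" using distr_ln_lborel unfolding eq .
  have e: "(indicator {0<..} r / r) *\<^sub>R g (ln r) = indicat_real {0<..} r *\<^sub>R (g (ln r) / complex_of_real r)" for r :: real
    by (auto simp: indicator_def scaleR_conv_of_real)
  have "integrable lborel g \<longleftrightarrow> integrable ?N (\<lambda>r. g (ln r))"
    by (subst d[symmetric], subst integrable_distr_eq) auto
  also have "\<dots> \<longleftrightarrow> set_integrable lborel {0<..} (\<lambda>r. g (ln r) / of_real r)"
    by (subst integrable_density) (auto simp: set_integrable_def e nn)
  finally show "set_integrable lborel {0<..} (\<lambda>r. g (ln r) / of_real r) \<longleftrightarrow> integrable lborel g" by simp
  have "(\<integral>x. g x \<partial>lborel) = (\<integral>r. g (ln r) \<partial>?N)"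
    by (subst d[symmetric], subst integral_distr) auto
  also have "\<dots> = (LINT r:{0<..}|lborel. g (ln r) / of_real r)"
    by (subst integral_density) (auto simp: set_lebesgue_integral_def e nn)
  finally show "(LINT r:{0<..}|lborel. g (ln r) / of_real r) = (\<integral>x. g x \<partial>lborel)" by simp
qed

lemma ray_line:
  assumes "(\<lambda>x. f (Complex x d)) \<in> borel_measurable borel"
  shows "ray_integrable d f \<longleftrightarrow> integrable lborel (\<lambda>x. f (Complex x d))"
    and "ray_integral d f = (\<integral>x. f (Complex x d) \<partial>lborel)"
  using integral_ln_substitution[OF assms]
  by (simp_all add: ray_integrable_def ray_integral_def cpoint_def)

section \<open>Holomorphic parameter integrals\<close>

text \<open>Cauchy's inequality turns the bound \<open>g\<close> on the integrand into a bound
  \<open>g y / r\<close> on its derivative near \<open>w\<close>, hence on the difference quotients;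
  dominated convergence along sequences then gives both claims.\<close>

lemma has_field_derivative_parameter_integral:
  fixes f :: "complex \<Rightarrow> 'b \<Rightarrow> complex"
  assumes S: "open S" "w \<in> S"
    and meas: "\<And>w. w \<in> S \<Longrightarrow> f w \<in> borel_measurable M"
    and hol: "\<And>y. y \<in> space M \<Longrightarrow> (\<lambda>w. f w y) holomorphic_on S"
    and g: "integrable M g"
    and bound: "\<And>w y. w \<in> S \<Longrightarrow> y \<in> space M \<Longrightarrow> norm (f w y) \<le> g y"
  shows "integrable M (\<lambda>y. deriv (\<lambda>w. f w y) w)"
    and "((\<lambda>w. \<integral>y. f w y \<partial>M) has_field_derivative (\<integral>y. deriv (\<lambda>w. f w y) w \<partial>M)) (at w)"
proof -
  obtain e where e: "e > 0" "cball w e \<subseteq> S" using S open_contains_cball by blast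
  \<comment> \<open>With half the radius, discs of radius \<open>r\<close> centred in
    \<open>ball w r\<close> stay inside \<open>S\<close>, as the Cauchy estimates require.\<close>
  define r where "r = e / 2"
  have r: "r > 0" using e by (simp add: r_def)
  have sub: "cball x r \<subseteq> S" if "x \<in> ball w r" for x
  proof
    fix y assume "y \<in> cball x r"
    then have "dist w y \<le> e" using that dist_triangle[of w y x] by (auto simp: r_def dist_commute)
    then show "y \<in> S" using e by auto
  qed
  have wb: "w \<in> ball w r" using r by simp
  have dbound: "norm (deriv (\<lambda>w. f w y) x) \<le> g y / r" if y: "y \<in> space M" and x: "x \<in> ball w r" for x y
  proof -
    have "norm ((deriv ^^ 1) (\<lambda>w. f w y) x) \<le> fact 1 * g y / r ^ 1"
    proof (rule Cauchy_inequality)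
      show "(\<lambda>w. f w y) holomorphic_on ball x r"
        using hol[OF y] sub[OF x] by (meson ball_subset_cball holomorphic_on_subset order_trans)
      show "continuous_on (cball x r) (\<lambda>w. f w y)"
        using hol[OF y] sub[OF x] by (meson holomorphic_on_imp_continuous_on holomorphic_on_subset)
      fix z assume "norm (x - z) = r"
      then have "z \<in> S" using sub[OF x] by (auto simp: dist_norm)
      then show "norm (f z y) \<le> g y" using bound y by blast
    qed (use r in auto)
    then show ?thesis by simp
  qed
  have int: "integrable M (f x)" if "x \<in> S" for x
    by (rule Bochner_Integration.integrable_bound[OF g]) (use meas that bound in \<open>auto intro!: AE_I2 intro: order_trans[OF _ abs_ge_self]\<close>)
  have dd: "((\<lambda>w. f w y) has_field_derivative deriv (\<lambda>w. f w y) x) (at x)" if "y \<in> space M" "x \<in> S" for x y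
    using holomorphic_derivI[OF hol S(1)] that by blast
  have quot: "norm ((f x y - f w y) / (x - w)) \<le> g y / r" if y: "y \<in> space M" and x: "x \<in> ball w r" for x y
  proof -
    have "norm (f x y - f w y) \<le> g y / r * norm (x - w)"
    proof (rule field_differentiable_bound)
      show "convex (ball w r)" by simp
      fix z assume z: "z \<in> ball w r"
      then have "z \<in> S" using sub[OF z] r by auto
      then show "((\<lambda>w. f w y) has_field_derivative deriv (\<lambda>w. f w y) z) (at z within ball w r)"
        using dd y has_field_derivative_at_within by blast
      show "norm (deriv (\<lambda>w. f w y) z) \<le> g y / r" using dbound y z by blast
    qed (use x wb in auto)
    moreover have "0 \<le> g y / r" using dbound[OF y wb] norm_ge_zero order_trans by blast
    ultimately show ?thesis
      by (cases "x = w") (auto simp: norm_divide field_simps)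
  qed
  have main: "integrable M (\<lambda>y. deriv (\<lambda>w. f w y) w) \<and>
    (\<lambda>i. \<integral>y. (f (X i) y - f w y) / (X i - w) \<partial>M) \<longlonglongrightarrow> (\<integral>y. deriv (\<lambda>w. f w y) w \<partial>M)"
    if X: "\<And>i. X i \<in> ball w r - {w}" "X \<longlonglongrightarrow> w" for X
  proof -
    have XS: "X i \<in> S" for i using X(1)[of i] sub[of "X i"] r by auto
    have [measurable]: "f (X i) \<in> borel_measurable M" "f w \<in> borel_measurable M" for i
      using meas XS S by auto
    have lim: "(\<lambda>i. (f (X i) y - f w y) / (X i - w)) \<longlonglongrightarrow> deriv (\<lambda>w. f w y) w" if "y \<in> space M" for y
    proof -
      have "((\<lambda>x. (f x y - f w y) / (x - w)) \<longlongrightarrow> deriv (\<lambda>w. f w y) w) (at w)"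
        using dd[OF that S(2)] by (simp add: has_field_derivative_iff)
      then show ?thesis
        using X by (auto simp: tendsto_at_iff_sequentially o_def)
    qed
    have meas': "(\<lambda>y. deriv (\<lambda>w. f w y) w) \<in> borel_measurable M"
      by (rule borel_measurable_LIMSEQ_metric[OF _ lim]) auto
    have gi: "integrable M (\<lambda>y. g y / r)" using g by auto
    show ?thesis
      using X quot lim
      by (intro conjI integrable_dominated_convergence[OF meas' _ gi, of "\<lambda>i y. (f (X i) y - f w y) / (X i - w)"]
               integral_dominated_convergence[OF meas' _ gi]) auto
  qed
  \<comment> \<open>One concrete sequence tending to \<open>w\<close> suffices for integrability of
    the derivative; the shift by 2 keeps it strictly inside the ball.\<close>
  have ex: "\<And>i. w + of_real (r / (real i + 2)) \<in> ball w r - {w}"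
    using r by (auto simp: dist_norm norm_mult norm_divide field_simps intro!: add_pos_nonneg
        simp flip: of_real_divide of_real_add)
  have "(\<lambda>i. w + of_real (r / (real i + 2))) \<longlonglongrightarrow> w + of_real 0"
    by (intro tendsto_intros) real_asymp
  then show "integrable M (\<lambda>y. deriv (\<lambda>w. f w y) w)" using main[OF ex] by simp
  show "((\<lambda>w. \<integral>y. f w y \<partial>M) has_field_derivative (\<integral>y. deriv (\<lambda>w. f w y) w \<partial>M)) (at w)"
    unfolding has_field_derivative_iff tendsto_at_iff_sequentially
  proof (intro allI impI)
    fix X assume X: "\<forall>i. X i \<in> UNIV - {w}" "X \<longlonglongrightarrow> w"
    have "eventually (\<lambda>i. X i \<in> ball w r) sequentially"
      using X(2) r by (auto simp: tendsto_iff dist_commute)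
    then obtain N where N: "\<And>i. i \<ge> N \<Longrightarrow> X i \<in> ball w r" by (auto simp: eventually_sequentially)
    have 1: "\<And>i. X (i + N) \<in> ball w r - {w}" using X(1) N by auto
    have 2: "(\<lambda>i. X (i + N)) \<longlonglongrightarrow> w" using X(2) LIMSEQ_ignore_initial_segment by blast
    have "X (i + N) \<in> S" for i using 1[of i] sub[of "X (i + N)"] r by auto
    then have "(\<integral>y. (f (X (i + N)) y - f w y) / (X (i + N) - w) \<partial>M)
        = ((\<integral>y. f (X (i + N)) y \<partial>M) - (\<integral>y. f w y \<partial>M)) / (X (i + N) - w)" for i
      using int S(2) by (subst integral_divide_zero) simp
    then have "(\<lambda>i. ((\<integral>y. f (X (i + N)) y \<partial>M) - (\<integral>y. f w y \<partial>M)) / (X (i + N) - w)) \<longlonglongrightarrow> (\<integral>y. deriv (\<lambda>w. f w y) w \<partial>M)"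
      using main[OF 1 2] by (simp del: integral_divide_zero)
    then have "(\<lambda>i. ((\<lambda>x. ((\<integral>y. f x y \<partial>M) - (\<integral>y. f w y \<partial>M)) / (x - w)) \<circ> X) (i + N)) \<longlonglongrightarrow> (\<integral>y. deriv (\<lambda>w. f w y) w \<partial>M)"
      by simp
    then show "((\<lambda>x. ((\<integral>y. f x y \<partial>M) - (\<integral>y. f w y \<partial>M)) / (x - w)) \<circ> X) \<longlonglongrightarrow> (\<integral>y. deriv (\<lambda>w. f w y) w \<partial>M)"
      by (rule LIMSEQ_offset)
  qed
qed

lemma holomorphic_parameter_integral:
  fixes f :: "complex \<Rightarrow> 'b \<Rightarrow> complex"
  assumes "open S"
    and "\<And>w. w \<in> S \<Longrightarrow> f w \<in> borel_measurable M"
    and "\<And>y. y \<in> space M \<Longrightarrow> (\<lambda>w. f w y) holomorphic_on S"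
    and "integrable M g"
    and "\<And>w y. w \<in> S \<Longrightarrow> y \<in> space M \<Longrightarrow> norm (f w y) \<le> g y"
  shows "(\<lambda>w. \<integral>y. f w y \<partial>M) holomorphic_on S"
  using has_field_derivative_parameter_integral(2)[OF assms(1) _ assms(2-5)]
  by (auto simp: holomorphic_on_open[OF assms(1)])

section \<open>Holomorphic functions on horizontal strips\<close>

text \<open>In the coordinate w = log s this is an unbounded sector, with the bounds on the argument
  as parameters.\<close>

definition hstrip :: "real \<Rightarrow> real \<Rightarrow> complex set" where
  "hstrip a b = {w. a < Im w \<and> Im w < b}"

text \<open>Decay at both ends, uniform on closed substrips: the class in which a horizontal line of
  integration may be moved. The constants may deteriorate towards the edges of the strip.\<close>

definition decaying :: "real \<Rightarrow> real \<Rightarrow> (complex \<Rightarrow> complex) \<Rightarrow> bool" where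
  "decaying a b H \<longleftrightarrow> H holomorphic_on hstrip a b \<and>
     (\<forall>a' b'. a < a' \<and> b' < b \<longrightarrow>
        (\<exists>A>0. \<exists>\<delta>>0. \<forall>w. a' \<le> Im w \<and> Im w \<le> b' \<longrightarrow> norm (H w) \<le> A * exp (- \<delta> * \<bar>Re w\<bar>)))"

text \<open>The class of the kernels: with s = exp w the bound reads |s|^\<delta> exp(-c
  |s|^\<kappa>). The power expresses integrability of e(s)/s at the origin, the exponential is
  flatness of order \<kappa>.\<close>

definition flat :: "real \<Rightarrow> real \<Rightarrow> (complex \<Rightarrow> complex) \<Rightarrow> bool" where
  "flat \<kappa> \<alpha> e \<longleftrightarrow> e holomorphic_on hstrip (- \<alpha>) \<alpha> \<and>
     (\<forall>\<alpha>'<\<alpha>. \<exists>A>0. \<exists>c>0. \<exists>\<delta>>0. \<forall>w. \<bar>Im w\<bar> \<le> \<alpha>' \<longrightarrow>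
        norm (e w) \<le> A * exp (\<delta> * Re w - c * exp (\<kappa> * Re w)))"

text \<open>The class paired with kernels, with bound |s|^\<sigma>. The case \<sigma> = 0 serves
  Borel transforms, and \<sigma> = Re u serves the powers s^u of Mellin transforms.\<close>

definition moderate :: "real \<Rightarrow> real \<Rightarrow> real \<Rightarrow> (complex \<Rightarrow> complex) \<Rightarrow> bool" where
  "moderate \<sigma> a b f \<longleftrightarrow> f holomorphic_on hstrip a b \<and>
     (\<forall>a' b'. a < a' \<and> b' < b \<longrightarrow>
        (\<exists>A>0. \<forall>w. a' \<le> Im w \<and> Im w \<le> b' \<longrightarrow> norm (f w) \<le> A * exp (\<sigma> * Re w)))"

lemma open_hstrip [simp, intro]: "open (hstrip a b)"
proof -
  have "hstrip a b = {w. a < Im w} \<inter> {w. Im w < b}" by (auto simp: hstrip_def)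
  then show ?thesis by (simp add: open_Int open_halfspace_Im_gt open_halfspace_Im_lt)
qed

lemma convex_hstrip [simp, intro]: "convex (hstrip a b)"
proof -
  have "hstrip a b = {w. Im w > a} \<inter> {w. Im w < b}" by (auto simp: hstrip_def)
  then show ?thesis by (simp add: convex_Int convex_halfspace_Im_gt convex_halfspace_Im_lt)
qed

lemma norm_deriv_le:
  assumes "f holomorphic_on S" "cball w r \<subseteq> S" "r > 0"
    and "\<And>z. z \<in> cball w r \<Longrightarrow> norm (f z) \<le> B"
  shows "norm (deriv f w) \<le> B / r"
proof -
  have "norm ((deriv ^^ 1) f w) \<le> fact 1 * B / r ^ 1"
  proof (rule Cauchy_inequality)
    show "f holomorphic_on ball w r"
      using assms by (meson ball_subset_cball holomorphic_on_subset order_trans)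
    show "continuous_on (cball w r) f"
      using assms by (meson holomorphic_on_imp_continuous_on holomorphic_on_subset)
    show "norm (f z) \<le> B" if "norm (w - z) = r" for z
      using assms(4)[of z] that by (simp add: dist_norm)
  qed (use assms in auto)
  then show ?thesis by simp
qed

lemma cball_Re_Im:
  assumes "z \<in> cball w r"
  shows "\<bar>Re z - Re w\<bar> \<le> r" "\<bar>Im z - Im w\<bar> \<le> r"
proof -
  have "norm (z - w) \<le> r" using assms by (simp add: dist_norm norm_minus_commute)
  then show "\<bar>Re z - Re w\<bar> \<le> r" "\<bar>Im z - Im w\<bar> \<le> r"
    using abs_Re_le_cmod[of "z - w"] abs_Im_le_cmod[of "z - w"] by auto
qed

text \<open>For x at least 0, exp(\<kappa> x) exceeds (\<kappa> x)^2 / 2, and completing the square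
  bounds the resulting parabola. The constant is twice its maximum, which is good enough.\<close>

lemma exp_dominates_linear:
  fixes s c \<kappa> :: real
  assumes "0 \<le> s" "0 < c" "0 < \<kappa>"
  obtains B where "0 \<le> B" "\<And>x. s * x - c * exp (\<kappa> * x) \<le> B"
proof
  show "0 \<le> s\<^sup>2 / (c * \<kappa>\<^sup>2)" using assms by simp
  fix x :: real
  show "s * x - c * exp (\<kappa> * x) \<le> s\<^sup>2 / (c * \<kappa>\<^sup>2)"
  proof (cases "x \<ge> 0")
    case True
    have "(\<kappa> * x)\<^sup>2 / 2 \<le> exp (\<kappa> * x)"
      using exp_lower_Taylor_quadratic[of "\<kappa> * x"] True assms by (smt (verit) mult_nonneg_nonneg)
    then have "c * ((\<kappa> * x)\<^sup>2 / 2) \<le> c * exp (\<kappa> * x)" using assms by simp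
    moreover have "s * x \<le> c * ((\<kappa> * x)\<^sup>2 / 2) + s\<^sup>2 / (c * \<kappa>\<^sup>2)"
    proof -
      have "0 \<le> (c * \<kappa>\<^sup>2 * x - s)\<^sup>2 + s\<^sup>2" by simp
      also have "\<dots> = 2 * (c * \<kappa>\<^sup>2) * (c * ((\<kappa> * x)\<^sup>2 / 2) + s\<^sup>2 / (c * \<kappa>\<^sup>2) - s * x)"
        using assms by (simp add: field_simps power2_eq_square)
      finally have "0 \<le> c * ((\<kappa> * x)\<^sup>2 / 2) + s\<^sup>2 / (c * \<kappa>\<^sup>2) - s * x"
        using mult_pos_pos[of "2 * (c * \<kappa>\<^sup>2)"] assms by (subst (asm) zero_le_mult_iff) (auto simp: not_le[symmetric] mult_le_0_iff)
      then show ?thesis by simp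
    qed
    ultimately show ?thesis by linarith
  next
    case False
    then have "s * x \<le> 0" "0 \<le> c * exp (\<kappa> * x)" using assms by (auto simp: mult_nonneg_nonpos)
    moreover have "0 \<le> s\<^sup>2 / (c * \<kappa>\<^sup>2)" using assms by simp
    ultimately show ?thesis by linarith
  qed
qed

lemma integrable_exp_minus_abs:
  assumes "0 < \<delta>"
  shows "integrable lborel (\<lambda>x::real. exp (- \<delta> * \<bar>x\<bar>))"
proof -
  have 1: "integrable lborel (\<lambda>x::real. inverse (1 + x\<^sup>2))"
    using integrable_inverse_1_plus_square by (simp add: set_integrable_def)
  show ?thesis
  proof (rule Bochner_Integration.integrable_bound)
    show "integrable lborel (\<lambda>x::real. (1 + 2 / \<delta>\<^sup>2) * inverse (1 + x\<^sup>2))" using 1 by simp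
    \<comment> \<open>The factor 1 + 2 / \<delta>^2 is chosen so that its product with 1 +
      \<delta>^2 x^2 / 2 dominates 1 + x^2 for every positive \<delta>.\<close>
    have "exp (- \<delta> * \<bar>x\<bar>) \<le> (1 + 2 / \<delta>\<^sup>2) * inverse (1 + x\<^sup>2)" for x :: real
    proof -
      have "1 + (\<delta> * \<bar>x\<bar>)\<^sup>2 / 2 \<le> exp (\<delta> * \<bar>x\<bar>)"
        using exp_lower_Taylor_quadratic[of "\<delta> * \<bar>x\<bar>"] assms by (smt (verit) mult_nonneg_nonneg abs_ge_zero)
      then have "(1 + 2 / \<delta>\<^sup>2) * (1 + \<delta>\<^sup>2 * x\<^sup>2 / 2) \<le> (1 + 2 / \<delta>\<^sup>2) * exp (\<delta> * \<bar>x\<bar>)"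
        using assms by (intro mult_left_mono) (auto simp: power_mult_distrib)
      moreover have "1 + x\<^sup>2 \<le> (1 + 2 / \<delta>\<^sup>2) * (1 + \<delta>\<^sup>2 * x\<^sup>2 / 2)"
        using assms by (simp add: field_simps)
      ultimately have "1 + x\<^sup>2 \<le> (1 + 2 / \<delta>\<^sup>2) * exp (\<delta> * \<bar>x\<bar>)" by linarith
      moreover have "0 < 1 + x\<^sup>2" by (simp add: add_pos_nonneg)
      ultimately show ?thesis by (simp add: exp_minus field_simps)
    qed
    then show "AE x in lborel. norm (exp (- \<delta> * \<bar>x\<bar>)) \<le> norm ((1 + 2 / \<delta>\<^sup>2) * inverse (1 + x\<^sup>2))"
      by (intro AE_I2) (simp add: abs_of_nonneg)
  qed auto
qed

lemma continuous_on_line: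
  assumes "f holomorphic_on hstrip a b" "a < \<theta>" "\<theta> < b"
  shows "continuous_on UNIV (\<lambda>x. f (Complex x \<theta>))"
proof -
  have "continuous_on UNIV (\<lambda>x. Complex x \<theta>)"
    unfolding Complex_eq by (intro continuous_intros)
  then show ?thesis
    by (rule continuous_on_compose2[OF holomorphic_on_imp_continuous_on[OF assms(1)]])
       (use assms in \<open>auto simp: hstrip_def\<close>)
qed

lemma borel_measurable_line:
  assumes "f holomorphic_on hstrip a b" "a < \<theta>" "\<theta> < b"
  shows "(\<lambda>x. f (Complex x \<theta>)) \<in> borel_measurable borel"
  using continuous_on_line[OF assms] by (rule borel_measurable_continuous_onI)

section \<open>Decaying functions and moving the line of integration\<close>

lemma decayingD:
  assumes "decaying a b H" "a < a'" "b' < b"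
  obtains A \<delta> where "A > 0" "\<delta> > 0" "\<And>w. a' \<le> Im w \<Longrightarrow> Im w \<le> b' \<Longrightarrow> norm (H w) \<le> A * exp (- \<delta> * \<bar>Re w\<bar>)"
  using assms unfolding decaying_def by blast

lemma decaying_integrable:
  assumes "decaying a b H" "a < \<theta>" "\<theta> < b"
  shows "integrable lborel (\<lambda>x. H (Complex x \<theta>))"
proof -
  obtain A \<delta> where A: "\<delta> > 0" "A > 0" "\<And>w. \<theta> \<le> Im w \<Longrightarrow> Im w \<le> \<theta> \<Longrightarrow> norm (H w) \<le> A * exp (- \<delta> * \<bar>Re w\<bar>)"
    using decayingD[OF assms] by metis
  show ?thesis
  proof (rule Bochner_Integration.integrable_bound)
    show "integrable lborel (\<lambda>x. A * exp (- \<delta> * \<bar>x\<bar>))" using integrable_exp_minus_abs[OF A(1)] by simp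
    show "(\<lambda>x. H (Complex x \<theta>)) \<in> borel_measurable lborel"
      using borel_measurable_line assms by (auto simp: decaying_def)
    show "AE x in lborel. norm (H (Complex x \<theta>)) \<le> norm (A * exp (- \<delta> * \<bar>x\<bar>))"
      using A(3)[of "Complex _ \<theta>"] A(2) by (intro AE_I2) simp
  qed
qed

text \<open>The integral over a horizontal line through the point w is invariant under real
  translations of w, so its complex derivative vanishes.\<close>

lemma decaying_translate_has_derivative_0:
  assumes H: "decaying a b H" and w: "w \<in> hstrip a b"
  shows "((\<lambda>w. \<integral>x. H (w + of_real x) \<partial>lborel) has_field_derivative 0) (at w)"
    and "(\<integral>x. deriv H (w + of_real x) \<partial>lborel) = 0"
proof -
  have hol: "H holomorphic_on hstrip a b" using H by (simp add: decaying_def)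
  define a' where "a' = (a + Im w) / 2"
  define b' where "b' = (Im w + b) / 2"
  have ab: "a < a'" "a' < Im w" "Im w < b'" "b' < b" using w by (auto simp: a'_def b'_def hstrip_def)
  obtain A \<delta> where A: "\<delta> > 0" "A > 0" "\<And>w. a' \<le> Im w \<Longrightarrow> Im w \<le> b' \<Longrightarrow> norm (H w) \<le> A * exp (- \<delta> * \<bar>Re w\<bar>)"
    using decayingD[OF H ab(1) ab(4)] by metis
  define S where "S = hstrip a' b' \<inter> ball w 1"
  have S: "open S" "w \<in> S" using ab by (auto simp: S_def hstrip_def[symmetric], simp add: hstrip_def)
  \<comment> \<open>Within the unit ball about \<open>w\<close> the real part moves by less than 1,
    so |Re v + x| is at least |x| - (|Re w| + 1); this produces the extra exponential
    factor.\<close>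
  let ?g = "\<lambda>x. A * exp (\<delta> * (\<bar>Re w\<bar> + 1)) * exp (- \<delta> * \<bar>x\<bar>)"
  have meas: "(\<lambda>x. H (v + of_real x)) \<in> borel_measurable lborel" if "v \<in> S" for v
  proof -
    have "continuous_on UNIV (\<lambda>x. H (v + of_real x))"
      by (rule continuous_on_compose2[OF holomorphic_on_imp_continuous_on[OF hol]])
         (use that ab in \<open>auto simp: hstrip_def S_def intro!: continuous_intros\<close>)
    then show ?thesis using borel_measurable_continuous_onI by auto
  qed
  have hol': "(\<lambda>v. H (v + of_real x)) holomorphic_on S" for x
  proof -
    have "(H \<circ> (\<lambda>v. v + of_real x)) holomorphic_on S"
      by (rule holomorphic_on_compose_gen[OF _ hol])
         (use ab in \<open>auto simp: S_def hstrip_def intro!: holomorphic_intros\<close>)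
    then show ?thesis by (simp add: o_def)
  qed
  have g: "integrable lborel ?g" using integrable_exp_minus_abs[OF A(1)] by simp
  have bound: "norm (H (v + of_real x)) \<le> ?g x" if "v \<in> S" for v x
  proof -
    have "\<bar>Re v - Re w\<bar> < 1"
      using that abs_Re_le_cmod[of "v - w"] by (auto simp: S_def dist_norm norm_minus_commute)
    then have "\<bar>x\<bar> - (\<bar>Re w\<bar> + 1) \<le> \<bar>Re v + x\<bar>" by linarith
    then have "- \<delta> * \<bar>Re v + x\<bar> \<le> \<delta> * (\<bar>Re w\<bar> + 1) + - \<delta> * \<bar>x\<bar>"
      using mult_left_mono[of "\<bar>x\<bar> - (\<bar>Re w\<bar> + 1)" "\<bar>Re v + x\<bar>" \<delta>] A(1) by (simp add: algebra_simps)
    then have "A * exp (- \<delta> * \<bar>Re v + x\<bar>) \<le> ?g x"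
      using A(2) by (simp add: exp_add[symmetric])
    moreover have "norm (H (v + of_real x)) \<le> A * exp (- \<delta> * \<bar>Re v + x\<bar>)"
      using A(3)[of "v + of_real x"] that ab by (auto simp: S_def hstrip_def)
    ultimately show ?thesis by linarith
  qed
  define \<Phi> where "\<Phi> = (\<lambda>w. \<integral>x. H (w + of_real x) \<partial>lborel)"
  define D where "D = (\<integral>x. deriv (\<lambda>w. H (w + of_real x)) w \<partial>lborel)"
  have D: "(\<Phi> has_field_derivative D) (at w)"
    unfolding \<Phi>_def D_def
    by (rule has_field_derivative_parameter_integral(2)[OF S meas hol' g bound])
  have inv: "\<Phi> (w + of_real h) = \<Phi> w" for h
  proof -
    have "\<Phi> w = (\<integral>x. H (w + of_real (h + 1 * x)) \<partial>lborel)"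
      using lborel_integral_real_affine[of 1 "\<lambda>x. H (w + of_real x)" h] by (simp add: \<Phi>_def)
    then show ?thesis by (simp add: \<Phi>_def add_ac)
  qed
  have "(\<lambda>i. (\<Phi> (w + of_real (1 / real (Suc i))) - \<Phi> w) / of_real (1 / real (Suc i))) \<longlonglongrightarrow> D"
  proof -
    have "((\<lambda>h. (\<Phi> (w + h) - \<Phi> w) / h) \<longlongrightarrow> D) (at 0)"
      using D by (simp add: DERIV_def)
    moreover have "filterlim (\<lambda>i. complex_of_real (1 / real (Suc i))) (at 0) sequentially"
    proof (rule filterlim_atI)
      have "(\<lambda>i. complex_of_real (1 / real (Suc i))) \<longlonglongrightarrow> of_real 0"
        by (intro tendsto_of_real LIMSEQ_Suc lim_1_over_n)
      then show "(\<lambda>i. complex_of_real (1 / real (Suc i))) \<longlonglongrightarrow> 0" by simp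
    qed (auto simp del: of_nat_Suc)
    ultimately show ?thesis by (rule filterlim_compose)
  qed
  then have "D = 0"
    unfolding inv by (simp add: LIMSEQ_const_iff)
  with D show "((\<lambda>w. \<integral>x. H (w + of_real x) \<partial>lborel) has_field_derivative 0) (at w)" by (simp add: \<Phi>_def)
  have "deriv (\<lambda>w. H (w + of_real x)) w = deriv H (w + of_real x)" for x
    unfolding deriv_def by (simp add: DERIV_shift)
  with \<open>D = 0\<close> show "(\<integral>x. deriv H (w + of_real x) \<partial>lborel) = 0" by (simp add: D_def)
qed

text \<open>This is integration by parts on a line, the boundary terms being absorbed in the
  translation argument.\<close>

lemma line_integral_deriv_eq_0:
  assumes "decaying a b H" "a < \<theta>" "\<theta> < b"
  shows "(\<integral>x. deriv H (Complex x \<theta>) \<partial>lborel) = 0"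
proof -
  have "Complex 0 \<theta> + of_real x = Complex x \<theta>" for x by (simp add: complex_eq_iff)
  with decaying_translate_has_derivative_0(2)[OF assms(1), of "Complex 0 \<theta>"] assms
  show ?thesis by (simp add: hstrip_def)
qed

text \<open>The integral as a function of a complex base point has derivative 0 on a convex strip,
  so it is constant across heights. This replaces Cauchy's theorem on long rectangles.\<close>

lemma line_integral_shift:
  assumes H: "decaying a b H" and \<theta>: "a < \<theta>" "\<theta> < b" and \<theta>': "a < \<theta>'" "\<theta>' < b"
  shows "(\<integral>x. H (Complex x \<theta>) \<partial>lborel) = (\<integral>x. H (Complex x \<theta>') \<partial>lborel)"
proof -
  have eq: "Complex 0 t + of_real x = Complex x t" for x t by (simp add: complex_eq_iff)
  have "\<exists>c. \<forall>w\<in>hstrip a b. (\<integral>x. H (w + of_real x) \<partial>lborel) = c"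
    using decaying_translate_has_derivative_0(1)[OF H]
    by (intro has_field_derivative_zero_constant convex_hstrip) (auto intro: has_field_derivative_at_within)
  moreover have "Complex 0 \<theta> \<in> hstrip a b" "Complex 0 \<theta>' \<in> hstrip a b"
    using \<theta> \<theta>' by (auto simp: hstrip_def)
  ultimately have "(\<integral>x. H (Complex 0 \<theta> + of_real x) \<partial>lborel) = (\<integral>x. H (Complex 0 \<theta>' + of_real x) \<partial>lborel)"
    by metis
  then show ?thesis by (simp add: eq)
qed

section \<open>Closure properties of flat and moderate functions\<close>

lemma flatD:
  assumes "flat \<kappa> \<alpha> e" "\<alpha>' < \<alpha>"
  obtains A c \<delta> where "A > 0" "c > 0" "\<delta> > 0"
    "\<And>w. \<bar>Im w\<bar> \<le> \<alpha>' \<Longrightarrow> norm (e w) \<le> A * exp (\<delta> * Re w - c * exp (\<kappa> * Re w))"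
  using assms unfolding flat_def by blast

lemma moderateD:
  assumes "moderate \<sigma> a b f" "a < a'" "b' < b"
  obtains A where "A > 0" "\<And>w. a' \<le> Im w \<Longrightarrow> Im w \<le> b' \<Longrightarrow> norm (f w) \<le> A * exp (\<sigma> * Re w)"
  using assms unfolding moderate_def by blast

text \<open>The strip consists of the heights at which both factors are defined. On the right the
  double exponential beats any growth exp(\<sigma> Re w); on the left the rates \<delta> and
  \<sigma> add up.\<close>

lemma decaying_flat_mult_moderate:
  assumes e: "flat \<kappa> \<alpha> e" and f: "moderate \<sigma> a b f" and "0 < \<kappa>" "0 \<le> \<sigma>"
  shows "decaying (max a (Im t - \<alpha>)) (min b (Im t + \<alpha>)) (\<lambda>w. e (w - t) * f w)"
  unfolding decaying_def
proof (intro conjI allI impI)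
  have "(e \<circ> (\<lambda>w. w - t)) holomorphic_on hstrip (max a (Im t - \<alpha>)) (min b (Im t + \<alpha>))"
  proof (rule holomorphic_on_compose_gen)
    show "e holomorphic_on hstrip (- \<alpha>) \<alpha>" using e by (simp add: flat_def)
  qed (auto simp: hstrip_def intro!: holomorphic_intros)
  moreover have "f holomorphic_on hstrip (max a (Im t - \<alpha>)) (min b (Im t + \<alpha>))"
    using f by (auto simp: moderate_def hstrip_def elim: holomorphic_on_subset)
  ultimately show "(\<lambda>w. e (w - t) * f w) holomorphic_on hstrip (max a (Im t - \<alpha>)) (min b (Im t + \<alpha>))"
    by (auto simp: o_def intro!: holomorphic_intros)
  fix a' b' assume ab: "max a (Im t - \<alpha>) < a' \<and> b' < min b (Im t + \<alpha>)"
  define \<alpha>' where "\<alpha>' = max (Im t - a') (b' - Im t)"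
  have "\<alpha>' < \<alpha>" using ab by (auto simp: \<alpha>'_def)
  then obtain A c \<delta> where A: "A > 0" "c > 0" "\<delta> > 0"
    "\<And>w. \<bar>Im w\<bar> \<le> \<alpha>' \<Longrightarrow> norm (e w) \<le> A * exp (\<delta> * Re w - c * exp (\<kappa> * Re w))"
    using flatD[OF e] by metis
  obtain C where C: "C > 0" "\<And>w. a' \<le> Im w \<Longrightarrow> Im w \<le> b' \<Longrightarrow> norm (f w) \<le> C * exp (\<sigma> * Re w)"
    using moderateD[OF f, of a' b'] ab by auto
  define \<epsilon> where "\<epsilon> = \<delta> + \<sigma>"
  define T where "T = Re t"
  have c': "c * exp (- \<kappa> * T) > 0" using A by simp
  \<comment> \<open>The slope is doubled so that, after bounding \<epsilon> x + \<epsilon> x, one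
    copy is left over as decay -\<epsilon> x on the right.\<close>
  obtain B where B: "0 \<le> B" "\<And>x. (\<epsilon> + \<epsilon>) * x - c * exp (- \<kappa> * T) * exp (\<kappa> * x) \<le> B"
    using exp_dominates_linear[of "\<epsilon> + \<epsilon>" "c * exp (- \<kappa> * T)" \<kappa>] A \<open>0 < \<kappa>\<close> \<open>0 \<le> \<sigma>\<close> c'
    by (auto simp: \<epsilon>_def)
  have key: "norm (e (w - t) * f w) \<le> A * C * exp (B - \<delta> * T) * exp (- \<epsilon> * \<bar>Re w\<bar>)"
    if w: "a' \<le> Im w" "Im w \<le> b'" for w
  proof -
    let ?x = "Re w"
    have "\<bar>Im (w - t)\<bar> \<le> \<alpha>'" using w by (auto simp: \<alpha>'_def)
    from mult_mono[OF A(4)[OF this] C(2)[OF w]]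
    have "norm (e (w - t) * f w) \<le> A * exp (\<delta> * (?x - T) - c * exp (\<kappa> * (?x - T))) * (C * exp (\<sigma> * ?x))"
      using A by (simp add: norm_mult T_def)
    also have "\<dots> = A * C * exp (- \<delta> * T) * exp (\<epsilon> * ?x - c * exp (- \<kappa> * T) * exp (\<kappa> * ?x))"
    proof -
      have 1: "exp (\<kappa> * (?x - T)) = exp (- \<kappa> * T) * exp (\<kappa> * ?x)"
        by (simp add: exp_add[symmetric] algebra_simps)
      have 2: "\<delta> * (?x - T) - c * exp (\<kappa> * (?x - T)) + \<sigma> * ?x = - \<delta> * T + (\<epsilon> * ?x - c * exp (- \<kappa> * T) * exp (\<kappa> * ?x))"
        unfolding 1 by (simp add: algebra_simps \<epsilon>_def)
      have "A * exp (\<delta> * (?x - T) - c * exp (\<kappa> * (?x - T))) * (C * exp (\<sigma> * ?x))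
          = A * C * exp (\<delta> * (?x - T) - c * exp (\<kappa> * (?x - T)) + \<sigma> * ?x)"
        by (simp add: exp_add)
      also have "\<dots> = A * C * exp (- \<delta> * T) * exp (\<epsilon> * ?x - c * exp (- \<kappa> * T) * exp (\<kappa> * ?x))"
        unfolding 2 exp_add by simp
      finally show ?thesis .
    qed
    also have "\<dots> \<le> A * C * exp (- \<delta> * T) * exp (B - \<epsilon> * \<bar>?x\<bar>)"
    proof -
      have "\<epsilon> * ?x - c * exp (- \<kappa> * T) * exp (\<kappa> * ?x) \<le> B - \<epsilon> * \<bar>?x\<bar>"
      proof (cases "?x \<ge> 0")
        case True
        then show ?thesis using B(2)[of ?x] by (simp add: algebra_simps)
      next
        case False
        have "0 \<le> c * exp (- \<kappa> * T) * exp (\<kappa> * ?x)" using A by simp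
        then show ?thesis using B(1) False by simp
      qed
      then show ?thesis using A C by (intro mult_left_mono) auto
    qed
    also have "\<dots> = A * C * exp (B - \<delta> * T) * exp (- \<epsilon> * \<bar>?x\<bar>)"
      by (simp add: exp_diff exp_minus field_simps)
    finally show ?thesis .
  qed
  have "\<epsilon> > 0" "A * C * exp (B - \<delta> * T) > 0" using A C \<open>0 \<le> \<sigma>\<close> by (auto simp: \<epsilon>_def)
  then show "\<exists>A>0. \<exists>\<delta>>0. \<forall>w. a' \<le> Im w \<and> Im w \<le> b' \<longrightarrow> norm (e (w - t) * f w) \<le> A * exp (- \<delta> * \<bar>Re w\<bar>)"
    using key by blast
qed

text \<open>Cauchy's estimate on discs of radius half the margin. Moving the real part by
  \<open>r\<close> costs a factor exp(\<delta> r) and turns \<open>c\<close> into c exp(-\<kappa>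
  r), so the shape of the bound persists.\<close>

lemma flat_deriv:
  assumes e: "flat \<kappa> \<alpha> e" and \<kappa>: "0 \<le> \<kappa>"
  shows "flat \<kappa> \<alpha> (deriv e)"
  unfolding flat_def
proof (intro conjI allI impI)
  have hol: "e holomorphic_on hstrip (- \<alpha>) \<alpha>" using e by (simp add: flat_def)
  then show "deriv e holomorphic_on hstrip (- \<alpha>) \<alpha>" by (simp add: holomorphic_deriv)
  fix \<alpha>' assume "\<alpha>' < \<alpha>"
  define r where "r = (\<alpha> - \<alpha>') / 2"
  have r: "r > 0" "\<alpha>' + r < \<alpha>" using \<open>\<alpha>' < \<alpha>\<close> by (auto simp: r_def field_simps)
  obtain A c \<delta> where A: "A > 0" "c > 0" "\<delta> > 0"
    "\<And>w. \<bar>Im w\<bar> \<le> \<alpha>' + r \<Longrightarrow> norm (e w) \<le> A * exp (\<delta> * Re w - c * exp (\<kappa> * Re w))"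
    using flatD[OF e r(2)] by metis
  have key: "norm (deriv e w) \<le> (A * exp (\<delta> * r) / r) * exp (\<delta> * Re w - (c * exp (- \<kappa> * r)) * exp (\<kappa> * Re w))"
    if w: "\<bar>Im w\<bar> \<le> \<alpha>'" for w
  proof -
    have "norm (deriv e w) \<le> A * exp (\<delta> * (Re w + r) - c * exp (\<kappa> * (Re w - r))) / r"
    proof (rule norm_deriv_le[OF hol _ r(1)])
      show "cball w r \<subseteq> hstrip (- \<alpha>) \<alpha>"
        using w r cball_Re_Im(2)[of _ w r] by (force simp: hstrip_def)
      fix z assume z: "z \<in> cball w r"
      have "\<bar>Im z\<bar> \<le> \<alpha>' + r" using cball_Re_Im(2)[OF z] w by linarith
      then have "norm (e z) \<le> A * exp (\<delta> * Re z - c * exp (\<kappa> * Re z))" using A(4) by blast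
      also have "\<dots> \<le> A * exp (\<delta> * (Re w + r) - c * exp (\<kappa> * (Re w - r)))"
        using A cball_Re_Im(1)[OF z] \<kappa>
        by (intro mult_left_mono) (auto intro!: diff_mono mult_left_mono)
      finally show "norm (e z) \<le> A * exp (\<delta> * (Re w + r) - c * exp (\<kappa> * (Re w - r)))" .
    qed
    also have "\<dots> = (A * exp (\<delta> * r) / r) * exp (\<delta> * Re w - (c * exp (- \<kappa> * r)) * exp (\<kappa> * Re w))"
    proof -
      have 1: "exp (\<kappa> * (Re w - r)) = exp (- \<kappa> * r) * exp (\<kappa> * Re w)"
        by (simp add: exp_add[symmetric] algebra_simps)
      have 2: "\<delta> * (Re w + r) - c * exp (\<kappa> * (Re w - r)) = \<delta> * r + (\<delta> * Re w - (c * exp (- \<kappa> * r)) * exp (\<kappa> * Re w))"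
        unfolding 1 by (simp add: algebra_simps)
      show ?thesis unfolding 2 exp_add by simp
    qed
    finally show ?thesis .
  qed
  have "A * exp (\<delta> * r) / r > 0" "c * exp (- \<kappa> * r) > 0" using A r by auto
  with A(3) key show "\<exists>A>0. \<exists>c>0. \<exists>\<delta>>0. \<forall>w. \<bar>Im w\<bar> \<le> \<alpha>' \<longrightarrow> norm (deriv e w) \<le> A * exp (\<delta> * Re w - c * exp (\<kappa> * Re w))"
    by blast
qed

lemma moderate_deriv:
  assumes f: "moderate \<sigma> a b f" and \<sigma>: "0 \<le> \<sigma>"
  shows "moderate \<sigma> a b (deriv f)"
  unfolding moderate_def
proof (intro conjI allI impI)
  have hol: "f holomorphic_on hstrip a b" using f by (simp add: moderate_def)
  then show "deriv f holomorphic_on hstrip a b" by (simp add: holomorphic_deriv)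
  fix a' b' assume ab: "a < a' \<and> b' < b"
  define r where "r = min (a' - a) (b - b') / 2"
  have r: "r > 0" "a < a' - r" "b' + r < b" using ab by (auto simp: r_def field_simps min_def)
  obtain A where A: "A > 0" "\<And>w. a' - r \<le> Im w \<Longrightarrow> Im w \<le> b' + r \<Longrightarrow> norm (f w) \<le> A * exp (\<sigma> * Re w)"
    using moderateD[OF f r(2,3)] by metis
  have key: "norm (deriv f w) \<le> (A * exp (\<sigma> * r) / r) * exp (\<sigma> * Re w)"
    if w: "a' \<le> Im w \<and> Im w \<le> b'" for w
  proof -
    have "norm (deriv f w) \<le> A * exp (\<sigma> * (Re w + r)) / r"
    proof (rule norm_deriv_le[OF hol _ r(1)])
      show "cball w r \<subseteq> hstrip a b"
        using w r cball_Re_Im(2)[of _ w r] by (force simp: hstrip_def)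
      fix z assume z: "z \<in> cball w r"
      have "a' - r \<le> Im z" "Im z \<le> b' + r" using cball_Re_Im(2)[OF z] w by linarith+
      then have "norm (f z) \<le> A * exp (\<sigma> * Re z)" using A(2) by blast
      also have "\<dots> \<le> A * exp (\<sigma> * (Re w + r))"
        using A cball_Re_Im(1)[OF z] \<sigma>
        by (intro mult_left_mono) (auto intro!: mult_left_mono)
      finally show "norm (f z) \<le> A * exp (\<sigma> * (Re w + r))" .
    qed
    also have "\<dots> = (A * exp (\<sigma> * r) / r) * exp (\<sigma> * Re w)"
      by (simp add: algebra_simps exp_add)
    finally show ?thesis .
  qed
  have "A * exp (\<sigma> * r) / r > 0" using A r by auto
  with key show "\<exists>A>0. \<forall>w. a' \<le> Im w \<and> Im w \<le> b' \<longrightarrow> norm (deriv f w) \<le> A * exp (\<sigma> * Re w)"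
    by blast
qed

text \<open>Half of the double exponential absorbs (\<delta> - \<eta>) x on the right, and on the
  left a smaller rate is weaker anyway. This brings different left rates to a common one, and \<eta>
  = 0 gives pure flatness.\<close>

lemma exp_flat_weaken:
  fixes \<delta> c \<kappa> \<eta> :: real
  assumes "0 < c" "0 < \<kappa>" "\<eta> \<le> \<delta>"
  obtains B where "B > 0"
    "\<And>x. exp (\<delta> * x - c * exp (\<kappa> * x)) \<le> B * exp (\<eta> * x - (c / 2) * exp (\<kappa> * x))"
proof -
  obtain B where B: "\<And>x. (\<delta> - \<eta>) * x - (c / 2) * exp (\<kappa> * x) \<le> B"
    using exp_dominates_linear[of "\<delta> - \<eta>" "c / 2" \<kappa>] assms by auto
  show ?thesis
  proof (rule that[of "exp B"])
    fix x
    have "\<delta> * x - c * exp (\<kappa> * x) \<le> B + (\<eta> * x - (c / 2) * exp (\<kappa> * x))"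
      using B[of x] by (simp add: algebra_simps)
    then show "exp (\<delta> * x - c * exp (\<kappa> * x)) \<le> exp B * exp (\<eta> * x - (c / 2) * exp (\<kappa> * x))"
      by (simp add: exp_add[symmetric])
  qed simp
qed

lemma flat_add_cmult:
  assumes e: "flat \<kappa> \<alpha> e" and e': "flat \<kappa> \<alpha> e'" and \<kappa>: "0 < \<kappa>"
  shows "flat \<kappa> \<alpha> (\<lambda>w. e w + k * e' w)"
  unfolding flat_def
proof (intro conjI allI impI)
  show "(\<lambda>w. e w + k * e' w) holomorphic_on hstrip (- \<alpha>) \<alpha>"
    using e e' by (auto simp: flat_def intro!: holomorphic_intros)
  fix \<alpha>' assume "\<alpha>' < \<alpha>"
  obtain A c \<delta> where A: "A > 0" "c > 0" "\<delta> > 0"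
    "\<And>w. \<bar>Im w\<bar> \<le> \<alpha>' \<Longrightarrow> norm (e w) \<le> A * exp (\<delta> * Re w - c * exp (\<kappa> * Re w))"
    using flatD[OF e \<open>\<alpha>' < \<alpha>\<close>] by metis
  obtain A' c' \<delta>' where A': "A' > 0" "c' > 0" "\<delta>' > 0"
    "\<And>w. \<bar>Im w\<bar> \<le> \<alpha>' \<Longrightarrow> norm (e' w) \<le> A' * exp (\<delta>' * Re w - c' * exp (\<kappa> * Re w))"
    using flatD[OF e' \<open>\<alpha>' < \<alpha>\<close>] by metis
  define \<eta> where "\<eta> = min \<delta> \<delta>'"
  define h where "h = min (c / 2) (c' / 2)"
  obtain B where B: "B > 0" "\<And>x. exp (\<delta> * x - c * exp (\<kappa> * x)) \<le> B * exp (\<eta> * x - (c / 2) * exp (\<kappa> * x))"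
    using exp_flat_weaken[OF A(2) \<kappa>, of \<eta> \<delta>] by (auto simp: \<eta>_def)
  obtain B' where B': "B' > 0" "\<And>x. exp (\<delta>' * x - c' * exp (\<kappa> * x)) \<le> B' * exp (\<eta> * x - (c' / 2) * exp (\<kappa> * x))"
    using exp_flat_weaken[OF A'(2) \<kappa>, of \<eta> \<delta>'] by (auto simp: \<eta>_def)
  have le: "exp (\<eta> * x - g * exp (\<kappa> * x)) \<le> exp (\<eta> * x - h * exp (\<kappa> * x))" if "h \<le> g" for g x
    using that by simp
  have key: "norm (e w + k * e' w) \<le> (A * B + norm k * (A' * B')) * exp (\<eta> * Re w - h * exp (\<kappa> * Re w))"
    if w: "\<bar>Im w\<bar> \<le> \<alpha>'" for w
  proof -
    have "norm (e w) \<le> A * (B * exp (\<eta> * Re w - h * exp (\<kappa> * Re w)))"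
      using A(4)[OF w] B(2)[of "Re w"] le[of "c / 2" "Re w"] A(1) B(1)
      by (smt (verit) h_def mult_left_mono min.cobounded1)
    moreover have "norm (e' w) \<le> A' * (B' * exp (\<eta> * Re w - h * exp (\<kappa> * Re w)))"
      using A'(4)[OF w] B'(2)[of "Re w"] le[of "c' / 2" "Re w"] A'(1) B'(1)
      by (smt (verit) h_def mult_left_mono min.cobounded2)
    then have "norm k * norm (e' w) \<le> norm k * (A' * (B' * exp (\<eta> * Re w - h * exp (\<kappa> * Re w))))"
      by (rule mult_left_mono) simp
    moreover have "norm (e w + k * e' w) \<le> norm (e w) + norm k * norm (e' w)"
      by (metis norm_triangle_ineq norm_mult)
    ultimately show ?thesis by (simp add: algebra_simps)
  qed
  have "A * B + norm k * (A' * B') > 0" "h > 0" "\<eta> > 0"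
    using A A' B B' by (auto simp: h_def \<eta>_def add_pos_nonneg)
  with key show "\<exists>A>0. \<exists>c>0. \<exists>\<delta>>0. \<forall>w. \<bar>Im w\<bar> \<le> \<alpha>' \<longrightarrow>
      norm (e w + k * e' w) \<le> A * exp (\<delta> * Re w - c * exp (\<kappa> * Re w))"
    by blast
qed

lemma moderate_add_cmult:
  assumes f: "moderate \<sigma> a b f" and f': "moderate \<sigma> a b f'"
  shows "moderate \<sigma> a b (\<lambda>w. f w + k * f' w)"
  unfolding moderate_def
proof (intro conjI allI impI)
  show "(\<lambda>w. f w + k * f' w) holomorphic_on hstrip a b"
    using f f' by (auto simp: moderate_def intro!: holomorphic_intros)
  fix a' b' assume ab: "a < a' \<and> b' < b"
  obtain A where A: "A > 0" "\<And>w. a' \<le> Im w \<Longrightarrow> Im w \<le> b' \<Longrightarrow> norm (f w) \<le> A * exp (\<sigma> * Re w)"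
    using moderateD[OF f] ab by metis
  obtain A' where A': "A' > 0" "\<And>w. a' \<le> Im w \<Longrightarrow> Im w \<le> b' \<Longrightarrow> norm (f' w) \<le> A' * exp (\<sigma> * Re w)"
    using moderateD[OF f'] ab by metis
  have "norm (f w + k * f' w) \<le> (A + norm k * A') * exp (\<sigma> * Re w)" if w: "a' \<le> Im w \<and> Im w \<le> b'" for w
  proof -
    have "norm k * norm (f' w) \<le> norm k * (A' * exp (\<sigma> * Re w))"
      using A'(2)[of w] w by (intro mult_left_mono) auto
    moreover have "norm (f w) \<le> A * exp (\<sigma> * Re w)" using A(2) w by blast
    moreover have "norm (f w + k * f' w) \<le> norm (f w) + norm k * norm (f' w)"
      by (metis norm_triangle_ineq norm_mult)
    ultimately show ?thesis by (simp add: algebra_simps)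
  qed
  moreover have "A + norm k * A' > 0" using A A' by (simp add: add_pos_nonneg)
  ultimately show "\<exists>A>0. \<forall>w. a' \<le> Im w \<and> Im w \<le> b' \<longrightarrow> norm (f w + k * f' w) \<le> A * exp (\<sigma> * Re w)"
    by blast
qed

section \<open>Averaging over real translations\<close>

lemma holomorphic_on_real_translate:
  assumes "f holomorphic_on hstrip a b" "S \<subseteq> hstrip a b"
  shows "(\<lambda>v. f (v + of_real r)) holomorphic_on S" "(\<lambda>v. f (v - of_real r)) holomorphic_on S"
proof -
  have *: "(f \<circ> (\<lambda>v. v + of_real r)) holomorphic_on S" for r
    by (rule holomorphic_on_compose_gen[OF _ assms(1)])
       (use assms(2) in \<open>auto simp: hstrip_def intro!: holomorphic_intros\<close>)
  show "(\<lambda>v. f (v + of_real r)) holomorphic_on S" "(\<lambda>v. f (v - of_real r)) holomorphic_on S"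
    using *[of r] *[of "- r"] by (simp_all add: o_def)
qed

text \<open>\<theta> is a random real translation. It points left, which harms no function bounded
  by exp(\<sigma> Re w) with \<sigma> nonnegative; the opposite translation of a kernel enlarges its
  factor exp(\<delta> Re w), and the exponential moment of order \<eta> keeps that
  integrable.\<close>

locale averaging = prob_space M for M :: "'y measure" +
  fixes \<theta> :: "'y \<Rightarrow> real" and \<eta> :: real
  assumes meas [measurable]: "\<theta> \<in> borel_measurable M"
    and nonpos: "\<And>y. y \<in> space M \<Longrightarrow> \<theta> y \<le> 0"
    and \<eta>_pos: "0 < \<eta>"
    and exp_integrable: "integrable M (\<lambda>y. exp (- \<eta> * \<theta> y))"
begin

text \<open>With \<open>down\<close> below this forms a pair of transposes for the bilinear pairing
  along a horizontal line: multiplicative convolution in s, and its adjoint.\<close>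

definition up :: "(complex \<Rightarrow> complex) \<Rightarrow> complex \<Rightarrow> complex" where
  "up e w = (\<integral>y. e (w - of_real (\<theta> y)) \<partial>M)"

definition down :: "(complex \<Rightarrow> complex) \<Rightarrow> complex \<Rightarrow> complex" where
  "down f w = (\<integral>y. f (w + of_real (\<theta> y)) \<partial>M)"

text \<open>For fixed y the translation x to x + \<theta> y moves the shift from \<open>g\<close> to
  \<open>h\<close>; Fubini does the rest. Since \<open>H\<close> is increasing and the shift
  nonpositive, one integral dominates the integrals over x for all y at once.\<close>

lemma pairing_line:
  fixes g h :: "real \<Rightarrow> complex" and H :: "real \<Rightarrow> real"
  assumes [measurable]: "g \<in> borel_measurable borel" "h \<in> borel_measurable borel"
    and H: "mono H" "\<And>x. norm (h x) \<le> H x" and int: "integrable lborel (\<lambda>x. norm (g (x - \<tau>)) * H x)"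
  shows "(\<integral>x. (\<integral>y. g (x - \<tau> - \<theta> y) \<partial>M) * h x \<partial>lborel) = (\<integral>x. g (x - \<tau>) * (\<integral>y. h (x + \<theta> y) \<partial>M) \<partial>lborel)"
proof -
  interpret P: pair_sigma_finite M "lborel :: real measure" ..
  define K where "K = (\<integral>x. norm (g (x - \<tau>)) * H x \<partial>lborel)"
  have H0: "0 \<le> H x" for x using H(2)[of x] norm_ge_zero order_trans by blast
  have bd: "norm (g (x - \<tau>) * h (x + \<theta> y)) \<le> norm (g (x - \<tau>)) * H x" if "y \<in> space M" for x y
  proof -
    have "norm (h (x + \<theta> y)) \<le> H x"
      using H(2)[of "x + \<theta> y"] monoD[OF H(1), of "x + \<theta> y" x] nonpos[OF that] by simp
    then show ?thesis by (simp add: norm_mult mult_left_mono)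
  qed
  have intG: "integrable lborel (\<lambda>x. g (x - \<tau>) * h (x + \<theta> y))" if "y \<in> space M" for y
    by (rule Bochner_Integration.integrable_bound[OF int])
       (use bd[OF that] H0 in \<open>auto intro!: AE_I2 simp: abs_of_nonneg\<close>)
  have eqx: "g (\<theta> y + 1 * x - \<tau> - \<theta> y) * h (\<theta> y + 1 * x) = g (x - \<tau>) * h (x + \<theta> y)" for x y
    by (simp add: add_ac)
  have intF: "integrable lborel (\<lambda>x. g (x - \<tau> - \<theta> y) * h x)" if "y \<in> space M" for y
    using intG[OF that] lborel_integrable_real_affine_iff[of 1 "\<lambda>x. g (x - \<tau> - \<theta> y) * h x" "\<theta> y"]
    by (simp only: eqx)
  have shift: "(\<integral>x. g (x - \<tau> - \<theta> y) * h x \<partial>lborel) = (\<integral>x. g (x - \<tau>) * h (x + \<theta> y) \<partial>lborel)" for y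
    using lborel_integral_real_affine[of 1 "\<lambda>x. g (x - \<tau> - \<theta> y) * h x" "\<theta> y"]
    by (simp only: eqx) simp
  have shiftn: "(\<integral>x. norm (g (x - \<tau> - \<theta> y) * h x) \<partial>lborel) = (\<integral>x. norm (g (x - \<tau>) * h (x + \<theta> y)) \<partial>lborel)" for y
    using lborel_integral_real_affine[of 1 "\<lambda>x. norm (g (x - \<tau> - \<theta> y) * h x)" "\<theta> y"]
    by (simp only: eqx) simp
  have nb: "norm (\<integral>x. norm (g (x - \<tau>) * h (x + \<theta> y)) \<partial>lborel) \<le> K" if "y \<in> space M" for y
    unfolding K_def using bd[OF that] intG[OF that] int
    by (subst real_norm_def, subst abs_of_nonneg) (auto intro!: integral_nonneg integral_mono)
  have int1: "integrable M (\<lambda>y. \<integral>x. norm (g (x - \<tau>) * h (x + \<theta> y)) \<partial>lborel)"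
    by (rule integrable_const_bound[of _ K]) (use nb in \<open>auto intro!: AE_I2\<close>)
  have pG: "integrable (M \<Otimes>\<^sub>M lborel) (\<lambda>(y, x). g (x - \<tau>) * h (x + \<theta> y))"
    by (rule P.Fubini_integrable) (use int1 intG in \<open>auto intro!: AE_I2\<close>)
  have pF: "integrable (M \<Otimes>\<^sub>M lborel) (\<lambda>(y, x). g (x - \<tau> - \<theta> y) * h x)"
    by (rule P.Fubini_integrable) (use int1 intF shiftn in \<open>auto intro!: AE_I2\<close>)
  have "(\<integral>x. (\<integral>y. g (x - \<tau> - \<theta> y) \<partial>M) * h x \<partial>lborel) = (\<integral>x. (\<integral>y. g (x - \<tau> - \<theta> y) * h x \<partial>M) \<partial>lborel)"
    by simp
  also have "\<dots> = (\<integral>y. (\<integral>x. g (x - \<tau> - \<theta> y) * h x \<partial>lborel) \<partial>M)"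
    using P.Fubini_integral[OF pF] by simp
  also have "\<dots> = (\<integral>y. (\<integral>x. g (x - \<tau>) * h (x + \<theta> y) \<partial>lborel) \<partial>M)"
    by (simp only: shift)
  also have "\<dots> = (\<integral>x. (\<integral>y. g (x - \<tau>) * h (x + \<theta> y) \<partial>M) \<partial>lborel)"
    using P.Fubini_integral[OF pG] by simp
  also have "\<dots> = (\<integral>x. g (x - \<tau>) * (\<integral>y. h (x + \<theta> y) \<partial>M) \<partial>lborel)"
    by simp
  finally show ?thesis .
qed

lemma translate_measurable:
  assumes "f holomorphic_on hstrip a b" "w \<in> hstrip a b"
  shows "(\<lambda>y. f (w + of_real (\<theta> y))) \<in> borel_measurable M" "(\<lambda>y. f (w - of_real (\<theta> y))) \<in> borel_measurable M"
proof -
  have [measurable]: "(\<lambda>x. f (Complex x (Im w))) \<in> borel_measurable borel"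
    by (rule borel_measurable_line[OF assms(1)]) (use assms in \<open>auto simp: hstrip_def\<close>)
  have "f (w + of_real x) = f (Complex (Re w + x) (Im w))" "f (w - of_real x) = f (Complex (Re w - x) (Im w))" for x
    by (rule arg_cong[of _ _ f], simp add: complex_eq_iff)+
  then show "(\<lambda>y. f (w + of_real (\<theta> y))) \<in> borel_measurable M" "(\<lambda>y. f (w - of_real (\<theta> y))) \<in> borel_measurable M"
    by simp_all
qed

text \<open>A right shift only strengthens the double exponential; the growth of exp(\<zeta> Re w)
  is paid for by the exponential moment. The same bound supplies the domination for
  holomorphy.\<close>

lemma flat_up:
  assumes e: "flat \<kappa> \<alpha> e" and \<kappa>: "0 < \<kappa>"
  shows "flat \<kappa> \<alpha> (up e)"
proof -
  have hol: "e holomorphic_on hstrip (- \<alpha>) \<alpha>" using e by (simp add: flat_def)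
  define J where "J = (\<integral>y. exp (- \<eta> * \<theta> y) \<partial>M)"
  have J: "1 \<le> J"
  proof -
    have "(\<integral>y. 1 \<partial>M) \<le> J" unfolding J_def
      by (rule integral_mono) (use exp_integrable nonpos \<eta>_pos in \<open>auto simp: mult_nonneg_nonpos\<close>)
    then show ?thesis by (simp add: prob_space)
  qed
  have bound: "\<exists>A>0. \<exists>c>0. \<exists>\<delta>>0. \<forall>w y. \<bar>Im w\<bar> \<le> \<alpha>' \<longrightarrow> y \<in> space M \<longrightarrow>
      norm (e (w - of_real (\<theta> y))) \<le> A * exp (\<delta> * Re w - c * exp (\<kappa> * Re w)) * exp (- \<eta> * \<theta> y)"
    if \<alpha>': "\<alpha>' < \<alpha>" for \<alpha>'
  proof -
    obtain A c \<delta> where A: "A > 0" "c > 0" "\<delta> > 0"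
      "\<And>w. \<bar>Im w\<bar> \<le> \<alpha>' \<Longrightarrow> norm (e w) \<le> A * exp (\<delta> * Re w - c * exp (\<kappa> * Re w))"
      using flatD[OF e \<alpha>'] by metis
    \<comment> \<open>The left rate is lowered to the order of the available exponential
      moment.\<close>
    define \<zeta> where "\<zeta> = min \<delta> \<eta>"
    have \<zeta>: "0 < \<zeta>" "\<zeta> \<le> \<delta>" "\<zeta> \<le> \<eta>" using A \<eta>_pos by (auto simp: \<zeta>_def)
    obtain B where B: "B > 0" "\<And>x. exp (\<delta> * x - c * exp (\<kappa> * x)) \<le> B * exp (\<zeta> * x - (c / 2) * exp (\<kappa> * x))"
      using exp_flat_weaken[OF A(2) \<kappa> \<zeta>(2)] by metis
    have "norm (e (w - of_real (\<theta> y))) \<le> (A * B) * exp (\<zeta> * Re w - (c / 2) * exp (\<kappa> * Re w)) * exp (- \<eta> * \<theta> y)"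
      if w: "\<bar>Im w\<bar> \<le> \<alpha>'" and y: "y \<in> space M" for w y
    proof -
      let ?z = "Re w - \<theta> y"
      have \<theta>: "\<theta> y \<le> 0" using nonpos y by auto
      have "norm (e (w - of_real (\<theta> y))) \<le> A * exp (\<delta> * ?z - c * exp (\<kappa> * ?z))"
        using A(4)[of "w - of_real (\<theta> y)"] w by simp
      also have "\<dots> \<le> A * (B * exp (\<zeta> * ?z - (c / 2) * exp (\<kappa> * ?z)))"
        using B(2)[of ?z] A by (intro mult_left_mono) auto
      also have "\<dots> \<le> A * (B * exp ((\<zeta> * Re w - (c / 2) * exp (\<kappa> * Re w)) + (- \<eta> * \<theta> y)))"
      proof -
        have "exp (\<kappa> * Re w) \<le> exp (\<kappa> * ?z)" using \<theta> \<kappa> by (simp add: mult_left_mono)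
        then have "c * exp (\<kappa> * Re w) \<le> c * exp (\<kappa> * ?z)" using A by simp
        moreover have "\<zeta> * - \<theta> y \<le> \<eta> * - \<theta> y" using \<zeta>(3) \<theta> by (intro mult_right_mono) auto
        ultimately have "\<zeta> * ?z - (c / 2) * exp (\<kappa> * ?z) \<le> (\<zeta> * Re w - (c / 2) * exp (\<kappa> * Re w)) + (- \<eta> * \<theta> y)"
          by (simp add: algebra_simps)
        then show ?thesis using A B by (intro mult_left_mono) auto
      qed
      also have "\<dots> = (A * B) * exp (\<zeta> * Re w - (c / 2) * exp (\<kappa> * Re w)) * exp (- \<eta> * \<theta> y)"
        unfolding exp_add by simp
      finally show ?thesis .
    qed
    moreover have "A * B > 0" "c / 2 > 0" using A B by auto
    ultimately show ?thesis using \<zeta>(1) by blast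
  qed
  have int: "integrable M (\<lambda>y. e (w - of_real (\<theta> y)))" if w: "w \<in> hstrip (- \<alpha>) \<alpha>" for w
  proof -
    obtain A c \<delta> where A: "A > 0" "\<And>y. y \<in> space M \<Longrightarrow>
      norm (e (w - of_real (\<theta> y))) \<le> A * exp (\<delta> * Re w - c * exp (\<kappa> * Re w)) * exp (- \<eta> * \<theta> y)"
      using bound[of "\<bar>Im w\<bar>"] w by (force simp: hstrip_def abs_less_iff)
    show ?thesis
    proof (rule Bochner_Integration.integrable_bound)
      show "integrable M (\<lambda>y. A * exp (\<delta> * Re w - c * exp (\<kappa> * Re w)) * exp (- \<eta> * \<theta> y))"
        using exp_integrable by simp
      show "AE y in M. norm (e (w - of_real (\<theta> y))) \<le> norm (A * exp (\<delta> * Re w - c * exp (\<kappa> * Re w)) * exp (- \<eta> * \<theta> y))"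
        using A by (intro AE_I2) (simp add: abs_of_pos)
    qed (rule translate_measurable[OF hol w])
  qed
  have "up e holomorphic_on hstrip (- \<alpha>) \<alpha>"
    unfolding up_def
  proof (subst holomorphic_on_open[OF open_hstrip], intro ballI)
    fix w assume w: "w \<in> hstrip (- \<alpha>) \<alpha>"
    define \<alpha>' where "\<alpha>' = (\<bar>Im w\<bar> + \<alpha>) / 2"
    have \<alpha>': "\<bar>Im w\<bar> < \<alpha>'" "\<alpha>' < \<alpha>" using w by (auto simp: \<alpha>'_def hstrip_def)
    obtain A c \<delta> where A: "A > 0" "c > 0" "\<delta> > 0" "\<And>w y. \<bar>Im w\<bar> \<le> \<alpha>' \<Longrightarrow> y \<in> space M \<Longrightarrow>
      norm (e (w - of_real (\<theta> y))) \<le> A * exp (\<delta> * Re w - c * exp (\<kappa> * Re w)) * exp (- \<eta> * \<theta> y)"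
      using bound[OF \<alpha>'(2)] by metis
    obtain B where B: "\<And>x. \<delta> * x - c * exp (\<kappa> * x) \<le> B"
      using exp_dominates_linear[of \<delta> c \<kappa>] A(2,3) \<kappa> by (metis less_imp_le)
    have sub: "hstrip (- \<alpha>') \<alpha>' \<subseteq> hstrip (- \<alpha>) \<alpha>" using \<alpha>' by (auto simp: hstrip_def)
    have "((\<lambda>w. \<integral>y. e (w - of_real (\<theta> y)) \<partial>M) has_field_derivative (\<integral>y. deriv (\<lambda>w. e (w - of_real (\<theta> y))) w \<partial>M)) (at w)"
    proof (rule has_field_derivative_parameter_integral(2))
      show "w \<in> hstrip (- \<alpha>') \<alpha>'" using \<alpha>' by (auto simp: hstrip_def)
      show "(\<lambda>y. e (v - of_real (\<theta> y))) \<in> borel_measurable M" if "v \<in> hstrip (- \<alpha>') \<alpha>'" for v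
        using translate_measurable[OF hol] that sub by auto
      show "(\<lambda>v. e (v - of_real (\<theta> y))) holomorphic_on hstrip (- \<alpha>') \<alpha>'" for y
        by (rule holomorphic_on_real_translate[OF hol sub])
      show "integrable M (\<lambda>y. A * exp B * exp (- \<eta> * \<theta> y))" using exp_integrable by simp
      fix v y assume v: "v \<in> hstrip (- \<alpha>') \<alpha>'" and y: "y \<in> space M"
      have "norm (e (v - of_real (\<theta> y))) \<le> A * exp (\<delta> * Re v - c * exp (\<kappa> * Re v)) * exp (- \<eta> * \<theta> y)"
        using A(4)[OF _ y] v by (auto simp: hstrip_def)
      also have "\<dots> \<le> A * exp B * exp (- \<eta> * \<theta> y)"
        using A(1) B[of "Re v"] by (intro mult_right_mono mult_left_mono) auto
      finally show "norm (e (v - of_real (\<theta> y))) \<le> A * exp B * exp (- \<eta> * \<theta> y)" .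
    qed simp
    then show "\<exists>f'. ((\<lambda>w. \<integral>y. e (w - of_real (\<theta> y)) \<partial>M) has_field_derivative f') (at w)" by blast
  qed
  moreover have "\<exists>A>0. \<exists>c>0. \<exists>\<delta>>0. \<forall>w. \<bar>Im w\<bar> \<le> \<alpha>' \<longrightarrow>
        norm (up e w) \<le> A * exp (\<delta> * Re w - c * exp (\<kappa> * Re w))" if \<alpha>': "\<alpha>' < \<alpha>" for \<alpha>'
  proof -
    obtain A c \<delta> where A: "A > 0" "c > 0" "\<delta> > 0" "\<And>w y. \<bar>Im w\<bar> \<le> \<alpha>' \<Longrightarrow> y \<in> space M \<Longrightarrow>
      norm (e (w - of_real (\<theta> y))) \<le> A * exp (\<delta> * Re w - c * exp (\<kappa> * Re w)) * exp (- \<eta> * \<theta> y)"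
      using bound[OF \<alpha>'] by metis
    have "norm (up e w) \<le> (A * J) * exp (\<delta> * Re w - c * exp (\<kappa> * Re w))" if w: "\<bar>Im w\<bar> \<le> \<alpha>'" for w
    proof -
      have "w \<in> hstrip (- \<alpha>) \<alpha>" using w \<alpha>' by (auto simp: hstrip_def)
      note i = int[OF this]
      have "norm (up e w) \<le> (\<integral>y. norm (e (w - of_real (\<theta> y))) \<partial>M)"
        unfolding up_def by (rule integral_norm_bound)
      also have "\<dots> \<le> (\<integral>y. A * exp (\<delta> * Re w - c * exp (\<kappa> * Re w)) * exp (- \<eta> * \<theta> y) \<partial>M)"
        using i exp_integrable A(4)[OF w] by (intro integral_mono) auto
      also have "\<dots> = (A * J) * exp (\<delta> * Re w - c * exp (\<kappa> * Re w))"
        by (simp add: J_def)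
      finally show ?thesis .
    qed
    moreover have "A * J > 0" using A J by auto
    ultimately show ?thesis using A(2,3) by blast
  qed
  ultimately show ?thesis by (simp add: flat_def)
qed

lemma moderate_bound:
  assumes f: "moderate \<sigma> a b f" and \<sigma>: "0 \<le> \<sigma>" and ab: "a < a'" "b' < b"
  obtains A where "A > 0" "\<And>w y. a' \<le> Im w \<Longrightarrow> Im w \<le> b' \<Longrightarrow> y \<in> space M \<Longrightarrow>
      norm (f (w + of_real (\<theta> y))) \<le> A * exp (\<sigma> * Re w)"
proof -
  obtain A where A: "A > 0" "\<And>w. a' \<le> Im w \<Longrightarrow> Im w \<le> b' \<Longrightarrow> norm (f w) \<le> A * exp (\<sigma> * Re w)"
    using moderateD[OF f ab] by metis
  show ?thesis
  proof (rule that[OF A(1)])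
    fix w y assume w: "a' \<le> Im w" "Im w \<le> b'" and y: "y \<in> space M"
    have "norm (f (w + of_real (\<theta> y))) \<le> A * exp (\<sigma> * (Re w + \<theta> y))"
      using A(2)[of "w + of_real (\<theta> y)"] w by simp
    also have "\<dots> \<le> A * exp (\<sigma> * Re w)"
      using A(1) \<sigma> nonpos[OF y] by (intro mult_left_mono) (auto simp: mult_left_mono)
    finally show "norm (f (w + of_real (\<theta> y))) \<le> A * exp (\<sigma> * Re w)" .
  qed
qed

text \<open>Left shifts do not increase exp(\<sigma> Re w), so the bound passes to the average with
  the same constant.\<close>

lemma moderate_down:
  assumes f: "moderate \<sigma> a b f" and \<sigma>: "0 \<le> \<sigma>"
  shows "moderate \<sigma> a b (down f)"
proof -
  have hol: "f holomorphic_on hstrip a b" using f by (simp add: moderate_def)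
  have "down f holomorphic_on hstrip a b"
    unfolding down_def
  proof (subst holomorphic_on_open[OF open_hstrip], intro ballI)
    fix w assume w: "w \<in> hstrip a b"
    define a' where "a' = (a + Im w) / 2"
    define b' where "b' = (Im w + b) / 2"
    have ab: "a < a'" "a' < Im w" "Im w < b'" "b' < b" using w by (auto simp: a'_def b'_def hstrip_def)
    obtain A where A: "A > 0" "\<And>w y. a' \<le> Im w \<Longrightarrow> Im w \<le> b' \<Longrightarrow> y \<in> space M \<Longrightarrow>
      norm (f (w + of_real (\<theta> y))) \<le> A * exp (\<sigma> * Re w)"
      using moderate_bound[OF f \<sigma> ab(1,4)] by metis
    \<comment> \<open>Cut off on the right, because for positive \<sigma> the bound exp(\<sigma> Re
      v) is not uniform over a whole strip.\<close>
    define S where "S = hstrip a' b' \<inter> {v. Re v < Re w + 1}"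
    have sub: "S \<subseteq> hstrip a b" using ab by (auto simp: S_def hstrip_def)
    have "((\<lambda>w. \<integral>y. f (w + of_real (\<theta> y)) \<partial>M) has_field_derivative (\<integral>y. deriv (\<lambda>w. f (w + of_real (\<theta> y))) w \<partial>M)) (at w)"
    proof (rule has_field_derivative_parameter_integral(2))
      show "open S" by (simp add: S_def open_Int open_halfspace_Re_lt)
      show "w \<in> S" using ab by (auto simp: S_def hstrip_def)
      show "(\<lambda>y. f (v + of_real (\<theta> y))) \<in> borel_measurable M" if "v \<in> S" for v
        using translate_measurable[OF hol] that sub by auto
      show "(\<lambda>v. f (v + of_real (\<theta> y))) holomorphic_on S" for y
        by (rule holomorphic_on_real_translate[OF hol sub])
      show "integrable M (\<lambda>y. A * exp (\<sigma> * (Re w + 1)))" by simp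
      fix v y assume v: "v \<in> S" and y: "y \<in> space M"
      have "norm (f (v + of_real (\<theta> y))) \<le> A * exp (\<sigma> * Re v)"
        using A(2)[OF _ _ y] v by (auto simp: hstrip_def S_def)
      also have "\<dots> \<le> A * exp (\<sigma> * (Re w + 1))"
        using A(1) v \<sigma> by (intro mult_left_mono) (auto simp: S_def mult_left_mono)
      finally show "norm (f (v + of_real (\<theta> y))) \<le> A * exp (\<sigma> * (Re w + 1))" .
    qed
    then show "\<exists>f'. ((\<lambda>w. \<integral>y. f (w + of_real (\<theta> y)) \<partial>M) has_field_derivative f') (at w)" by blast
  qed
  moreover have "\<exists>A>0. \<forall>w. a' \<le> Im w \<and> Im w \<le> b' \<longrightarrow> norm (down f w) \<le> A * exp (\<sigma> * Re w)"
    if ab: "a < a'" "b' < b" for a' b'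
  proof -
    obtain A where A: "A > 0" "\<And>w y. a' \<le> Im w \<Longrightarrow> Im w \<le> b' \<Longrightarrow> y \<in> space M \<Longrightarrow>
      norm (f (w + of_real (\<theta> y))) \<le> A * exp (\<sigma> * Re w)"
      using moderate_bound[OF f \<sigma> ab] by metis
    have "norm (down f w) \<le> A * exp (\<sigma> * Re w)" if w: "a' \<le> Im w" "Im w \<le> b'" for w
    proof -
      have m: "(\<lambda>y. f (w + of_real (\<theta> y))) \<in> borel_measurable M"
        using translate_measurable[OF hol] w ab by (auto simp: hstrip_def)
      have i: "integrable M (\<lambda>y. f (w + of_real (\<theta> y)))"
        by (rule integrable_const_bound[OF _ m]) (use A(2)[OF w] in \<open>auto intro!: AE_I2\<close>)
      have "norm (down f w) \<le> (\<integral>y. norm (f (w + of_real (\<theta> y))) \<partial>M)"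
        unfolding down_def by (rule integral_norm_bound)
      also have "\<dots> \<le> (\<integral>y. A * exp (\<sigma> * Re w) \<partial>M)"
        using i A(2)[OF w] by (intro integral_mono) auto
      finally show ?thesis by (simp add: prob_space)
    qed
    with A(1) show ?thesis by blast
  qed
  ultimately show ?thesis by (simp add: moderate_def)
qed

lemma pairing_up_down:
  assumes e: "flat \<kappa> \<alpha> e" and f: "moderate \<sigma> a b f" and pos: "0 < \<kappa>" "0 \<le> \<sigma>"
    and d: "a < d" "d < b" "\<bar>d - Im t\<bar> < \<alpha>"
  shows "(\<integral>x. up e (Complex x d - t) * f (Complex x d) \<partial>lborel) = (\<integral>x. e (Complex x d - t) * down f (Complex x d) \<partial>lborel)"
proof -
  define g where "g = (\<lambda>x. e (Complex x (d - Im t)))"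
  define h where "h = (\<lambda>x. f (Complex x d))"
  have eh: "e holomorphic_on hstrip (- \<alpha>) \<alpha>" and fh: "f holomorphic_on hstrip a b"
    using e f by (auto simp: flat_def moderate_def)
  have [measurable]: "g \<in> borel_measurable borel" "h \<in> borel_measurable borel"
    unfolding g_def h_def using d by (auto intro!: borel_measurable_line[OF eh] borel_measurable_line[OF fh])
  obtain A where A: "A > 0" "\<And>w. d \<le> Im w \<Longrightarrow> Im w \<le> d \<Longrightarrow> norm (f w) \<le> A * exp (\<sigma> * Re w)"
    using moderateD[OF f d(1,2)] by metis
  have g: "e (Complex x d - t) = g (x - Re t)" for x
    unfolding g_def by (rule arg_cong[of _ _ e]) (simp add: complex_eq_iff)
  \<comment> \<open>Integrability of |g| against exp(\<sigma> x) is obtained by testing the kernel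
    against the moderate function exp(\<sigma> w), on a strip wide enough to contain the height
    \<open>d\<close>.\<close>
  have exp_mod: "moderate \<sigma> (d - \<alpha> - 1) (d + \<alpha> + 1) (\<lambda>w. exp (of_real \<sigma> * w))"
    unfolding moderate_def by (auto intro!: holomorphic_intros exI[of _ 1])
  have "decaying (max (d - \<alpha> - 1) (Im t - \<alpha>)) (min (d + \<alpha> + 1) (Im t + \<alpha>)) (\<lambda>w. e (w - t) * exp (of_real \<sigma> * w))"
    by (rule decaying_flat_mult_moderate[OF e exp_mod pos])
  then have "integrable lborel (\<lambda>x. e (Complex x d - t) * exp (of_real \<sigma> * Complex x d))"
    by (rule decaying_integrable) (use d in auto)
  then have "integrable lborel (\<lambda>x. norm (e (Complex x d - t) * exp (of_real \<sigma> * Complex x d)))"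
    by (rule integrable_norm)
  then have "integrable lborel (\<lambda>x. A * (norm (g (x - Re t)) * exp (\<sigma> * x)))"
    by (simp add: norm_mult g)
  then have int: "integrable lborel (\<lambda>x. norm (g (x - Re t)) * (A * exp (\<sigma> * x)))"
    by (simp add: mult_ac)
  have "(\<integral>x. (\<integral>y. g (x - Re t - \<theta> y) \<partial>M) * h x \<partial>lborel) = (\<integral>x. g (x - Re t) * (\<integral>y. h (x + \<theta> y) \<partial>M) \<partial>lborel)"
  proof (rule pairing_line[where H = "\<lambda>x. A * exp (\<sigma> * x)"])
    show "mono (\<lambda>x. A * exp (\<sigma> * x))"
      using A pos by (auto intro!: monoI mult_left_mono)
    show "norm (h x) \<le> A * exp (\<sigma> * x)" for x using A(2)[of "Complex x d"] by (simp add: h_def)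
  qed (use int in auto)
  moreover have "(\<integral>y. g (x - Re t - \<theta> y) \<partial>M) = up e (Complex x d - t)" for x
    unfolding g_def up_def
    by (rule Bochner_Integration.integral_cong[OF refl], rule arg_cong[of _ _ e]) (simp add: complex_eq_iff)
  moreover have "(\<integral>y. h (x + \<theta> y) \<partial>M) = down f (Complex x d)" for x
    unfolding h_def down_def
    by (rule Bochner_Integration.integral_cong[OF refl], rule arg_cong[of _ _ f]) (simp add: complex_eq_iff)
  ultimately show ?thesis by (simp add: h_def g)
qed

end

text \<open>The derivative of the product e(w - t) f(w) integrates to 0 along the line, so 1 -
  \<beta> d/dw on the kernel is the transpose of 1 + \<beta> d/dw on the function.\<close>

lemma pairing_deriv:
  assumes e: "flat \<kappa> \<alpha> e" and f: "moderate \<sigma> a b f" and pos: "0 < \<kappa>" "0 \<le> \<sigma>"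
    and d: "a < d" "d < b" "\<bar>d - Im t\<bar> < \<alpha>"
  shows "(\<integral>x. (e (Complex x d - t) + (- \<beta>) * deriv e (Complex x d - t)) * f (Complex x d) \<partial>lborel)
       = (\<integral>x. e (Complex x d - t) * (f (Complex x d) + \<beta> * deriv f (Complex x d)) \<partial>lborel)"
proof -
  let ?a = "max a (Im t - \<alpha>)" and ?b = "min b (Im t + \<alpha>)"
  have ab: "?a < d" "d < ?b" using d by auto
  have i1: "integrable lborel (\<lambda>x. e (Complex x d - t) * f (Complex x d))"
    by (rule decaying_integrable[OF decaying_flat_mult_moderate[OF e f pos] ab])
  have i2: "integrable lborel (\<lambda>x. deriv e (Complex x d - t) * f (Complex x d))"
    by (rule decaying_integrable[OF decaying_flat_mult_moderate[OF flat_deriv[OF e] f pos] ab]) (use pos in auto)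
  have i3: "integrable lborel (\<lambda>x. e (Complex x d - t) * deriv f (Complex x d))"
    by (rule decaying_integrable[OF decaying_flat_mult_moderate[OF e moderate_deriv[OF f pos(2)] pos] ab])
  have dv: "deriv (\<lambda>w. e (w - t) * f w) (Complex x d)
      = deriv e (Complex x d - t) * f (Complex x d) + e (Complex x d - t) * deriv f (Complex x d)" for x
  proof -
    have "(e has_field_derivative deriv e (Complex x d - t)) (at (Complex x d - t))"
      by (rule holomorphic_derivI[of _ "hstrip (- \<alpha>) \<alpha>"]) (use e d in \<open>auto simp: flat_def intro: open_hstrip\<close>, use d in \<open>auto simp: hstrip_def\<close>)
    then have "((\<lambda>w. e (w - t)) has_field_derivative deriv e (Complex x d - t)) (at (Complex x d))"
      using DERIV_shift[of e _ "Complex x d" "- t"] by simp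
    moreover have "(f has_field_derivative deriv f (Complex x d)) (at (Complex x d))"
      by (rule holomorphic_derivI[of _ "hstrip a b"]) (use f d in \<open>auto simp: moderate_def intro: open_hstrip\<close>, use d in \<open>auto simp: hstrip_def\<close>)
    ultimately have "((\<lambda>w. e (w - t) * f w) has_field_derivative
       (deriv e (Complex x d - t) * f (Complex x d) + deriv f (Complex x d) * e (Complex x d - t))) (at (Complex x d))"
      by (rule DERIV_mult)
    then show ?thesis by (simp add: DERIV_imp_deriv mult.commute)
  qed
  have "(\<integral>x. deriv e (Complex x d - t) * f (Complex x d) + e (Complex x d - t) * deriv f (Complex x d) \<partial>lborel) = 0"
    using line_integral_deriv_eq_0[OF decaying_flat_mult_moderate[OF e f pos] ab] by (simp add: dv)
  then have 0: "(\<integral>x. deriv e (Complex x d - t) * f (Complex x d) \<partial>lborel) = - (\<integral>x. e (Complex x d - t) * deriv f (Complex x d) \<partial>lborel)"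
    using i2 i3 by (simp add: add_eq_0_iff2)
  have "(\<integral>x. (e (Complex x d - t) + (- \<beta>) * deriv e (Complex x d - t)) * f (Complex x d) \<partial>lborel)
     = (\<integral>x. e (Complex x d - t) * f (Complex x d) + (- \<beta>) * (deriv e (Complex x d - t) * f (Complex x d)) \<partial>lborel)"
    by (simp add: algebra_simps)
  also have "\<dots> = (\<integral>x. e (Complex x d - t) * f (Complex x d) \<partial>lborel) + (- \<beta>) * (\<integral>x. deriv e (Complex x d - t) * f (Complex x d) \<partial>lborel)"
    using i1 i2 by simp
  also have "\<dots> = (\<integral>x. e (Complex x d - t) * f (Complex x d) \<partial>lborel) + \<beta> * (\<integral>x. e (Complex x d - t) * deriv f (Complex x d) \<partial>lborel)"
    by (simp add: 0)
  also have "\<dots> = (\<integral>x. e (Complex x d - t) * f (Complex x d) + \<beta> * (e (Complex x d - t) * deriv f (Complex x d)) \<partial>lborel)"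
    using i1 i3 by simp
  also have "\<dots> = (\<integral>x. e (Complex x d - t) * (f (Complex x d) + \<beta> * deriv f (Complex x d)) \<partial>lborel)"
    by (simp add: algebra_simps)
  finally show ?thesis .
qed

section \<open>The Beta averages\<close>

definition unit_measure :: "real measure" where
  "unit_measure = restrict_space lborel {0<..<1}"

text \<open>Chosen so that exp(u \<theta>) = (y^i (1 - y))^(u/n), the integrand of Euler's Beta
  function at i u/n + 1 and u/n + 1.\<close>

definition beta_shift :: "real \<Rightarrow> nat \<Rightarrow> real \<Rightarrow> real" where
  "beta_shift n i y = ln (y ^ i * (1 - y)) / n"

lemma space_unit_measure [simp]: "space unit_measure = {0<..<1}"
  by (simp add: unit_measure_def space_restrict_space)

lemma integral_unit_measure:
  fixes f :: "real \<Rightarrow> 'b::{banach, second_countable_topology}"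
  shows "(\<integral>y. f y \<partial>unit_measure) = (LINT y:{0<..<1}|lborel. f y)"
  by (simp add: unit_measure_def integral_restrict_space set_lebesgue_integral_def)

lemma integrable_unit_measure:
  fixes f :: "real \<Rightarrow> 'b::{banach, second_countable_topology}"
  shows "integrable unit_measure f \<longleftrightarrow> set_integrable lborel {0<..<1} f"
  by (simp add: unit_measure_def integrable_restrict_space set_integrable_def)

lemma beta_weight_bounds:
  assumes "0 < (y::real)" "y < 1"
  shows "0 < y ^ i * (1 - y)" "y ^ i * (1 - y) \<le> 1"
  using assms by (auto intro!: mult_le_one power_le_one)

lemma beta_shift_nonpos:
  assumes "0 < n" "0 < y" "y < 1"
  shows "beta_shift n i y \<le> 0"
  using beta_weight_bounds[OF assms(2,3), of i] assms(1)
  by (auto simp: beta_shift_def divide_nonpos_pos)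

lemma beta_shift_measurable [measurable]: "beta_shift n i \<in> borel_measurable unit_measure"
proof -
  have "beta_shift n i \<in> borel_measurable borel" unfolding beta_shift_def by measurable
  then show ?thesis unfolding unit_measure_def by (intro measurable_restrict_space1) simp
qed

lemma prob_space_unit_measure: "prob_space unit_measure"
  by standard (simp add: unit_measure_def emeasure_restrict_space space_restrict_space)

lemma powr_integrable_unit_measure:
  assumes "0 < a" "0 < (b::real)"
  shows "integrable unit_measure (\<lambda>y. y powr (a - 1) * (1 - y) powr (b - 1))"
    and "(\<integral>y. y powr (a - 1) * (1 - y) powr (b - 1) \<partial>unit_measure) = Beta a b"
proof -
  have i: "set_integrable lborel {0<..<1} (\<lambda>y. y powr (a - 1) * (1 - y) powr (b - 1))"
    by (rule set_integrable_subset[OF integrable_Beta[OF assms]]) auto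
  then show "integrable unit_measure (\<lambda>y. y powr (a - 1) * (1 - y) powr (b - 1))"
    by (simp add: integrable_unit_measure)
  have "((\<lambda>y. y powr (a - 1) * (1 - y) powr (b - 1)) has_integral Beta a b) {0<..<1}"
    using has_integral_Beta_real[OF assms] by (simp add: has_integral_Icc_iff_Ioo)
  then show "(\<integral>y. y powr (a - 1) * (1 - y) powr (b - 1) \<partial>unit_measure) = Beta a b"
    using set_borel_integral_eq_integral(2)[OF i] by (simp add: integral_unit_measure integral_unique)
qed

lemma exp_ln_beta_weight:
  assumes "0 < (y::real)" "y < 1"
  shows "exp (x * ln (y ^ i * (1 - y))) = y powr (real i * x) * (1 - y) powr x"
proof -
  have "ln (y ^ i * (1 - y)) = real i * ln y + ln (1 - y)"
    using assms by (subst ln_mult) (auto simp: ln_realpow)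
  then show ?thesis using assms by (simp add: powr_def exp_add[symmetric] algebra_simps)
qed

text \<open>The exponent -1/(2i) turns the weight into y^(-1/2) (1 - y)^(-1/(2i)), with both powers
  above -1. The integral is Beta(1/2, 1 - 1/(2i)).\<close>

lemma beta_weight_integrable:
  assumes "i \<ge> 1"
  shows "integrable unit_measure (\<lambda>y. exp (- (1 / (2 * real i)) * ln (y ^ i * (1 - y))))"
proof -
  have "integrable unit_measure (\<lambda>y. y powr (1/2 - 1) * (1 - y) powr ((1 - 1 / (2 * real i)) - 1))"
    using assms by (intro powr_integrable_unit_measure) (auto simp: field_simps)
  also have "?this \<longleftrightarrow> ?thesis"
    using assms by (intro Bochner_Integration.integrable_cong refl) (subst exp_ln_beta_weight, auto)
  finally show ?thesis .
qed

lemma averaging_beta: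
  assumes "0 < n" "i \<ge> 1"
  shows "averaging unit_measure (beta_shift n i) (n / (2 * real i))"
proof -
  interpret prob_space unit_measure by (rule prob_space_unit_measure)
  show ?thesis
  proof unfold_locales
    show "integrable unit_measure (\<lambda>y. exp (- (n / (2 * real i)) * beta_shift n i y))"
      using beta_weight_integrable[OF assms(2)] assms by (simp add: beta_shift_def)
  qed (use assms in \<open>auto simp: beta_shift_nonpos\<close>)
qed

text \<open>Both sides are holomorphic for Re z > -1/(2i) and agree for real z, by Euler's Beta integral.\<close>

lemma complex_Beta_integral:
  assumes i: "i \<ge> 1" and z: "0 \<le> Re z"
  shows "(1 + of_nat (Suc i) * z) * (\<integral>y. exp (z * of_real (ln (y ^ i * (1 - y)))) \<partial>unit_measure)
     = Gamma (1 + of_nat i * z) * Gamma (1 + z) / Gamma (1 + of_nat (Suc i) * z)"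
proof -
  \<comment> \<open>The margin left by \<open>beta_weight_integrable\<close>. It makes an open half
    plane out of the closed one, and keeps Re (1 + j z) positive for j up to
    \<open>i\<close>.\<close>
  define c where "c = 1 / (2 * real i)"
  have c: "0 < c" "c \<le> 1 / 2" "real i * c = 1 / 2" using i by (auto simp: c_def field_simps)
  define S where "S = {z. - c < Re z}"
  \<comment> \<open>The reciprocal \<open>rGamma\<close> is entire, so the denominator raises no
    question of poles.\<close>
  define F where "F = (\<lambda>z::complex. (\<integral>y. exp (z * of_real (ln (y ^ i * (1 - y)))) \<partial>unit_measure)
      - Gamma (1 + of_nat i * z) * Gamma (1 + z) * rGamma (2 + of_nat (Suc i) * z))"
  have S: "open S" "connected S"
    unfolding S_def by (auto intro: open_halfspace_Re_gt convex_connected convex_halfspace_Re_gt)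
  have Gi: "1 + of_nat j * z \<notin> \<int>\<^sub>\<le>\<^sub>0" if "z \<in> S" "j \<le> i" for z :: complex and j
  proof -
    have "- c < Re z" using that by (simp add: S_def)
    then have "real j * - c \<le> real j * Re z" by (intro mult_left_mono) auto
    moreover have "real j * c \<le> real i * c" using that c by (intro mult_right_mono) auto
    ultimately have "0 < Re (1 + of_nat j * z)" using c by simp
    then show ?thesis using nonpos_Ints_cases by (metis Re_complex_of_real of_int_le_0_iff of_real_of_int_eq not_le)
  qed
  have "(\<lambda>z::complex. \<integral>y. exp (z * of_real (ln (y ^ i * (1 - y)))) \<partial>unit_measure) holomorphic_on S"
  proof (rule holomorphic_parameter_integral[OF S(1) _ _ beta_weight_integrable[OF i]])
    show "(\<lambda>y. exp (w * complex_of_real (ln (y ^ i * (1 - y))))) \<in> borel_measurable unit_measure" for w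
      unfolding unit_measure_def by (intro measurable_restrict_space1) measurable
    show "norm (exp (w * complex_of_real (ln (y ^ i * (1 - y))))) \<le> exp (- (1 / (2 * real i)) * ln (y ^ i * (1 - y)))"
      if "w \<in> S" "y \<in> space unit_measure" for w y
    proof -
      have "ln (y ^ i * (1 - y)) \<le> 0" using beta_weight_bounds[of y i] that by simp
      then have "Re w * ln (y ^ i * (1 - y)) \<le> - c * ln (y ^ i * (1 - y))"
        using that by (intro mult_right_mono_neg) (auto simp: S_def)
      then show ?thesis by (simp add: c_def)
    qed
  qed (auto intro!: holomorphic_intros)
  moreover have "1 + z \<notin> \<int>\<^sub>\<le>\<^sub>0" if "z \<in> S" for z :: complex using Gi[OF that, of 1] i by simp
  ultimately have hol: "F holomorphic_on S"
    unfolding F_def using Gi by (intro holomorphic_intros) auto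
  define U where "U = complex_of_real ` {0..}"
  have zero: "F w = 0" if w: "w \<in> U" for w
  proof -
    obtain x where x: "w = of_real x" "0 \<le> x" using w by (auto simp: U_def)
    have "(\<integral>y. exp (w * of_real (ln (y ^ i * (1 - y)))) \<partial>unit_measure)
        = (\<integral>y. complex_of_real (exp (x * ln (y ^ i * (1 - y)))) \<partial>unit_measure)"
      unfolding x(1) by (simp add: exp_of_real flip: of_real_mult)
    also have "\<dots> = of_real (\<integral>y. exp (x * ln (y ^ i * (1 - y))) \<partial>unit_measure)"
      by (rule integral_complex_of_real)
    also have "(\<integral>y. exp (x * ln (y ^ i * (1 - y))) \<partial>unit_measure)
        = (\<integral>y. y powr ((real i * x + 1) - 1) * (1 - y) powr ((x + 1) - 1) \<partial>unit_measure)"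
      by (rule Bochner_Integration.integral_cong[OF refl]) (simp add: exp_ln_beta_weight)
    also have "\<dots> = Beta (real i * x + 1) (x + 1)"
      using x by (intro powr_integrable_unit_measure) (auto intro: add_nonneg_pos)
    also have "complex_of_real \<dots> = Gamma (1 + of_nat i * w) * Gamma (1 + w) * rGamma (2 + of_nat (Suc i) * w)"
      unfolding Beta_altdef x(1)
      by (simp add: Gamma_complex_of_real[symmetric] rGamma_complex_of_real[symmetric] algebra_simps)
    finally show ?thesis by (simp add: F_def)
  qed
  have "F z = 0"
  proof (rule analytic_continuation[OF hol S, of U "of_real 1"])
    show "U \<subseteq> S" using c by (auto simp: U_def S_def)
    show "complex_of_real 1 islimpt U"
      unfolding islimpt_approachable
    proof (intro allI impI)
      fix e :: real assume "0 < e"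
      then show "\<exists>x'\<in>U. x' \<noteq> complex_of_real 1 \<and> dist x' (complex_of_real 1) < e"
        unfolding U_def
        by (intro bexI[of _ "of_real (1 + e / 2)"] conjI image_eqI[of _ _ "1 + e / 2"])
           (simp_all only: dist_of_real of_real_eq_iff, auto simp: dist_real_def)
    qed
  qed (use zero z c in \<open>auto simp: S_def\<close>)
  then have 1: "(\<integral>y. exp (z * of_real (ln (y ^ i * (1 - y)))) \<partial>unit_measure)
      = Gamma (1 + of_nat i * z) * Gamma (1 + z) * rGamma (2 + of_nat (Suc i) * z)" by (simp add: F_def)
  \<comment> \<open>The functional equation of Gamma: this is where the prefactor of the claim comes
    from.\<close>
  have 2: "rGamma (1 + of_nat (Suc i) * z) = (1 + of_nat (Suc i) * z) * rGamma (2 + of_nat (Suc i) * z)"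
    using rGamma_plus1[of "1 + of_nat (Suc i) * z"] by (simp add: algebra_simps)
  have "Gamma (1 + of_nat i * z) * Gamma (1 + z) / Gamma (1 + of_nat (Suc i) * z)
      = Gamma (1 + of_nat i * z) * Gamma (1 + z) * rGamma (1 + of_nat (Suc i) * z)"
    by (simp add: rGamma_inverse_Gamma divide_inverse)
  then show ?thesis unfolding 1 2 by (simp only: mult_ac)
qed

section \<open>The kernels\<close>

text \<open>The classical kernel \<kappa> s^\<kappa> exp(-s^\<kappa>) of Gamma(1 + u/\<kappa>), in
  the logarithmic coordinate.\<close>

definition stretched_kernel :: "real \<Rightarrow> complex \<Rightarrow> complex" where
  "stretched_kernel \<kappa> w = of_real \<kappa> * exp (of_real \<kappa> * w - exp (of_real \<kappa> * w))"

text \<open>Transpose of \<open>function_step\<close>: order of the operators reversed, sign of the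
  derivative changed. On Mellin transforms the derivative part multiplies by 1 + (i+1) u/n.\<close>

definition kernel_step :: "real \<Rightarrow> nat \<Rightarrow> (complex \<Rightarrow> complex) \<Rightarrow> complex \<Rightarrow> complex" where
  "kernel_step n i e = averaging.up unit_measure (beta_shift n i)
     (\<lambda>w. e w + (- (of_nat (Suc i) / of_real n)) * deriv e w)"

definition function_step :: "real \<Rightarrow> nat \<Rightarrow> (complex \<Rightarrow> complex) \<Rightarrow> complex \<Rightarrow> complex" where
  "function_step n i f = (let g = averaging.down unit_measure (beta_shift n i) f in
     (\<lambda>w. g w + (of_nat (Suc i) / of_real n) * deriv g w))"

primrec product_kernel :: "real \<Rightarrow> real \<Rightarrow> nat \<Rightarrow> complex \<Rightarrow> complex" where
  "product_kernel n \<kappa> 0 = stretched_kernel \<kappa>"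
| "product_kernel n \<kappa> (Suc i) = kernel_step n (Suc i) (product_kernel n \<kappa> i)"

text \<open>The highest step acts first, mirroring \<open>product_kernel\<close>, where it is the
  outermost and hence the first to be moved across the pairing.\<close>

primrec product_function :: "real \<Rightarrow> nat \<Rightarrow> (complex \<Rightarrow> complex) \<Rightarrow> complex \<Rightarrow> complex" where
  "product_function n 0 f = f"
| "product_function n (Suc i) f = product_function n i (function_step n (Suc i) f)"

text \<open>The modulus of exp(-s^\<kappa>) is exp(-|s|^\<kappa> cos(\<kappa> arg s)), and the
  cosine stays away from 0 on narrower strips. The factor s^\<kappa> supplies the left rate.\<close>

lemma flat_stretched_kernel:
  assumes \<kappa>: "0 < \<kappa>"
  shows "flat \<kappa> (pi / (2 * \<kappa>)) (stretched_kernel \<kappa>)"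
  unfolding flat_def
proof (intro conjI allI impI)
  show "stretched_kernel \<kappa> holomorphic_on hstrip (- (pi / (2 * \<kappa>))) (pi / (2 * \<kappa>))"
    unfolding stretched_kernel_def by (intro holomorphic_intros)
  fix \<alpha>' assume \<alpha>': "\<alpha>' < pi / (2 * \<kappa>)"
  \<comment> \<open>The given bound may be negative, in which case nothing is claimed; monotonicity
    of the cosine needs a nonnegative angle.\<close>
  define \<beta> where "\<beta> = max 0 \<alpha>'"
  have \<beta>: "0 \<le> \<beta>" "\<kappa> * \<beta> < pi / 2" using \<alpha>' \<kappa> by (auto simp: \<beta>_def max_def field_simps)
  define c where "c = cos (\<kappa> * \<beta>)"
  have "- (pi / 2) < \<kappa> * \<beta>" using \<beta> \<kappa> pi_gt_zero by (meson less_le_trans mult_nonneg_nonneg neg_less_0_iff_less pi_half_gt_zero less_imp_le)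
  then have c: "c > 0" unfolding c_def using \<beta> by (intro cos_gt_zero_pi) auto
  have "norm (stretched_kernel \<kappa> w) \<le> \<kappa> * exp (\<kappa> * Re w - c * exp (\<kappa> * Re w))" if w: "\<bar>Im w\<bar> \<le> \<alpha>'" for w
  proof -
    have "\<kappa> * \<beta> \<le> pi" using \<beta>(2) pi_gt_zero by linarith
    then have "c \<le> cos \<bar>\<kappa> * Im w\<bar>" unfolding c_def
      using w \<beta> \<kappa> by (intro cos_monotone_0_pi_le) (auto simp: abs_mult \<beta>_def max_def mult_left_mono)
    then have "c \<le> cos (\<kappa> * Im w)" by simp
    then have "c * exp (\<kappa> * Re w) \<le> exp (\<kappa> * Re w) * cos (\<kappa> * Im w)"
      by (simp add: mult.commute mult_right_mono)
    then show ?thesis using \<kappa> by (simp add: stretched_kernel_def norm_mult Re_exp)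
  qed
  then show "\<exists>A>0. \<exists>c>0. \<exists>\<delta>>0. \<forall>w. \<bar>Im w\<bar> \<le> \<alpha>' \<longrightarrow>
      norm (stretched_kernel \<kappa> w) \<le> A * exp (\<delta> * Re w - c * exp (\<kappa> * Re w))"
    using \<kappa> c by blast
qed

lemma flat_kernel_step:
  assumes "flat \<kappa> \<alpha> e" "0 < \<kappa>" "0 < n" "i \<ge> 1"
  shows "flat \<kappa> \<alpha> (kernel_step n i e)"
proof -
  interpret averaging unit_measure "beta_shift n i" "n / (2 * real i)" by (rule averaging_beta) fact+
  show ?thesis unfolding kernel_step_def
    by (intro flat_up flat_add_cmult flat_deriv assms less_imp_le)
qed

lemma flat_product_kernel:
  assumes "0 < \<kappa>" "0 < n"
  shows "flat \<kappa> (pi / (2 * \<kappa>)) (product_kernel n \<kappa> i)"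
  using assms by (induction i) (auto intro: flat_stretched_kernel flat_kernel_step)

lemma moderate_function_step:
  assumes "moderate \<sigma> a b f" "0 \<le> \<sigma>" "0 < n" "i \<ge> 1"
  shows "moderate \<sigma> a b (function_step n i f)"
proof -
  interpret averaging unit_measure "beta_shift n i" "n / (2 * real i)" by (rule averaging_beta) fact+
  show ?thesis unfolding function_step_def Let_def
    by (intro moderate_down moderate_add_cmult moderate_deriv assms)
qed

lemma moderate_product_function:
  assumes "moderate \<sigma> a b f" "0 \<le> \<sigma>" "0 < n"
  shows "moderate \<sigma> a b (product_function n i f)"
  using assms
proof (induction i arbitrary: f)
  case (Suc i)
  then show ?case using moderate_function_step[OF Suc.prems, of "Suc i"] by simp
qed simp

lemma pairing_step:
  assumes e: "flat \<kappa> \<alpha> e" and f: "moderate \<sigma> a b f" and pos: "0 < \<kappa>" "0 \<le> \<sigma>" and n: "0 < n" "i \<ge> 1"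
    and d: "a < d" "d < b" "\<bar>d - Im t\<bar> < \<alpha>"
  shows "(\<integral>x. kernel_step n i e (Complex x d - t) * f (Complex x d) \<partial>lborel)
       = (\<integral>x. e (Complex x d - t) * function_step n i f (Complex x d) \<partial>lborel)"
proof -
  interpret averaging unit_measure "beta_shift n i" "n / (2 * real i)" by (rule averaging_beta) fact+
  let ?\<beta> = "of_nat (Suc i) / complex_of_real n"
  have fl: "flat \<kappa> \<alpha> (\<lambda>w. e w + (- ?\<beta>) * deriv e w)"
    by (intro flat_add_cmult flat_deriv e pos less_imp_le)
  show ?thesis
    unfolding kernel_step_def function_step_def Let_def pairing_up_down[OF fl f pos d]
    by (rule pairing_deriv[OF e moderate_down[OF f pos(2)] pos d])
qed

text \<open>Used twice: against exponentials it computes the Mellin transform of the product kernel,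
  against the geometric function it identifies the two Laplace integrals.\<close>

lemma pairing_product:
  assumes f: "moderate \<sigma> a b f" and pos: "0 < \<kappa>" "0 \<le> \<sigma>" and n: "0 < n"
    and d: "a < d" "d < b" "\<bar>d - Im t\<bar> < pi / (2 * \<kappa>)"
  shows "(\<integral>x. product_kernel n \<kappa> i (Complex x d - t) * f (Complex x d) \<partial>lborel)
       = (\<integral>x. stretched_kernel \<kappa> (Complex x d - t) * product_function n i f (Complex x d) \<partial>lborel)"
  using f
proof (induction i arbitrary: f)
  case (Suc i)
  have "moderate \<sigma> a b (function_step n (Suc i) f)"
    using moderate_function_step[OF Suc.prems] pos n by simp
  from Suc.IH[OF this] show ?case
    using pairing_step[OF flat_product_kernel[OF pos(1) n] Suc.prems pos n _ d, of "Suc i"] by simp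
qed simp

section \<open>Uniqueness of Fourier transforms\<close>

lemma AE_lborel_open_imp_empty:
  fixes S :: "real set"
  assumes "open S" "AE x in lborel. x \<notin> S"
  shows "S = {}"
proof -
  have "S \<in> null_sets lborel"
    using assms by (subst AE_iff_null_sets) (auto intro: borel_open)
  then have "negligible S"
    using null_sets_completionI by (auto simp: negligible_iff_null_sets)
  then show ?thesis using assms(1) open_not_negligible by blast
qed

text \<open>The positive and negative parts have equal mass, by the transform at 0. Normalised by it
  they are probability densities with the same characteristic function, and Levy's uniqueness
  theorem applies; if the mass is 0, both parts vanish almost everywhere.\<close>

lemma fourier_unique_real:
  fixes f :: "real \<Rightarrow> real"
  assumes f: "integrable lborel f"
    and 0: "\<And>y. (\<integral>x. iexp (y * x) * of_real (f x) \<partial>lborel) = 0"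
  shows "AE x in lborel. f x = 0"
proof -
  define P where "P = (\<lambda>x. max (f x) 0)"
  define N where "N = (\<lambda>x. max (- f x) 0)"
  have [measurable]: "f \<in> borel_measurable lborel" using f by simp
  have P: "integrable lborel P" and N: "integrable lborel N" using f by (auto simp: P_def N_def)
  have PN: "f x = P x - N x" "0 \<le> P x" "0 \<le> N x" for x by (auto simp: P_def N_def)
  define I where "I = (\<integral>x. P x \<partial>lborel)"
  have "complex_of_real (\<integral>x. f x \<partial>lborel) = 0"
    using 0[of 0] by (simp flip: integral_complex_of_real)
  then have "(\<integral>x. P x \<partial>lborel) - (\<integral>x. N x \<partial>lborel) = 0"
    using P N by (simp add: PN(1))
  then have IN: "(\<integral>x. N x \<partial>lborel) = I" by (simp add: I_def)
  have I0: "0 \<le> I" unfolding I_def using PN by (intro Bochner_Integration.integral_nonneg) auto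
  show ?thesis
  proof (cases "I = 0")
    case True
    then have "AE x in lborel. P x = 0" "AE x in lborel. N x = 0"
      using integral_nonneg_eq_0_iff_AE[OF P] integral_nonneg_eq_0_iff_AE[OF N] PN IN
      by (auto simp: I_def)
    then show ?thesis by eventually_elim (simp add: PN(1))
  next
    case False
    then have I: "0 < I" using I0 by simp
    have dist: "real_distribution (density lborel (\<lambda>x. ennreal (g x / I)))"
      if g: "integrable lborel g" "\<And>x. 0 \<le> g x" "(\<integral>x. g x \<partial>lborel) = I" for g
    proof -
      have [measurable]: "g \<in> borel_measurable borel" using borel_measurable_integrable[OF g(1)] by simp
      have "(\<integral>\<^sup>+x. ennreal (g x / I) \<partial>lborel) = ennreal (\<integral>x. g x / I \<partial>lborel)"
        using g I by (intro nn_integral_eq_integral) auto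
      also have "\<dots> = 1" using g I by simp
      finally have "(\<integral>\<^sup>+x. ennreal (g x / I) \<partial>lborel) = 1" .
      then have "prob_space (density lborel (\<lambda>x. ennreal (g x / I)))"
        by (intro prob_spaceI) (simp add: emeasure_density)
      then show ?thesis by (simp add: real_distribution_def real_distribution_axioms_def)
    qed
    have char: "char (density lborel (\<lambda>x. ennreal (g x / I))) y = (\<integral>x. iexp (y * x) * of_real (g x) \<partial>lborel) / I"
      if g: "integrable lborel g" "\<And>x. 0 \<le> g x" for g y
    proof -
      have [measurable]: "g \<in> borel_measurable borel" using borel_measurable_integrable[OF g(1)] by simp
      have "char (density lborel (\<lambda>x. ennreal (g x / I))) y = (\<integral>x. (g x / I) *\<^sub>R iexp (y * x) \<partial>lborel)"
        unfolding char_def using g I by (subst integral_density) auto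
      also have "\<dots> = (\<integral>x. iexp (y * x) * of_real (g x) / of_real I \<partial>lborel)"
        by (simp add: scaleR_conv_of_real mult_ac)
      finally show ?thesis by simp
    qed
    have int: "integrable lborel (\<lambda>x. iexp (y * x) * of_real (g x))" if "integrable lborel g" for g y
      by (rule Bochner_Integration.integrable_bound[OF that])
         (use that in \<open>auto simp: norm_mult\<close>)
    have "(\<integral>x. iexp (y * x) * of_real (P x) \<partial>lborel) - (\<integral>x. iexp (y * x) * of_real (N x) \<partial>lborel) = 0" for y
    proof -
      have "(\<integral>x. iexp (y * x) * of_real (P x) \<partial>lborel) - (\<integral>x. iexp (y * x) * of_real (N x) \<partial>lborel)
        = (\<integral>x. iexp (y * x) * of_real (P x) - iexp (y * x) * of_real (N x) \<partial>lborel)"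
        using int[OF P] int[OF N] by simp
      also have "\<dots> = (\<integral>x. iexp (y * x) * of_real (f x) \<partial>lborel)"
        by (simp add: PN(1) algebra_simps)
      finally show ?thesis using 0[of y] by simp
    qed
    then have "char (density lborel (\<lambda>x. ennreal (P x / I))) = char (density lborel (\<lambda>x. ennreal (N x / I)))"
      using P N PN by (auto simp: fun_eq_iff char)
    then have "density lborel (\<lambda>x. ennreal (P x / I)) = density lborel (\<lambda>x. ennreal (N x / I))"
      using P N PN I_def IN by (intro Levy_uniqueness dist) auto
    then have "AE x in lborel. ennreal (P x / I) = ennreal (N x / I)"
      using P N by (intro sigma_finite_measure.density_unique[OF sigma_finite_lborel]) auto
    then show ?thesis
    proof eventually_elim
      case (elim x)
      then have "P x / I = N x / I" using PN[of x] I by (subst (asm) ennreal_inj) auto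
      then show ?case using I by (simp add: PN(1))
    qed
  qed
qed

text \<open>The transform of the conjugate at y is the conjugate of the transform at -y, so real and
  imaginary part have vanishing transforms too. Continuity turns almost everywhere into
  everywhere.\<close>

lemma fourier_unique:
  fixes f :: "real \<Rightarrow> complex"
  assumes f: "integrable lborel f" and cont: "continuous_on UNIV f"
    and 0: "\<And>y. (\<integral>x. iexp (y * x) * f x \<partial>lborel) = 0"
  shows "f x = 0"
proof -
  have int: "integrable lborel (\<lambda>x. iexp (y * x) * g x)" if "integrable lborel g" for g :: "real \<Rightarrow> complex" and y
    by (rule Bochner_Integration.integrable_bound[OF that]) (use that in \<open>auto simp: norm_mult\<close>)
  have zc: "(\<integral>x. iexp (y * x) * cnj (f x) \<partial>lborel) = 0" for y
  proof -
    have "(\<integral>x. iexp (y * x) * cnj (f x) \<partial>lborel) = (\<integral>x. cnj (iexp ((- y) * x) * f x) \<partial>lborel)"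
      by (simp add: exp_cnj)
    also have "\<dots> = cnj (\<integral>x. iexp ((- y) * x) * f x \<partial>lborel)" by (rule Bochner_Integration.integral_cnj)
    finally show ?thesis using 0[of "- y"] by simp
  qed
  have fc: "integrable lborel (\<lambda>x. cnj (f x))" using f by simp
  have "(\<integral>x. iexp (y * x) * of_real (Re (f x)) \<partial>lborel) = 0" for y
  proof -
    have "(\<integral>x. iexp (y * x) * of_real (Re (f x)) \<partial>lborel)
        = (\<integral>x. (iexp (y * x) * f x + iexp (y * x) * cnj (f x)) / 2 \<partial>lborel)"
      by (rule Bochner_Integration.integral_cong) (simp_all add: complex_add_cnj flip: distrib_left)
    also have "\<dots> = ((\<integral>x. iexp (y * x) * f x \<partial>lborel) + (\<integral>x. iexp (y * x) * cnj (f x) \<partial>lborel)) / 2"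
      using int[OF f] int[OF fc] by simp
    finally show ?thesis using 0 zc by simp
  qed
  then have Re0: "AE x in lborel. Re (f x) = 0"
    using f by (intro fourier_unique_real) auto
  have "(\<integral>x. iexp (y * x) * of_real (Im (f x)) \<partial>lborel) = 0" for y
  proof -
    have "(\<integral>x. iexp (y * x) * of_real (Im (f x)) \<partial>lborel)
        = (\<integral>x. (iexp (y * x) * f x - iexp (y * x) * cnj (f x)) / (2 * \<i>) \<partial>lborel)"
    proof (rule Bochner_Integration.integral_cong[OF refl])
      fix x
      have "of_real (Im (f x)) = (f x - cnj (f x)) / (2 * \<i>)" by (simp add: complex_eq_iff)
      then show "iexp (y * x) * of_real (Im (f x)) = (iexp (y * x) * f x - iexp (y * x) * cnj (f x)) / (2 * \<i>)"
        by (simp only: times_divide_eq_right right_diff_distrib)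
    qed
    also have "\<dots> = ((\<integral>x. iexp (y * x) * f x \<partial>lborel) - (\<integral>x. iexp (y * x) * cnj (f x) \<partial>lborel)) / (2 * \<i>)"
      using int[OF f] int[OF fc] by simp
    finally show ?thesis using 0 zc by simp
  qed
  then have Im0: "AE x in lborel. Im (f x) = 0"
    using f by (intro fourier_unique_real) auto
  have "{x. f x \<noteq> 0} = {}"
  proof (rule AE_lborel_open_imp_empty)
    show "open {x. f x \<noteq> 0}" using cont by (intro open_Collect_neq) auto
    show "AE x in lborel. x \<notin> {x. f x \<noteq> 0}" using Re0 Im0 by eventually_elim (auto simp: complex_eq_iff)
  qed
  then show ?thesis by blast
qed

text \<open>Positivity of the kernels comes from writing them as convolution powers on the real line.\<close>

lemma positive_convolution:
  fixes g h :: "real \<Rightarrow> real"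
  assumes g: "integrable lborel g" "\<And>x. 0 < g x"
    and h: "integrable lborel h" "continuous_on UNIV h" "\<And>x. 0 < h x" "\<And>x. h x \<le> B"
  obtains k where "integrable lborel k" "continuous_on UNIV k" "\<And>x. 0 < k x"
    "\<And>y. (\<integral>x. iexp (y * x) * of_real (k x) \<partial>lborel)
      = (\<integral>x. iexp (y * x) * of_real (g x) \<partial>lborel) * (\<integral>x. iexp (y * x) * of_real (h x) \<partial>lborel)"
proof -
  have [measurable]: "g \<in> borel_measurable borel" "h \<in> borel_measurable borel"
    using borel_measurable_integrable[OF g(1)] borel_measurable_integrable[OF h(1)] by auto
  define k where "k = (\<lambda>x. \<integral>y. g y * h (x - y) \<partial>lborel)"
  \<comment> \<open>Boundedness of \<open>h\<close> gives one dominating function for all x, which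
    serves the existence and the continuity of the convolution.\<close>
  have gB: "integrable lborel (\<lambda>y. g y * B)" using g by simp
  have bd: "norm (g y * h (x - y)) \<le> g y * B" for x y
    using g(2)[of y] h(3)[of "x - y"] h(4)[of "x - y"] by (simp add: abs_mult mult_left_mono)
  have intx: "integrable lborel (\<lambda>y. g y * h (x - y))" for x
    by (rule Bochner_Integration.integrable_bound[OF gB])
       (use bd in \<open>auto intro!: AE_I2 intro: order_trans[OF _ abs_ge_self]\<close>)
  have cont: "continuous_on UNIV k"
  proof -
    have "isCont k x" for x
      unfolding continuous_at_sequentially o_def
    proof (intro allI impI)
      fix X assume X: "X \<longlonglongrightarrow> x"
      show "(\<lambda>n. k (X n)) \<longlonglongrightarrow> k x"
        unfolding k_def
      proof (rule integral_dominated_convergence[OF _ _ gB])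
        have "isCont h z" for z using h(2) continuous_on_eq_continuous_at by blast
        then show "AE y in lborel. (\<lambda>i. g y * h (X i - y)) \<longlonglongrightarrow> g y * h (x - y)"
          using X by (intro AE_I2 tendsto_intros isCont_tendsto_compose[of _ h]) auto
      qed (use bd in auto)
    qed
    then show ?thesis by (simp add: continuous_at_imp_continuous_on)
  qed
  have pos: "0 < k x" for x
  proof -
    have nn: "AE y in lborel. 0 \<le> g y * h (x - y)" using g(2) h(3) by (simp add: less_imp_le)
    have "k x \<noteq> 0"
    proof
      assume "k x = 0"
      then have "AE y in lborel. g y * h (x - y) = 0"
        using integral_nonneg_eq_0_iff_AE[OF intx nn] by (simp add: k_def)
      then have "AE y in lborel. y \<notin> (UNIV :: real set)"
        by eventually_elim (use g(2) h(3) in \<open>metis mult_eq_0_iff less_irrefl\<close>)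
      then show False using AE_lborel_open_imp_empty[of UNIV] by simp
    qed
    moreover have "0 \<le> k x" unfolding k_def using nn by (rule integral_nonneg_AE)
    ultimately show ?thesis by simp
  qed
  have hs: "integrable lborel (\<lambda>x. h (x - y))" "(\<integral>x. h (x - y) \<partial>lborel) = (\<integral>x. h x \<partial>lborel)" for y
    using lborel_integrable_real_affine_iff[of 1 h "- y"] lborel_integral_real_affine[of 1 h "- y"] h(1) by simp_all
  \<comment> \<open>The bounded factor \<open>c\<close> is 1 for integrability of the convolution
    and the character for its Fourier transform.\<close>
  have pair: "integrable (lborel \<Otimes>\<^sub>M lborel) (\<lambda>(y, x). c x * (of_real (g y) * of_real (h (x - y)) :: complex))"
    if [measurable]: "c \<in> borel_measurable borel" and c: "\<And>x. norm (c x) \<le> 1" for c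
  proof (rule lborel_pair.Fubini_integrable)
    have "integrable (lborel :: real measure) (\<lambda>y. g y * (\<integral>x. h x \<partial>lborel))" using g by simp
    then show "integrable lborel (\<lambda>y. \<integral>x. norm (case (y, x) of (y, x) \<Rightarrow> c x * (of_real (g y) * of_real (h (x - y)))) \<partial>lborel)"
    proof (rule Bochner_Integration.integrable_bound)
      show "AE y in lborel. norm (\<integral>x. norm (case (y, x) of (y, x) \<Rightarrow> c x * (complex_of_real (g y) * of_real (h (x - y)))) \<partial>lborel)
          \<le> norm (g y * (\<integral>x. h x \<partial>lborel))"
      proof (intro AE_I2)
        fix y
        have "(\<integral>x. norm (c x) * (g y * h (x - y)) \<partial>lborel) \<le> (\<integral>x. g y * h (x - y) \<partial>lborel)"
        proof (rule integral_mono)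
          show "integrable lborel (\<lambda>x. g y * h (x - y))" using hs by simp
          then show "integrable lborel (\<lambda>x. norm (c x) * (g y * h (x - y)))"
            by (rule Bochner_Integration.integrable_bound)
               (use c in \<open>auto intro!: AE_I2 mult_left_le_one_le simp: abs_mult\<close>)
          show "norm (c x) * (g y * h (x - y)) \<le> g y * h (x - y)" for x
            using c[of x] g(2)[of y] h(3)[of "x - y"] by (intro mult_left_le_one_le) auto
        qed
        also have "\<dots> = g y * (\<integral>x. h x \<partial>lborel)" using hs by simp
        finally have "(\<integral>x. norm (c x) * (g y * h (x - y)) \<partial>lborel) \<le> g y * (\<integral>x. h x \<partial>lborel)" .
        moreover have "0 \<le> (\<integral>x. norm (c x) * (g y * h (x - y)) \<partial>lborel)"
          using g(2) h(3) by (intro Bochner_Integration.integral_nonneg) (simp add: less_imp_le)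
        moreover have "norm (c x * (complex_of_real (g y) * of_real (h (x - y)))) = norm (c x) * (g y * h (x - y))" for x
          using g(2)[of y] h(3)[of "x - y"] by (simp add: norm_mult)
        ultimately show "norm (\<integral>x. norm (case (y, x) of (y, x) \<Rightarrow> c x * (complex_of_real (g y) * of_real (h (x - y)))) \<partial>lborel)
          \<le> norm (g y * (\<integral>x. h x \<partial>lborel))" by simp
      qed
    qed auto
    show "AE y in lborel. integrable lborel (\<lambda>x. case (y, x) of (y, x) \<Rightarrow> c x * (complex_of_real (g y) * of_real (h (x - y))))"
    proof (intro AE_I2)
      fix y
      have "integrable lborel (\<lambda>x. g y * h (x - y))" using hs by simp
      then show "integrable lborel (\<lambda>x. case (y, x) of (y, x) \<Rightarrow> c x * (complex_of_real (g y) * of_real (h (x - y))))"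
        by (rule Bochner_Integration.integrable_bound)
           (use c in \<open>auto intro!: AE_I2 mult_left_le_one_le simp: abs_mult norm_mult\<close>)
    qed
  qed auto
  show ?thesis
  proof (rule that[OF _ cont pos])
    have "integrable lborel (\<lambda>x. \<integral>y. of_real (g y) * complex_of_real (h (x - y)) \<partial>lborel)"
      using lborel_pair.integrable_snd[OF pair[of "\<lambda>_. 1"]] by simp
    then have "integrable lborel (\<lambda>x. complex_of_real (k x))"
      unfolding k_def by (simp flip: integral_complex_of_real)
    then show "integrable lborel k" by (simp add: complex_of_real_integrable_eq)
    fix t :: real
    have "(\<integral>x. iexp (t * x) * of_real (k x) \<partial>lborel)
        = (\<integral>x. \<integral>y. iexp (t * x) * (of_real (g y) * complex_of_real (h (x - y))) \<partial>lborel \<partial>lborel)"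
      unfolding k_def by (simp flip: integral_complex_of_real)
    also have "\<dots> = (\<integral>y. \<integral>x. iexp (t * x) * (of_real (g y) * complex_of_real (h (x - y))) \<partial>lborel \<partial>lborel)"
      by (rule lborel_pair.Fubini_integral) (use pair[of "\<lambda>x. iexp (t * x)"] in auto)
    also have "\<dots> = (\<integral>y. (iexp (t * y) * of_real (g y)) * (\<integral>x. iexp (t * x) * of_real (h x) \<partial>lborel) \<partial>lborel)"
    proof (rule Bochner_Integration.integral_cong[OF refl])
      fix y
      have "(\<integral>x. iexp (t * x) * (of_real (g y) * complex_of_real (h (x - y))) \<partial>lborel)
          = (\<integral>x. iexp (t * (y + 1 * x)) * (of_real (g y) * complex_of_real (h (y + 1 * x - y))) \<partial>lborel)"
        using lborel_integral_real_affine[of 1 "\<lambda>x. iexp (t * x) * (of_real (g y) * complex_of_real (h (x - y)))" y] by simp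
      also have "\<dots> = (\<integral>x. (iexp (t * y) * of_real (g y)) * (iexp (t * x) * of_real (h x)) \<partial>lborel)"
        by (simp add: distrib_left exp_add mult_ac)
      finally show "(\<integral>x. iexp (t * x) * (of_real (g y) * complex_of_real (h (x - y))) \<partial>lborel)
          = (iexp (t * y) * of_real (g y)) * (\<integral>x. iexp (t * x) * of_real (h x) \<partial>lborel)" by simp
    qed
    finally show "(\<integral>x. iexp (t * x) * of_real (k x) \<partial>lborel)
      = (\<integral>x. iexp (t * x) * of_real (g x) \<partial>lborel) * (\<integral>x. iexp (t * x) * of_real (h x) \<partial>lborel)"
      by simp
  qed
qed

section \<open>Mellin transforms and kernel functions\<close>

text \<open>The imaginary part of \<open>u\<close> contributes only exp(-Im u Im w), which is
  bounded on substrips. The summand 1 in the constant keeps it positive when \<open>k\<close> is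
  0.\<close>

lemma moderate_exp:
  assumes "0 \<le> Re u"
  shows "moderate (Re u) a b (\<lambda>w. k * exp (u * w))"
  unfolding moderate_def
proof (intro conjI allI impI)
  show "(\<lambda>w. k * exp (u * w)) holomorphic_on hstrip a b" by (intro holomorphic_intros)
  fix a' b' :: real
  define A where "A = (norm k + 1) * exp (\<bar>Im u\<bar> * (\<bar>a'\<bar> + \<bar>b'\<bar>))"
  have "norm (k * exp (u * w)) \<le> A * exp (Re u * Re w)" if w: "a' \<le> Im w \<and> Im w \<le> b'" for w
  proof -
    have "- (Im u * Im w) \<le> \<bar>Im u\<bar> * \<bar>Im w\<bar>" by (metis abs_ge_minus_self abs_mult)
    also have "\<dots> \<le> \<bar>Im u\<bar> * (\<bar>a'\<bar> + \<bar>b'\<bar>)" using w by (intro mult_left_mono) auto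
    finally have "exp (Re u * Re w + - (Im u * Im w)) \<le> exp (Re u * Re w + \<bar>Im u\<bar> * (\<bar>a'\<bar> + \<bar>b'\<bar>))"
      by simp
    then have "norm k * exp (Re u * Re w - Im u * Im w) \<le> (norm k + 1) * (exp (Re u * Re w) * exp (\<bar>Im u\<bar> * (\<bar>a'\<bar> + \<bar>b'\<bar>)))"
      unfolding exp_add[symmetric] by (intro mult_mono) auto
    then show ?thesis by (simp add: norm_mult A_def mult_ac)
  qed
  moreover have "A > 0" by (simp add: A_def add_nonneg_pos)
  ultimately show "\<exists>A>0. \<forall>w. a' \<le> Im w \<and> Im w \<le> b' \<longrightarrow> norm (k * exp (u * w)) \<le> A * exp (Re u * Re w)"
    by blast
qed

text \<open>The power s^u is an eigenfunction of real translations and of d/dw; the eigenvalue is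
  the quotient evaluated by \<open>complex_Beta_integral\<close>.\<close>

lemma function_step_exp:
  assumes n: "0 < n" "i \<ge> 1" and u: "0 \<le> Re u"
  shows "function_step n i (\<lambda>w. k * exp (u * w)) = (\<lambda>w. (k *
    (Gamma (1 + of_nat i * (u / of_real n)) * Gamma (1 + u / of_real n) / Gamma (1 + of_nat (Suc i) * (u / of_real n)))) * exp (u * w))"
proof -
  interpret averaging unit_measure "beta_shift n i" "n / (2 * real i)" by (rule averaging_beta) fact+
  define L where "L = (\<integral>y. exp (u / of_real n * of_real (ln (y ^ i * (1 - y)))) \<partial>unit_measure)"
  have down: "down (\<lambda>w. k * exp (u * w)) = (\<lambda>w. k * L * exp (u * w))"
  proof
    fix w
    have "down (\<lambda>w. k * exp (u * w)) w
       = (\<integral>y. (k * exp (u * w)) * exp (u / of_real n * of_real (ln (y ^ i * (1 - y)))) \<partial>unit_measure)"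
      unfolding down_def by (simp add: beta_shift_def distrib_left exp_add mult_ac)
    then show "down (\<lambda>w. k * exp (u * w)) w = k * L * exp (u * w)"
      by (simp add: L_def)
  qed
  have dv: "deriv (\<lambda>w. k * L * exp (u * w)) w = k * L * u * exp (u * w)" for w
    by (rule DERIV_imp_deriv) (auto intro!: derivative_eq_intros)
  have "(1 + of_nat (Suc i) * (u / of_real n)) * L
     = Gamma (1 + of_nat i * (u / of_real n)) * Gamma (1 + u / of_real n) / Gamma (1 + of_nat (Suc i) * (u / of_real n))"
    unfolding L_def using n u by (intro complex_Beta_integral) auto
  note Beta = this
  have "k * L * exp (u * w) + of_nat (Suc i) / of_real n * (k * L * u * exp (u * w))
      = (k * ((1 + of_nat (Suc i) * (u / of_real n)) * L)) * exp (u * w)" for w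
    by (simp add: algebra_simps del: of_nat_Suc)
  then show ?thesis
    unfolding function_step_def Let_def down dv Beta by simp
qed

lemma Gamma_shift_nonzero:
  assumes "0 \<le> Re z"
  shows "Gamma (1 + z) \<noteq> 0"
proof -
  have "1 + z \<notin> \<int>\<^sub>\<le>\<^sub>0"
    using assms by (auto elim!: nonpos_Ints_cases simp: complex_eq_iff)
  then show ?thesis by (simp add: Gamma_eq_zero_iff)
qed

text \<open>The eigenvalues telescope: each step contributes one factor Gamma(1 + u/n) and trades
  one denominator for the next.\<close>

lemma product_function_exp:
  assumes n: "0 < n" and u: "0 \<le> Re u"
  shows "product_function n i (\<lambda>w. k * exp (u * w)) = (\<lambda>w. (k *
    (Gamma (1 + u / of_real n) ^ Suc i / Gamma (1 + of_nat (Suc i) * (u / of_real n)))) * exp (u * w))"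
proof (induction i arbitrary: k)
  case 0
  have "Gamma (1 + u / of_real n) \<noteq> 0" using n u by (intro Gamma_shift_nonzero) auto
  then show ?case by simp
next
  case (Suc i)
  have G: "Gamma (1 + of_nat (Suc i) * (u / of_real n)) \<noteq> 0"
    using n u by (intro Gamma_shift_nonzero) (auto simp del: of_nat_Suc)
  have fs: "function_step n (Suc i) (\<lambda>w. k * exp (u * w)) = (\<lambda>w. (k *
    (Gamma (1 + of_nat (Suc i) * (u / of_real n)) * Gamma (1 + u / of_real n) / Gamma (1 + of_nat (Suc (Suc i)) * (u / of_real n)))) * exp (u * w))"
    by (rule function_step_exp[OF n _ u]) simp
  have alg: "(k * (a * g / b)) * (g ^ Suc i / a) = k * (g ^ Suc (Suc i) / b)" if "a \<noteq> 0" for a b g :: complex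
    using that by simp
  show ?case
    unfolding product_function.simps fs Suc.IH alg[OF G] ..
qed

text \<open>Euler's integral for Gamma at z = 1 + u/\<kappa>, after passing to the logarithm and
  scaling it by \<kappa>.\<close>

lemma stretched_kernel_mellin:
  assumes \<kappa>: "0 < \<kappa>" and u: "0 \<le> Re u"
  shows "(\<integral>x. exp (u * of_real x) * stretched_kernel \<kappa> (Complex x 0) \<partial>lborel) = Gamma (1 + u / of_real \<kappa>)"
proof -
  define z where "z = 1 + u / of_real \<kappa>"
  have z: "0 < Re z" using \<kappa> u by (auto simp: z_def intro: add_pos_nonneg)
  define g where "g = (\<lambda>x. exp (z * of_real x - exp (of_real x)))"
  have [measurable]: "g \<in> borel_measurable borel" unfolding g_def by measurable
  have gr: "g (ln r) / of_real r = of_real r powr (z - 1) / of_real (exp r)" if "r > 0" for r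
  proof -
    have "g (ln r) = exp (z * of_real (ln r)) / of_real (exp r)"
      using that by (simp add: g_def exp_diff exp_of_real)
    moreover have "of_real r powr (z - 1) = exp (z * of_real (ln r)) / of_real r"
      using that by (simp add: powr_def left_diff_distrib exp_diff Ln_of_real exp_of_real)
    ultimately show ?thesis by simp
  qed
  have "set_integrable lebesgue {0<..} (\<lambda>r. g (ln r) / of_real r)"
    using absolutely_integrable_Gamma_integral'[OF z]
    by (rule set_integrable_cong[THEN iffD1, OF refl refl, rotated]) (simp add: gr)
  moreover have "set_integrable lborel {0<..} (\<lambda>r. g (ln r) / of_real r) \<longleftrightarrow> set_integrable lebesgue {0<..} (\<lambda>r. g (ln r) / of_real r)"
    unfolding set_integrable_def by (subst integrable_completion) auto
  ultimately have i: "set_integrable lborel {0<..} (\<lambda>r. g (ln r) / of_real r)" by simp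
  have "(LINT r:{0<..}|lborel. g (ln r) / of_real r) = integral {0<..} (\<lambda>r. g (ln r) / of_real r)"
    by (rule set_borel_integral_eq_integral(2)[OF i])
  also have "\<dots> = integral {0<..} (\<lambda>r. of_real r powr (z - 1) / of_real (exp r))"
    by (rule Henstock_Kurzweil_Integration.integral_cong) (simp add: gr)
  also have "\<dots> = Gamma z" by (rule integral_unique[OF Gamma_integral_complex'[OF z]])
  finally have "(\<integral>x. g x \<partial>lborel) = Gamma z" using integral_ln_substitution(2)[of g] by simp
  moreover have "(\<integral>x. g x \<partial>lborel) = of_real \<kappa> * (\<integral>x. g (\<kappa> * x) \<partial>lborel)"
    using lborel_integral_real_affine[of \<kappa> g 0] \<kappa> by (simp add: scaleR_conv_of_real)
  moreover have "of_real \<kappa> * g (\<kappa> * x) = exp (u * of_real x) * stretched_kernel \<kappa> (Complex x 0)" for x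
  proof -
    have x: "Complex x 0 = of_real x" by (simp add: complex_eq_iff)
    have "z * of_real (\<kappa> * x) = u * of_real x + of_real \<kappa> * of_real x"
      using \<kappa> by (simp add: z_def field_simps)
    then show ?thesis unfolding g_def stretched_kernel_def x
      by (simp add: exp_add[symmetric] algebra_simps exp_diff)
  qed
  ultimately show ?thesis
    unfolding z_def integral_mult_right_zero[symmetric] by simp
qed

lemma product_kernel_integrable:
  assumes "0 < \<kappa>" "0 < n" "0 \<le> Re u"
  shows "integrable lborel (\<lambda>x. exp (u * of_real x) * product_kernel n \<kappa> i (Complex x 0))"
proof -
  have "decaying (max (-1) (Im 0 - pi / (2 * \<kappa>))) (min 1 (Im 0 + pi / (2 * \<kappa>)))
      (\<lambda>w. product_kernel n \<kappa> i (w - 0) * (1 * exp (u * w)))"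
    using assms by (intro decaying_flat_mult_moderate[OF flat_product_kernel moderate_exp]) auto
  from decaying_integrable[OF this, of 0] assms show ?thesis
    by (simp add: mult.commute complex_of_real_def)
qed

text \<open>Rather than transforming the averaged kernel, the steps are moved onto exp(u w), which
  they only multiply by a number.\<close>

lemma product_kernel_mellin:
  assumes \<kappa>: "0 < \<kappa>" and n: "0 < n" and u: "0 \<le> Re u"
  shows "(\<integral>x. exp (u * of_real x) * product_kernel n \<kappa> i (Complex x 0) \<partial>lborel)
    = Gamma (1 + u / of_real \<kappa>) * (Gamma (1 + u / of_real n) ^ Suc i / Gamma (1 + of_nat (Suc i) * (u / of_real n)))"
proof -
  have x: "Complex x 0 = of_real x" for x by (simp add: complex_of_real_def)
  have "(\<integral>x. product_kernel n \<kappa> i (Complex x 0 - 0) * (1 * exp (u * Complex x 0)) \<partial>lborel)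
     = (\<integral>x. stretched_kernel \<kappa> (Complex x 0 - 0) * product_function n i (\<lambda>w. 1 * exp (u * w)) (Complex x 0) \<partial>lborel)"
    by (rule pairing_product[OF moderate_exp[OF u, of "-1" 1] \<kappa> u n]) (use \<kappa> in auto)
  also have "\<dots> = (\<integral>x. (Gamma (1 + u / of_real n) ^ Suc i / Gamma (1 + of_nat (Suc i) * (u / of_real n))) *
      (exp (u * of_real x) * stretched_kernel \<kappa> (Complex x 0)) \<partial>lborel)"
    unfolding product_function_exp[OF n u] by (simp add: x mult_ac)
  also have "\<dots> = Gamma (1 + u / of_real \<kappa>) * (Gamma (1 + u / of_real n) ^ Suc i / Gamma (1 + of_nat (Suc i) * (u / of_real n)))"
    using stretched_kernel_mellin[OF \<kappa> u] by simp
  finally show ?thesis by (simp add: x mult.commute)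
qed

text \<open>For this \<kappa> the factor Gamma(1 + u/\<kappa>) of the starting kernel is exactly the
  remaining denominator.\<close>

lemma product_kernel_mellin':
  assumes n: "0 < n" and \<kappa>: "\<kappa> = n / real (Suc i)" and u: "0 \<le> Re u"
  shows "(\<integral>x. exp (u * of_real x) * product_kernel n \<kappa> i (Complex x 0) \<partial>lborel) = Gamma (1 + u / of_real n) ^ Suc i"
proof -
  have \<kappa>0: "0 < \<kappa>" using n \<kappa> by simp
  have eq: "u / of_real \<kappa> = of_nat (Suc i) * (u / of_real n)" using n unfolding \<kappa> by (simp add: field_simps)
  have "Gamma (1 + of_nat (Suc i) * (u / of_real n)) \<noteq> 0"
    using n u by (intro Gamma_shift_nonzero) (auto simp del: of_nat_Suc)
  then show ?thesis unfolding product_kernel_mellin[OF \<kappa>0 n u] eq by simp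
qed

section \<open>Positivity of the kernel on the real line\<close>

lemma continuous_on_flat_line:
  assumes "flat \<kappa> \<alpha> e" "0 < \<alpha>"
  shows "continuous_on UNIV (\<lambda>x. e (Complex x 0))"
  using assms by (intro continuous_on_line[of _ "- \<alpha>" \<alpha>]) (auto simp: flat_def)

lemma stretched_kernel_real:
  "stretched_kernel \<kappa> (Complex x 0) = of_real (\<kappa> * exp (\<kappa> * x - exp (\<kappa> * x)))"
  unfolding stretched_kernel_def
  by (simp add: exp_of_real[symmetric] complex_of_real_def[symmetric])

text \<open>The factor Gamma(1 + i y/n) is the Fourier transform of the positive function n exp(n x
  - exp(n x)), bounded by n. Convolution multiplies transforms and keeps positivity.\<close>

lemma convolution_powers:
  assumes n: "0 < n"
  shows "\<exists>g. integrable lborel g \<and> continuous_on UNIV g \<and> (\<forall>x. 0 < g x) \<and>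
    (\<forall>y. (\<integral>x. iexp (y * x) * complex_of_real (g x) \<partial>lborel) = Gamma (1 + \<i> * of_real y / of_real n) ^ Suc i)"
proof (induction i)
  let ?h = "\<lambda>x. n * exp (n * x - exp (n * x))"
  have mell: "(\<integral>x. iexp (y * x) * of_real (?h x) \<partial>lborel) = Gamma (1 + \<i> * of_real y / of_real n)" for y
    using stretched_kernel_mellin[OF n, of "\<i> * of_real y"] by (simp add: stretched_kernel_real mult_ac)
  have hi: "integrable lborel ?h"
  proof -
    have "integrable lborel (\<lambda>x. complex_of_real (?h x))"
      using product_kernel_integrable[OF n n, of 0 0] by (simp add: stretched_kernel_real)
    then show ?thesis unfolding complex_of_real_integrable_eq .
  qed
  have hc: "continuous_on UNIV ?h" by (intro continuous_intros)
  have hp: "0 < ?h x" for x using n by simp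
  case 0
  show ?case using hi hc hp mell by (intro exI[of _ ?h]) simp
  case (Suc i)
  then obtain g where g: "integrable lborel g" "continuous_on UNIV g" "\<And>x. 0 < g x"
    "\<And>y. (\<integral>x. iexp (y * x) * complex_of_real (g x) \<partial>lborel) = Gamma (1 + \<i> * of_real y / of_real n) ^ Suc i"
    by blast
  have hB: "?h x \<le> n" for x
  proof -
    have "n * x \<le> exp (n * x)" using exp_ge_add_one_self[of "n * x"] by linarith
    then show ?thesis using n by simp
  qed
  obtain k where k: "integrable lborel k" "continuous_on UNIV k" "\<And>x. 0 < k x"
    "\<And>y. (\<integral>x. iexp (y * x) * of_real (k x) \<partial>lborel)
      = (\<integral>x. iexp (y * x) * of_real (g x) \<partial>lborel) * (\<integral>x. iexp (y * x) * of_real (?h x) \<partial>lborel)"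
    by (rule positive_convolution[OF g(1,3) hi hc hp hB]; rule that; assumption)
  have "(\<integral>x. iexp (y * x) * complex_of_real (k x) \<partial>lborel) = Gamma (1 + \<i> * of_real y / of_real n) ^ Suc (Suc i)" for y
    unfolding k(4) g(4) mell by simp
  with k(1-3) show ?case by (intro exI[of _ k]) simp
qed

text \<open>The construction subtracts a derivative, so positivity is not visible in it. Mellin
  transforms at u = i y are Fourier transforms, and by uniqueness the kernel on the real line equals
  a positive convolution power.\<close>

lemma product_kernel_positive:
  assumes n: "0 < n" and \<kappa>: "\<kappa> = n / real (Suc i)"
  shows "product_kernel n \<kappa> i (Complex x 0) \<in> \<real>" "0 < Re (product_kernel n \<kappa> i (Complex x 0))"
proof -
  have \<kappa>0: "0 < \<kappa>" using n \<kappa> by simp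
  obtain g where g: "integrable lborel g" "continuous_on UNIV g" "\<And>x. 0 < g x"
    "\<And>y. (\<integral>x. iexp (y * x) * complex_of_real (g x) \<partial>lborel) = Gamma (1 + \<i> * of_real y / of_real n) ^ Suc i"
    using convolution_powers[OF n] by blast
  define f where "f = (\<lambda>x. product_kernel n \<kappa> i (Complex x 0) - of_real (g x))"
  have ki: "integrable lborel (\<lambda>x. product_kernel n \<kappa> i (Complex x 0))"
    using product_kernel_integrable[OF \<kappa>0 n, of 0 i] by simp
  have "f x = 0"
  proof (rule fourier_unique)
    show "integrable lborel f" unfolding f_def using ki g(1) by simp
    show "continuous_on UNIV f" unfolding f_def
      using g(2) continuous_on_flat_line[OF flat_product_kernel[OF \<kappa>0 n]] \<kappa>0 by (intro continuous_intros) auto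
    fix y
    have "integrable lborel (\<lambda>x. iexp (y * x) * product_kernel n \<kappa> i (Complex x 0))"
      using product_kernel_integrable[OF \<kappa>0 n, of "\<i> * of_real y" i] by (simp add: mult_ac)
    moreover have "integrable lborel (\<lambda>x. iexp (y * x) * complex_of_real (g x))"
      by (rule Bochner_Integration.integrable_bound[OF g(1)]) (use g(1) in \<open>auto simp: norm_mult\<close>)
    moreover have "(\<integral>x. iexp (y * x) * product_kernel n \<kappa> i (Complex x 0) \<partial>lborel) = Gamma (1 + \<i> * of_real y / of_real n) ^ Suc i"
      using product_kernel_mellin'[OF n \<kappa>, of "\<i> * of_real y"] by (simp add: mult_ac)
    ultimately show "(\<integral>x. iexp (y * x) * f x \<partial>lborel) = 0"
      unfolding f_def right_diff_distrib using g(4)[of y] by simp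
  qed
  then have "product_kernel n \<kappa> i (Complex x 0) = of_real (g x)" by (simp add: f_def)
  then show "product_kernel n \<kappa> i (Complex x 0) \<in> \<real>" "0 < Re (product_kernel n \<kappa> i (Complex x 0))"
    using g(3)[of x] by auto
qed

section \<open>Existence and uniqueness of the kernel function\<close>

lemma unbounded_sector_hstrip: "unbounded_sector d \<alpha> = hstrip (d - \<alpha> / 2) (d + \<alpha> / 2)"
  by (auto simp: unbounded_sector_def hstrip_def)

lemma mellin_ray:
  fixes e :: "complex \<Rightarrow> complex" and u :: complex
  assumes [measurable]: "(\<lambda>x. e (Complex x 0)) \<in> borel_measurable borel"
  shows "set_integrable lborel {0<..} (\<lambda>x. of_real x powr (u - 1) * e (cpoint x 0))
      \<longleftrightarrow> integrable lborel (\<lambda>x. exp (u * of_real x) * e (Complex x 0))"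
    and "(LINT x:{0<..}|lborel. of_real x powr (u - 1) * e (cpoint x 0)) = (\<integral>x. exp (u * of_real x) * e (Complex x 0) \<partial>lborel)"
proof -
  have eq: "of_real r powr (u - 1) * e (cpoint r 0) = exp (u * of_real (ln r)) * e (Complex (ln r) 0) / of_real r"
    if "r \<in> {0<..}" for r
    using that by (simp add: powr_def cpoint_def left_diff_distrib exp_diff Ln_of_real exp_of_real)
  have [measurable]: "(\<lambda>x. exp (u * of_real x) * e (Complex x 0)) \<in> borel_measurable borel" by measurable
  show "set_integrable lborel {0<..} (\<lambda>x. of_real x powr (u - 1) * e (cpoint x 0))
      \<longleftrightarrow> integrable lborel (\<lambda>x. exp (u * of_real x) * e (Complex x 0))"
    using integral_ln_substitution(1)[of "\<lambda>x. exp (u * of_real x) * e (Complex x 0)"]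
    by (subst set_integrable_cong[OF refl refl eq]) auto
  show "(LINT x:{0<..}|lborel. of_real x powr (u - 1) * e (cpoint x 0)) = (\<integral>x. exp (u * of_real x) * e (Complex x 0) \<partial>lborel)"
  proof -
    have "(LINT x:{0<..}|lborel. of_real x powr (u - 1) * e (cpoint x 0))
        = (LINT x:{0<..}|lborel. exp (u * of_real (ln x)) * e (Complex (ln x) 0) / of_real x)"
      by (rule set_lebesgue_integral_cong) (auto simp: eq)
    then show ?thesis
      using integral_ln_substitution(2)[of "\<lambda>x. exp (u * of_real x) * e (Complex x 0)"] by simp
  qed
qed

lemma is_kernel_product_kernel:
  assumes n: "0 < n" and \<kappa>: "\<kappa> = n / real (Suc i)"
  shows "is_kernel \<kappa> (\<lambda>u. Gamma (1 + u / of_real n) ^ Suc i) (product_kernel n \<kappa> i)"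
proof -
  let ?e = "product_kernel n \<kappa> i"
  let ?\<alpha> = "pi / (2 * \<kappa>)"
  have \<kappa>0: "0 < \<kappa>" using n \<kappa> by simp
  have flat: "flat \<kappa> ?\<alpha> ?e" by (rule flat_product_kernel[OF \<kappa>0 n])
  then have hol: "?e holomorphic_on hstrip (- ?\<alpha>) ?\<alpha>" by (simp add: flat_def)
  have \<alpha>: "0 < ?\<alpha>" using \<kappa>0 by simp
  have m0: "(\<lambda>x. ?e (Complex x 0)) \<in> borel_measurable borel"
    using \<alpha> by (intro borel_measurable_line[OF hol]) auto
  show ?thesis
    unfolding is_kernel_def
  proof (intro conjI allI impI)
    show "?e holomorphic_on unbounded_sector 0 (pi / \<kappa>)"
      using hol by (simp add: unbounded_sector_hstrip mult.commute)
    show "?e (cpoint x 0) \<in> \<real>" "0 < Re (?e (cpoint x 0))" if "0 < x" for x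
      unfolding cpoint_def by (rule product_kernel_positive[OF n \<kappa>])+
    show "set_integrable lborel {0<..<R} (\<lambda>x. ?e (cpoint x \<tau>) / of_real x)"
      if "\<bar>\<tau>\<bar> < pi / \<kappa> / 2 \<and> 0 < R" for \<tau> R
    proof -
      have \<tau>: "- ?\<alpha> < \<tau>" "\<tau> < ?\<alpha>" using that by (auto simp: abs_less_iff mult.commute)
      have mo: "moderate (Re 0) (\<tau> - 1) (\<tau> + 1) (\<lambda>w. 1 * exp (0 * w))" by (rule moderate_exp) simp
      have "integrable lborel (\<lambda>x. ?e (Complex x \<tau>))"
        using decaying_integrable[OF decaying_flat_mult_moderate[OF flat mo \<kappa>0, of 0], of \<tau>] \<tau> by simp
      then have "set_integrable lborel {0<..} (\<lambda>x. ?e (Complex (ln x) \<tau>) / of_real x)"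
        using integral_ln_substitution(1)[OF borel_measurable_line[OF hol \<tau>]] by simp
      then show ?thesis unfolding cpoint_def by (rule set_integrable_subset) auto
    qed
    show "\<exists>A>0. \<exists>B>0. \<forall>w\<in>unbounded_sector 0 (pi / \<kappa> - \<epsilon>). cmod (?e w) \<le> A * exp (- ((exp (Re w) / B) powr \<kappa>))"
      if "0 < \<epsilon>" for \<epsilon>
    proof -
      have "?\<alpha> - \<epsilon> / 2 < ?\<alpha>" using that by simp
      then obtain A c \<delta> where A: "A > 0" "c > 0" "\<delta> > 0"
        "\<And>w. \<bar>Im w\<bar> \<le> ?\<alpha> - \<epsilon> / 2 \<Longrightarrow> norm (?e w) \<le> A * exp (\<delta> * Re w - c * exp (\<kappa> * Re w))"
        using flatD[OF flat] by metis
      have "0 \<le> \<delta>" using A by simp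
      from exp_flat_weaken[OF A(2) \<kappa>0 this] obtain B where B: "B > 0"
        "\<And>x. exp (\<delta> * x - c * exp (\<kappa> * x)) \<le> B * exp (0 * x - (c / 2) * exp (\<kappa> * x))" by metis
      \<comment> \<open>The left rate was lowered to 0 before; \<open>D\<close> solves (exp x /
        D)^\<kappa> = (c/2) exp(\<kappa> x), the form in which \<open>is_kernel\<close> states
        flatness.\<close>
      define D where "D = (2 / c) powr (1 / \<kappa>)"
      have D: "D > 0" "D powr \<kappa> = 2 / c" using A \<kappa>0 by (auto simp: D_def powr_powr)
      have "cmod (?e w) \<le> (A * B) * exp (- ((exp (Re w) / D) powr \<kappa>))" if w: "w \<in> unbounded_sector 0 (pi / \<kappa> - \<epsilon>)" for w
      proof -
        have "\<bar>Im w\<bar> \<le> ?\<alpha> - \<epsilon> / 2" using w \<kappa>0 by (auto simp: unbounded_sector_def abs_le_iff field_simps)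
        then have "cmod (?e w) \<le> A * exp (\<delta> * Re w - c * exp (\<kappa> * Re w))" by (rule A(4))
        also have "\<dots> \<le> A * (B * exp (0 * Re w - (c / 2) * exp (\<kappa> * Re w)))"
          using A(1) B(2) by (intro mult_left_mono) auto
        also have "(c / 2) * exp (\<kappa> * Re w) = (exp (Re w) / D) powr \<kappa>"
        proof -
          have "(exp (Re w) / D) powr \<kappa> = exp (Re w) powr \<kappa> / D powr \<kappa>"
            using D by (simp add: powr_divide)
          moreover have "exp (Re w) powr \<kappa> = exp (\<kappa> * Re w)" by (simp add: powr_def)
          ultimately show ?thesis using D A by simp
        qed
        finally show ?thesis by simp
      qed
      moreover have "A * B > 0" using A B by simp
      ultimately show ?thesis using D(1) by blast
    qed
    fix u :: complex assume u: "0 \<le> Re u"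
    show "set_integrable lborel {0<..} (\<lambda>x. of_real x powr (u - 1) * ?e (cpoint x 0))"
      unfolding mellin_ray[OF m0] by (rule product_kernel_integrable[OF \<kappa>0 n u])
    show "Gamma (1 + u / of_real n) ^ Suc i = (LINT x:{0<..}|lborel. of_real x powr (u - 1) * ?e (cpoint x 0))"
      unfolding mellin_ray[OF m0] by (rule product_kernel_mellin'[OF n \<kappa> u, symmetric])
  qed
qed

text \<open>At u = i y the moment identity prescribes the Fourier transform of the kernel on the
  real line, so two kernels agree there, and then on the whole strip by the identity
  theorem.\<close>

lemma is_kernel_unique:
  assumes \<kappa>: "0 < \<kappa>" and e: "is_kernel \<kappa> m e" and e': "is_kernel \<kappa> m e'" and w: "\<bar>Im w\<bar> < pi / \<kappa> / 2"
  shows "e w = e' w"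
proof -
  let ?\<alpha> = "pi / \<kappa> / 2"
  have \<alpha>: "0 < ?\<alpha>" using \<kappa> by simp
  have *: "f holomorphic_on hstrip (- ?\<alpha>) ?\<alpha> \<and> (\<forall>u. 0 \<le> Re u \<longrightarrow> integrable lborel (\<lambda>x. exp (u * of_real x) * f (Complex x 0)) \<and>
      (\<integral>x. exp (u * of_real x) * f (Complex x 0) \<partial>lborel) = m u)" if "is_kernel \<kappa> m f" for f
  proof (intro conjI allI impI)
    show hol: "f holomorphic_on hstrip (- ?\<alpha>) ?\<alpha>"
      using that by (simp add: is_kernel_def unbounded_sector_hstrip)
    have m0: "(\<lambda>x. f (Complex x 0)) \<in> borel_measurable borel"
      using \<alpha> by (intro borel_measurable_line[OF hol]) auto
    fix u :: complex assume "0 \<le> Re u"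
    then have "set_integrable lborel {0<..} (\<lambda>x. of_real x powr (u - 1) * f (cpoint x 0))"
      "m u = (LINT x:{0<..}|lborel. of_real x powr (u - 1) * f (cpoint x 0))"
      using that unfolding is_kernel_def by blast+
    then show "integrable lborel (\<lambda>x. exp (u * of_real x) * f (Complex x 0))"
      "(\<integral>x. exp (u * of_real x) * f (Complex x 0) \<partial>lborel) = m u"
      unfolding mellin_ray[OF m0] by auto
  qed
  note E = *[OF e, THEN conjunct1] *[OF e, THEN conjunct2, rule_format]
  note E' = *[OF e', THEN conjunct1] *[OF e', THEN conjunct2, rule_format]
  have real: "e (Complex x 0) = e' (Complex x 0)" for x
  proof -
    have "e (Complex x 0) - e' (Complex x 0) = 0"
    proof (rule fourier_unique[where f = "\<lambda>x. e (Complex x 0) - e' (Complex x 0)"])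
      show "integrable lborel (\<lambda>x. e (Complex x 0) - e' (Complex x 0))"
        using E(2)[of 0] E'(2)[of 0] by simp
      show "continuous_on UNIV (\<lambda>x. e (Complex x 0) - e' (Complex x 0))"
        using \<alpha> by (intro continuous_intros continuous_on_line[OF E(1)] continuous_on_line[OF E'(1)]) auto
      fix y
      show "(\<integral>x. iexp (y * x) * (e (Complex x 0) - e' (Complex x 0)) \<partial>lborel) = 0"
        using E(2)[of "\<i> * of_real y"] E'(2)[of "\<i> * of_real y"] by (simp add: right_diff_distrib mult.assoc)
    qed
    then show ?thesis by simp
  qed
  have "e w - e' w = 0"
  proof (rule analytic_continuation[of "\<lambda>w. e w - e' w" "hstrip (- ?\<alpha>) ?\<alpha>" "range complex_of_real" 0])
    show "(\<lambda>w. e w - e' w) holomorphic_on hstrip (- ?\<alpha>) ?\<alpha>" using E(1) E'(1) by (intro holomorphic_intros)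
    show "0 islimpt range complex_of_real"
      unfolding islimpt_approachable
    proof (intro allI impI)
      fix r :: real assume "0 < r"
      then show "\<exists>x'\<in>range complex_of_real. x' \<noteq> 0 \<and> dist x' 0 < r"
        by (intro bexI[of _ "of_real (r / 2)"] rangeI) auto
    qed
    show "\<And>z. z \<in> range complex_of_real \<Longrightarrow> e z - e' z = 0" using real by (auto simp: complex_of_real_def)
  qed (use \<alpha> w in \<open>auto simp: hstrip_def convex_connected open_hstrip[unfolded hstrip_def] convex_hstrip[unfolded hstrip_def] abs_less_iff\<close>)
  then show ?thesis by simp
qed

lemma kernel_fun_eq_product_kernel:
  assumes n: "0 < n" and \<kappa>: "\<kappa> = n / real (Suc i)" and w: "\<bar>Im w\<bar> < pi / \<kappa> / 2"
  shows "kernel_fun \<kappa> (\<lambda>u. Gamma (1 + u / of_real n) ^ Suc i) w = product_kernel n \<kappa> i w"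
proof -
  note k = is_kernel_product_kernel[OF n \<kappa>]
  have "is_kernel \<kappa> (\<lambda>u. Gamma (1 + u / of_real n) ^ Suc i) (kernel_fun \<kappa> (\<lambda>u. Gamma (1 + u / of_real n) ^ Suc i))"
    unfolding kernel_fun_def by (rule someI[of "is_kernel \<kappa> _"]) (rule k)
  from is_kernel_unique[OF _ this k w] n \<kappa> show ?thesis by simp
qed

section \<open>Power series in the exponential coordinate\<close>

text \<open>A power series in X = s^n with X = exp(n w), convergent for |X| < L. The encoding makes
  the steps act coefficientwise, since exp(j n w) is an eigenfunction of each.\<close>

definition exp_series :: "real \<Rightarrow> real \<Rightarrow> (nat \<Rightarrow> complex) \<Rightarrow> (complex \<Rightarrow> complex) \<Rightarrow> bool" where
  "exp_series n L b f \<longleftrightarrow> (\<forall>w. norm (exp (of_real n * w)) < L \<longrightarrow> (\<lambda>j. b j * exp (of_real n * w) ^ j) sums f w)"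

lemma exp_series_summable:
  assumes f: "exp_series n L b f" and n: "0 < n" and X: "norm X < L"
  shows "summable (\<lambda>j. b j * X ^ j)"
proof (cases "X = 0")
  case True
  then show ?thesis by simp
next
  case False
  then have "exp (of_real n * (Ln X / of_real n)) = X" using n by simp
  then show ?thesis using f X unfolding exp_series_def by (metis sums_summable)
qed

lemma exp_series_summable_norm:
  assumes f: "exp_series n L b f" and n: "0 < n" and X: "norm X < L"
  shows "summable (\<lambda>j. norm (b j * X ^ j))"
proof -
  obtain r where r: "norm X < r" "r < L" using X dense by blast
  then have "norm (complex_of_real r) < L" "norm X < norm (complex_of_real r)"
    by (auto simp: abs_of_pos) (use norm_ge_zero[of X] in linarith)+
  then show ?thesis by (intro powser_insidea[OF exp_series_summable[OF f n]])
qed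

text \<open>A left shift multiplies X by a factor of modulus at most 1, so the shifted series
  converges absolutely and uniformly in y; sum and integral may be exchanged.\<close>

lemma exp_series_down:
  assumes f: "exp_series n L b f" and n: "0 < n" and i: "i \<ge> 1"
  shows "exp_series n L (\<lambda>j. b j * (\<integral>y. exp (of_nat j * of_real (ln (y ^ i * (1 - y)))) \<partial>unit_measure))
     (averaging.down unit_measure (beta_shift n i) f)"
  unfolding exp_series_def
proof (intro allI impI)
  interpret averaging unit_measure "beta_shift n i" "n / (2 * real i)" by (rule averaging_beta) fact+
  fix w :: complex assume w: "norm (exp (of_real n * w)) < L"
  define X where "X = exp (of_real n * w)"
  define h where "h = (\<lambda>y::real. complex_of_real (ln (y ^ i * (1 - y))))"
  have nh: "norm (exp (of_nat j * h y)) \<le> 1" if "y \<in> space unit_measure" for j y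
  proof -
    have "ln (y ^ i * (1 - y)) \<le> 0" using beta_weight_bounds[of y i] that by simp
    then show ?thesis by (simp add: h_def mult_nonneg_nonpos)
  qed
  have [measurable]: "h \<in> borel_measurable unit_measure"
    unfolding h_def unit_measure_def by (intro measurable_restrict_space1) measurable
  let ?t = "\<lambda>j y. b j * X ^ j * exp (of_nat j * h y)"
  have nt: "norm (?t j y) \<le> norm (b j * X ^ j)" if "y \<in> space unit_measure" for j y
    using nh[OF that] by (simp add: norm_mult mult_left_le)
  have ti: "integrable unit_measure (?t j)" for j
    by (rule integrable_const_bound[of _ "norm (b j * X ^ j)"]) (use nt in \<open>auto intro!: AE_I2\<close>)
  have S: "summable (\<lambda>j. norm (b j * X ^ j))"
    using exp_series_summable_norm[OF f n] w by (simp add: X_def)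
  have eq: "f (w + of_real (beta_shift n i y)) = (\<Sum>j. ?t j y)" if y: "y \<in> space unit_measure" for y
  proof -
    have e: "exp (of_real n * (w + of_real (beta_shift n i y))) = X * exp (h y)"
      using n by (simp add: X_def h_def beta_shift_def distrib_left exp_add)
    have "norm (X * exp (h y)) \<le> norm X" using nh[OF y, of 1] by (simp add: norm_mult mult_left_le)
    then have "norm (X * exp (h y)) < L" using w by (simp add: X_def)
    then have "(\<lambda>j. b j * (X * exp (h y)) ^ j) sums f (w + of_real (beta_shift n i y))"
      using f unfolding exp_series_def by (metis e)
    then show ?thesis by (simp add: power_mult_distrib exp_of_nat_mult mult.assoc sums_iff)
  qed
  have "(\<lambda>j. integral\<^sup>L unit_measure (?t j)) sums (\<integral>y. (\<Sum>j. ?t j y) \<partial>unit_measure)"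
  proof (rule sums_integral[OF ti])
    show "AE y in unit_measure. summable (\<lambda>j. norm (?t j y))"
      using nt by (intro AE_I2 summable_comparison_test'[OF S, of 0]) auto
    have "norm (\<integral>y. norm (?t j y) \<partial>unit_measure) \<le> norm (b j * X ^ j)" for j
    proof -
      have "(\<integral>y. norm (?t j y) \<partial>unit_measure) \<le> (\<integral>y. norm (b j * X ^ j) \<partial>unit_measure)"
        using ti nt by (intro integral_mono) auto
      moreover have "0 \<le> (\<integral>y. norm (?t j y) \<partial>unit_measure)" by (rule Bochner_Integration.integral_nonneg) simp
      ultimately show ?thesis using prob_space by simp
    qed
    then show "summable (\<lambda>j. \<integral>y. norm (?t j y) \<partial>unit_measure)"
      by (intro summable_comparison_test'[OF S, of 0]) auto
  qed
  also have "(\<integral>y. (\<Sum>j. ?t j y) \<partial>unit_measure) = down f w"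
    unfolding down_def by (rule Bochner_Integration.integral_cong[OF refl]) (simp add: eq)
  finally show "(\<lambda>j. b j * (\<integral>y. exp (of_nat j * of_real (ln (y ^ i * (1 - y)))) \<partial>unit_measure) * exp (of_real n * w) ^ j) sums down f w"
    by (simp add: h_def X_def mult_ac)
qed

lemma exp_series_has_field_derivative:
  assumes f: "exp_series n L b f" and n: "0 < n" and w: "norm (exp (of_real n * w)) < L"
  shows "(f has_field_derivative (of_real n * exp (of_real n * w) * (\<Sum>j. diffs b j * exp (of_real n * w) ^ j))) (at w)"
proof -
  let ?X = "exp (of_real n * w)"
  have sm: "\<And>X. norm X < L \<Longrightarrow> summable (\<lambda>j. b j * X ^ j)" by (rule exp_series_summable[OF f n])
  have "((\<lambda>X. \<Sum>j. b j * X ^ j) has_field_derivative (\<Sum>j. diffs b j * ?X ^ j)) (at ?X)"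
    by (rule termdiffs_strong'[OF sm w])
  moreover have "((\<lambda>w. exp (of_real n * w)) has_field_derivative (of_real n * ?X)) (at w)"
    by (auto intro!: derivative_eq_intros)
  ultimately have "((\<lambda>w. \<Sum>j. b j * exp (of_real n * w) ^ j) has_field_derivative ((\<Sum>j. diffs b j * ?X ^ j) * (of_real n * ?X))) (at w)"
    by (rule DERIV_chain2)
  moreover have "open {w. norm (exp (complex_of_real n * w)) < L}"
    by (intro open_Collect_less continuous_intros)
  ultimately have "(f has_field_derivative ((\<Sum>j. diffs b j * ?X ^ j) * (of_real n * ?X))) (at w)"
    by (rule has_field_derivative_transform_within_open) (use w f in \<open>auto simp: exp_series_def sums_iff\<close>)
  then show ?thesis by (simp only: mult_ac)
qed

lemma exp_series_deriv:
  assumes f: "exp_series n L b f" and n: "0 < n"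
  shows "exp_series n L (\<lambda>j. of_real n * of_nat j * b j) (deriv f)"
  unfolding exp_series_def
proof (intro allI impI)
  fix w :: complex assume w: "norm (exp (of_real n * w)) < L"
  define X where "X = exp (of_real n * w)"
  have X: "norm X < L" using w by (simp add: X_def)
  have ds: "summable (\<lambda>j. diffs b j * X ^ j)"
    using exp_series_summable[OF f n] by (intro termdiff_converges[OF X]) auto
  have "deriv f w = of_real n * X * (\<Sum>j. diffs b j * X ^ j)"
    using exp_series_has_field_derivative[OF f n w] by (simp add: DERIV_imp_deriv X_def)
  moreover have "(\<lambda>j. of_real n * X * (of_nat j * b j * X ^ (j - Suc 0))) sums (of_real n * X * (\<Sum>j. diffs b j * X ^ j))"
    by (intro sums_mult diffs_equiv ds)
  moreover have "of_real n * X * (of_nat j * b j * X ^ (j - Suc 0)) = of_real n * of_nat j * b j * X ^ j" for j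
    by (cases j) (simp_all add: mult_ac)
  ultimately show "(\<lambda>j. of_real n * of_nat j * b j * exp (of_real n * w) ^ j) sums deriv f w"
    unfolding X_def[symmetric] by (simp only:)
qed

lemma exp_series_function_step:
  assumes f: "exp_series n L b f" and n: "0 < n" and i: "i \<ge> 1"
  shows "exp_series n L (\<lambda>j. b j * (Gamma (1 + of_nat i * of_nat j) * Gamma (1 + of_nat j) / Gamma (1 + of_nat (Suc i) * of_nat j)))
    (function_step n i f)"
proof -
  let ?g = "averaging.down unit_measure (beta_shift n i) f"
  let ?b = "\<lambda>j. b j * (\<integral>y. exp (of_nat j * of_real (ln (y ^ i * (1 - y)))) \<partial>unit_measure)"
  have g: "exp_series n L ?b ?g" by (rule exp_series_down[OF f n i])
  note g' = exp_series_deriv[OF g n]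
  have "(\<lambda>j. ?b j * exp (of_real n * w) ^ j + of_nat (Suc i) / of_real n * (of_real n * of_nat j * ?b j * exp (of_real n * w) ^ j))
      sums (?g w + of_nat (Suc i) / of_real n * deriv ?g w)" if w: "norm (exp (of_real n * w)) < L" for w :: complex
    using g g' w unfolding exp_series_def by (intro sums_add sums_mult) auto
  moreover have "?b j * x ^ j + of_nat (Suc i) / of_real n * (of_real n * of_nat j * ?b j * x ^ j)
     = b j * (Gamma (1 + of_nat i * of_nat j) * Gamma (1 + of_nat j) / Gamma (1 + of_nat (Suc i) * of_nat j)) * x ^ j" for j x
  proof -
    have "?b j * x ^ j + of_nat (Suc i) / of_real n * (of_real n * of_nat j * ?b j * x ^ j)
      = b j * ((1 + of_nat (Suc i) * of_nat j) * (\<integral>y. exp (of_nat j * of_real (ln (y ^ i * (1 - y)))) \<partial>unit_measure)) * x ^ j"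
      using n by (simp add: algebra_simps del: of_nat_Suc)
    also have "(1 + of_nat (Suc i) * complex_of_nat j) * (\<integral>y. exp (of_nat j * of_real (ln (y ^ i * (1 - y)))) \<partial>unit_measure)
      = Gamma (1 + of_nat i * of_nat j) * Gamma (1 + of_nat j) / Gamma (1 + of_nat (Suc i) * of_nat j)"
      by (rule complex_Beta_integral[OF i]) simp
    finally show ?thesis .
  qed
  ultimately show ?thesis unfolding exp_series_def function_step_def Let_def by simp
qed

text \<open>At u = n j the telescoping Gamma quotients become factorials. Starting from the
  geometric series, the result is therefore the Borel transform of order 1/\<kappa>.\<close>

lemma exp_series_product_function:
  assumes f: "exp_series n L b f" and n: "0 < n"
  shows "exp_series n L (\<lambda>j. b j * (fact j ^ Suc i / fact (Suc i * j))) (product_function n i f)"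
  using f
proof (induction i arbitrary: b f)
  case (Suc i)
  have G: "Gamma (1 + of_nat k * of_nat j :: complex) = fact (k * j)" for k j
    using Gamma_fact[of "k * j", where 'a = complex] by (simp add: add.commute)
  have "exp_series n L (\<lambda>j. b j * (fact (Suc i * j) * fact j / fact (Suc (Suc i) * j)))
     (function_step n (Suc i) f)"
    using exp_series_function_step[OF Suc.prems n, of "Suc i"] unfolding G Gamma_fact by (simp only: fact_1)
  from Suc.IH[OF this] show ?case
    by (simp add: mult_ac)
qed (auto simp: exp_series_def)

section \<open>Continuations of lacunary series\<close>

text \<open>The shape of all series below: only powers of s^n occur, and the dependence on z is
  through the common factor \<open>\<phi> z\<close>.\<close>

definition lacunary :: "nat \<Rightarrow> (complex \<Rightarrow> complex) \<Rightarrow> (nat \<Rightarrow> complex) \<Rightarrow> nat \<Rightarrow> complex \<Rightarrow> complex" where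
  "lacunary n \<phi> b N z = (if n dvd N then \<phi> z * b (N div n) else 0)"

lemma lacunary_sums:
  assumes n: "n \<ge> 1" and b: "(\<lambda>j. b j * (s ^ n) ^ j) sums S"
  shows "(\<lambda>N. lacunary n \<phi> b N z * s ^ N) sums (\<phi> z * S)"
proof -
  have "(\<lambda>j. lacunary n \<phi> b (n * j) z * s ^ (n * j)) sums (\<phi> z * S)"
    using sums_mult[OF b, of "\<phi> z"] n by (simp add: lacunary_def mult.assoc mult.commute[of S] flip: power_mult)
  moreover have "strict_mono (\<lambda>j. n * j)" using n by (auto intro!: strict_monoI)
  moreover have "lacunary n \<phi> b N z * s ^ N = 0" if "N \<notin> range (\<lambda>j. n * j)" for N
    using that by (auto simp: lacunary_def)
  ultimately show ?thesis using sums_mono_reindex[of "\<lambda>j. n * j" "\<lambda>N. lacunary n \<phi> b N z * s ^ N"] by simp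
qed

text \<open>Below modulus 1 the n-th power is at most the number itself, so the same radius bounds s
  and s^n.\<close>

lemma small_exp_power:
  assumes n: "n \<ge> 1" and w: "exp (Re w) < min 1 L"
  shows "norm (exp (of_real (real n) * w)) < L"
proof -
  have "norm (exp (of_real (real n) * w)) = exp (Re w) ^ n"
    by (simp add: exp_of_nat_mult[symmetric])
  also have "\<dots> \<le> exp (Re w) ^ 1" using n w by (intro power_decreasing) auto
  also have "\<dots> < L" using w by simp
  finally show ?thesis .
qed

lemma continuations_holomorphic:
  assumes v: "v \<in> continuations \<rho> \<kappa> d \<alpha> c" and z: "z \<in> cball 0 \<rho>"
  shows "(\<lambda>w. v w z) holomorphic_on unbounded_sector d \<alpha>"
proof -
  have "\<exists>D. ((\<lambda>w. v w z) has_field_derivative D) (at w)" if w: "w \<in> unbounded_sector d \<alpha>" for w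
  proof -
    obtain g where "uniform_limit (cball 0 \<rho>) (\<lambda>h z. (v (w + h) z - v w z) / h) g (at 0)"
      using v w by (auto simp: continuations_def O_growth_def E_holomorphic_on_def)
    then have "((\<lambda>h. (v (w + h) z - v w z) / h) \<longlongrightarrow> g z) (at 0)"
      using z by (rule tendsto_uniform_limitI)
    then show ?thesis unfolding DERIV_def by blast
  qed
  then show ?thesis
    unfolding unbounded_sector_hstrip by (subst holomorphic_on_open[OF open_hstrip]) auto
qed

text \<open>Near the origin every admissible continuation is forced to be the sum of the series.
  This is the seed for each use of the identity theorem.\<close>

lemma continuations_lacunary_near_0:
  assumes v: "v \<in> continuations \<rho> \<kappa> d \<alpha> (lacunary n \<phi> b)" and z: "z \<in> cball 0 \<rho>"
    and n: "n \<ge> 1" and g: "exp_series (real n) L b g" "0 < L"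
  obtains r where "0 < r" "\<And>w. w \<in> sector d \<alpha> r \<Longrightarrow> v w z = \<phi> z * g w"
proof -
  obtain r f where r: "r > 0"
    "\<And>s. s \<in> ball 0 r \<Longrightarrow> uniform_limit (cball 0 \<rho>) (\<lambda>N z. \<Sum>k<N. lacunary n \<phi> b k z * s ^ k) (f s) sequentially"
    "\<And>w z. w \<in> sector d \<alpha> r \<Longrightarrow> z \<in> cball 0 \<rho> \<Longrightarrow> v w z = f (exp w) z"
    using v unfolding continuations_def by blast
  show ?thesis
  proof (rule that[of "min r (min 1 L)"])
    fix w assume w: "w \<in> sector d \<alpha> (min r (min 1 L))"
    then have "exp w \<in> ball 0 r" "w \<in> sector d \<alpha> r" by (auto simp: sector_def)
    then have "(\<lambda>N. \<Sum>k<N. lacunary n \<phi> b k z * exp w ^ k) \<longlonglongrightarrow> v w z"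
      using tendsto_uniform_limitI[OF r(2) z] r(3)[OF _ z] by simp
    moreover have "(\<lambda>k. lacunary n \<phi> b k z * exp w ^ k) sums (\<phi> z * g w)"
    proof (rule lacunary_sums[OF n])
      have "exp (Re w) < min 1 L" using w by (simp add: sector_def)
      from small_exp_power[OF n this] show "(\<lambda>j. b j * (exp w ^ n) ^ j) sums g w"
        using g(1) by (simp add: exp_series_def exp_of_nat_mult)
    qed
    ultimately show "v w z = \<phi> z * g w"
      unfolding sums_def using LIMSEQ_unique by blast
  qed (use r g in auto)
qed

lemma sector_nonempty:
  assumes "0 < \<alpha>" "0 < r"
  shows "sector d \<alpha> r \<noteq> {}"
proof -
  have "Complex (ln (r / 2)) d \<in> sector d \<alpha> r"
    using assms by (simp add: sector_def unbounded_sector_def)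
  then show ?thesis by blast
qed

lemma open_sector: "open (sector d \<alpha> r)"
proof -
  have "sector d \<alpha> r = unbounded_sector d \<alpha> \<inter> {t. exp (Re t) < r}" by (auto simp: sector_def)
  then show ?thesis
    by (simp add: unbounded_sector_hstrip open_Int open_Collect_less continuous_intros)
qed

text \<open>The opening of the chosen continuation is unknown, so the comparison takes place on a
  sector common to both functions. Agreement over the ray is all that a Laplace integral
  sees.\<close>

lemma continuation_lacunary_unique:
  assumes v: "v \<in> continuations \<rho> \<kappa> d \<alpha> (lacunary n \<phi> b)" and z: "z \<in> cball 0 \<rho>" and \<alpha>: "0 < \<alpha>"
    and n: "n \<ge> 1" and g: "exp_series (real n) L b g" "0 < L" "g holomorphic_on hstrip lo hi"
    and d: "lo < d" "d < hi" and w: "Im w = d"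
  shows "v w z = \<phi> z * g w"
proof -
  obtain r where r: "0 < r" "\<And>w. w \<in> sector d \<alpha> r \<Longrightarrow> v w z = \<phi> z * g w"
    using continuations_lacunary_near_0[OF v z n g(1,2)] by metis
  \<comment> \<open>The largest symmetric opening about \<open>d\<close> allowed by both the
    continuation and the strip of \<open>g\<close>.\<close>
  define \<beta> where "\<beta> = min \<alpha> (2 * min (d - lo) (hi - d))"
  have \<beta>: "0 < \<beta>" "\<beta> \<le> \<alpha>" "lo \<le> d - \<beta> / 2" "d + \<beta> / 2 \<le> hi" using d \<alpha> by (auto simp: \<beta>_def min_def)
  show ?thesis
  proof (rule analytic_continuation_open[of "sector d \<beta> r" "unbounded_sector d \<beta>" "\<lambda>w. v w z" "\<lambda>w. \<phi> z * g w"])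
    show "sector d \<beta> r \<noteq> {}" by (rule sector_nonempty[OF \<beta>(1) r(1)])
    show "open (unbounded_sector d \<beta>)" "connected (unbounded_sector d \<beta>)"
      by (auto simp: unbounded_sector_hstrip intro: convex_connected)
    show "sector d \<beta> r \<subseteq> unbounded_sector d \<beta>" by (auto simp: sector_def)
    show "(\<lambda>w. v w z) holomorphic_on unbounded_sector d \<beta>"
      by (rule holomorphic_on_subset[OF continuations_holomorphic[OF v z]]) (use \<beta> in \<open>auto simp: unbounded_sector_def\<close>)
    show "(\<lambda>w. \<phi> z * g w) holomorphic_on unbounded_sector d \<beta>"
      by (intro holomorphic_intros holomorphic_on_subset[OF g(3)])
         (use \<beta> in \<open>auto simp: unbounded_sector_def hstrip_def\<close>)
    show "v w z = \<phi> z * g w" if "w \<in> sector d \<beta> r" for w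
      using r(2)[of w] that \<beta> by (auto simp: sector_def unbounded_sector_def)
    show "w \<in> unbounded_sector d \<beta>" using w \<beta> by (auto simp: unbounded_sector_def)
  qed (rule open_sector)
qed

text \<open>A function that is moderate with exponent 0 is bounded on proper subsectors, so growth
  of order \<kappa> holds trivially. Boundedness of \<phi> on the closed disc upgrades scalar limits
  to limits uniform in z.\<close>

lemma lacunary_continuation_exists:
  assumes \<phi>: "\<phi> \<in> disc_space \<rho>"
    and n: "n \<ge> 1" and g: "exp_series (real n) L b g" "0 < L" "moderate 0 lo hi g"
    and d: "lo < d" "d < hi"
  obtains \<alpha> where "0 < \<alpha>" "(\<lambda>w z. \<phi> z * g w) \<in> continuations \<rho> \<kappa> d \<alpha> (lacunary n \<phi> b)"
proof -
  define \<alpha> where "\<alpha> = 2 * min (d - lo) (hi - d)"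
  have \<alpha>: "0 < \<alpha>" "lo \<le> d - \<alpha> / 2" "d + \<alpha> / 2 \<le> hi" using d by (auto simp: \<alpha>_def min_def)
  have "compact (\<phi> ` cball 0 \<rho>)"
    using \<phi> by (intro compact_continuous_image) (auto simp: disc_space_def)
  then obtain B where B: "B > 0" "\<And>z. z \<in> cball 0 \<rho> \<Longrightarrow> norm (\<phi> z) \<le> B"
    using compact_imp_bounded bounded_pos by (metis imageI)
  have scale: "uniform_limit (cball 0 \<rho>) (\<lambda>h z. \<phi> z * G h) (\<lambda>z. \<phi> z * D) F"
    if G: "(G \<longlongrightarrow> D) F" for G :: "'a \<Rightarrow> complex" and D F
    unfolding uniform_limit_iff
  proof (intro allI impI)
    fix e :: real assume e: "0 < e"
    then have "eventually (\<lambda>x. dist (G x) D < e / B) F" using G B by (simp add: tendsto_iff)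
    then show "\<forall>\<^sub>F h in F. \<forall>z\<in>cball 0 \<rho>. dist (\<phi> z * G h) (\<phi> z * D) < e"
    proof eventually_elim
      case (elim h)
      show ?case
      proof
        fix z :: complex assume z: "z \<in> cball 0 \<rho>"
        have "dist (\<phi> z * G h) (\<phi> z * D) = norm (\<phi> z) * dist (G h) D"
          by (simp add: dist_norm norm_mult flip: right_diff_distrib)
        also have "\<dots> \<le> B * dist (G h) D" using B(2)[OF z] by (intro mult_right_mono) auto
        also have "\<dots> < e" using elim B(1) by (simp add: field_simps)
        finally show "dist (\<phi> z * G h) (\<phi> z * D) < e" .
      qed
    qed
  qed
  have disc: "(\<lambda>z. \<phi> z * k) \<in> disc_space \<rho>" for k
    using \<phi> by (auto simp: disc_space_def intro!: continuous_intros holomorphic_intros)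
  have ghol: "g holomorphic_on hstrip lo hi" using g(3) by (simp add: moderate_def)
  have "(\<lambda>w z. \<phi> z * g w) \<in> continuations \<rho> \<kappa> d \<alpha> (lacunary n \<phi> b)"
    unfolding continuations_def O_growth_def
  proof (safe)
    show "E_holomorphic_on \<rho> (\<lambda>w z. \<phi> z * g w) (unbounded_sector d \<alpha>)"
      unfolding E_holomorphic_on_def
    proof (intro ballI conjI disc)
      fix w assume "w \<in> unbounded_sector d \<alpha>"
      then have "w \<in> hstrip lo hi" using \<alpha> by (auto simp: unbounded_sector_def hstrip_def)
      then have "(g has_field_derivative deriv g w) (at w)"
        using holomorphic_derivI[OF ghol open_hstrip] by blast
      then have "((\<lambda>h. (g (w + h) - g w) / h) \<longlongrightarrow> deriv g w) (at 0)" by (simp add: DERIV_def)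
      from scale[OF this]
      have "uniform_limit (cball 0 \<rho>) (\<lambda>h z. (\<phi> z * g (w + h) - \<phi> z * g w) / h) (\<lambda>z. \<phi> z * deriv g w) (at 0)"
        by (simp add: right_diff_distrib)
      then show "\<exists>k\<in>disc_space \<rho>. uniform_limit (cball 0 \<rho>) (\<lambda>h z. (\<phi> z * g (w + h) - \<phi> z * g w) / h) k (at 0)"
        using disc by blast
    qed
  next
    fix d' \<alpha>' :: real assume \<alpha>': "0 < \<alpha>'" "{d' - \<alpha>' / 2..d' + \<alpha>' / 2} \<subseteq> {d - \<alpha> / 2<..<d + \<alpha> / 2}"
    then have "d' - \<alpha>' / 2 \<in> {d - \<alpha> / 2<..<d + \<alpha> / 2}" "d' + \<alpha>' / 2 \<in> {d - \<alpha> / 2<..<d + \<alpha> / 2}"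
      by (auto simp del: greaterThanLessThan_iff intro!: subsetD[OF \<alpha>'(2)])
    then have "d - \<alpha> / 2 < d' - \<alpha>' / 2" "d' + \<alpha>' / 2 < d + \<alpha> / 2" by simp_all
    then have "lo < d' - \<alpha>' / 2" "d' + \<alpha>' / 2 < hi" using \<alpha> by auto
    from moderateD[OF g(3) this] obtain A where A: "A > 0"
      "\<And>w. d' - \<alpha>' / 2 \<le> Im w \<Longrightarrow> Im w \<le> d' + \<alpha>' / 2 \<Longrightarrow> norm (g w) \<le> A * exp (0 * Re w)" by metis
    have "cmod (\<phi> z * g w) \<le> (B * A) * exp (1 * exp (Re w) powr \<kappa>)"
      if "w \<in> unbounded_sector d' \<alpha>'" "z \<in> cball 0 \<rho>" for w z :: complex
    proof -
      have "cmod (\<phi> z * g w) \<le> B * A"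
        using A(2)[of w] B(2)[OF that(2)] that(1) A(1) B(1)
        by (auto simp: norm_mult unbounded_sector_def intro!: mult_mono)
      also have "\<dots> \<le> (B * A) * exp (1 * exp (Re w) powr \<kappa>)" using A B by simp
      finally show ?thesis .
    qed
    moreover have "B * A > 0" using A B by simp
    ultimately show "\<exists>C1>0. \<exists>C2>0. \<forall>w\<in>unbounded_sector d' \<alpha>'. \<forall>z\<in>cball 0 \<rho>.
        cmod (\<phi> z * g w) \<le> C1 * exp (C2 * exp (Re w) powr \<kappa>)"
      using zero_less_one by blast
  next
    define G where "G = (\<lambda>s. \<Sum>j. b j * (s ^ n) ^ j)"
    have lim: "uniform_limit (cball 0 \<rho>) (\<lambda>N z. \<Sum>k<N. lacunary n \<phi> b k z * s ^ k) (\<lambda>z. \<phi> z * G s) sequentially"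
      if s: "s \<in> ball 0 (min 1 L)" for s
    proof -
      have "norm s ^ n \<le> norm s ^ 1" using n s by (intro power_decreasing) auto
      then have "norm (s ^ n) < L" using s by (simp add: norm_power)
      then have "(\<lambda>j. b j * (s ^ n) ^ j) sums G s"
        unfolding G_def using exp_series_summable[OF g(1)] n by (intro summable_sums) auto
      \<comment> \<open>The scalar series is the lacunary one with constant factor 1;
        \<open>scale\<close> then restores \<phi> uniformly on the disc.\<close>
      from lacunary_sums[OF n this, of "\<lambda>_. 1"]
      have "(\<lambda>N. \<Sum>k<N. lacunary n (\<lambda>_. 1) b k 0 * s ^ k) \<longlonglongrightarrow> G s" by (simp add: sums_def lacunary_def)
      moreover have "\<phi> z * (\<Sum>k<N. lacunary n (\<lambda>_. 1) b k 0 * s ^ k) = (\<Sum>k<N. lacunary n \<phi> b k z * s ^ k)" for N z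
        unfolding sum_distrib_left by (rule sum.cong) (auto simp: lacunary_def)
      ultimately show ?thesis using scale by fastforce
    qed
    show "\<exists>r>0. \<exists>f. (\<forall>s\<in>ball 0 r. uniform_limit (cball 0 \<rho>) (\<lambda>N z. \<Sum>k<N. lacunary n \<phi> b k z * s ^ k) (f s) sequentially) \<and>
        (\<forall>w\<in>sector d \<alpha> r. \<forall>z\<in>cball 0 \<rho>. \<phi> z * g w = f (exp w) z)"
    proof (intro exI[of _ "min 1 L"] conjI exI[of _ "\<lambda>s z. \<phi> z * G s"] ballI lim)
      fix w z :: complex assume "w \<in> sector d \<alpha> (min 1 L)"
      then have "exp (Re w) < min 1 L" by (simp add: sector_def)
      from small_exp_power[OF n this] have "(\<lambda>j. b j * (exp w ^ n) ^ j) sums g w"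
        using g(1) by (simp add: exp_series_def exp_of_nat_mult)
      then show "\<phi> z * g w = \<phi> z * G (exp w)" by (simp add: G_def sums_iff)
    qed (use g in auto)
  qed
  with \<alpha>(1) show ?thesis by (rule that)
qed

lemma continuation_lacunary:
  assumes \<phi>: "\<phi> \<in> disc_space \<rho>"
    and n: "n \<ge> 1" and g: "exp_series (real n) L b g" "0 < L" "moderate 0 lo hi g"
    and d: "lo < d" "d < hi"
  shows "continuable \<rho> \<kappa> d (lacunary n \<phi> b)"
    and "\<And>w z. Im w = d \<Longrightarrow> z \<in> cball 0 \<rho> \<Longrightarrow> continuation \<rho> \<kappa> d (lacunary n \<phi> b) w z = \<phi> z * g w"
proof -
  obtain \<alpha> where \<alpha>: "0 < \<alpha>" "(\<lambda>w z. \<phi> z * g w) \<in> continuations \<rho> \<kappa> d \<alpha> (lacunary n \<phi> b)"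
    using lacunary_continuation_exists[OF assms] by metis
  then show "continuable \<rho> \<kappa> d (lacunary n \<phi> b)" unfolding continuable_def by blast
  have "\<exists>v. \<exists>\<alpha>>0. v \<in> continuations \<rho> \<kappa> d \<alpha> (lacunary n \<phi> b)" using \<alpha> by blast
  then have "\<exists>\<alpha>>0. continuation \<rho> \<kappa> d (lacunary n \<phi> b) \<in> continuations \<rho> \<kappa> d \<alpha> (lacunary n \<phi> b)"
    unfolding continuation_def by (rule someI_ex)
  then obtain \<beta> where \<beta>: "0 < \<beta>" "continuation \<rho> \<kappa> d (lacunary n \<phi> b) \<in> continuations \<rho> \<kappa> d \<beta> (lacunary n \<phi> b)" by blast
  have ghol: "g holomorphic_on hstrip lo hi" using g(3) by (simp add: moderate_def)
  show "continuation \<rho> \<kappa> d (lacunary n \<phi> b) w z = \<phi> z * g w" if "Im w = d" "z \<in> cball 0 \<rho>" for w z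
    by (rule continuation_lacunary_unique[OF \<beta>(2) that(2) \<beta>(1) n g(1,2) ghol d that(1)])
qed

section \<open>The formal solution and its Borel transforms\<close>

text \<open>Each application of f to (t f)' multiplies the coefficient of t^m by m + 1.\<close>

lemma fps_deriv_X_mult_power_nth:
  "fps_nth (((\<lambda>f. fps_deriv (fps_X * f)) ^^ p) F) m = of_nat (Suc m) ^ p * fps_nth (F :: 'a::comm_ring_1 fps) m"
  by (induction p) (simp_all add: algebra_simps)

text \<open>Comparing coefficients gives u_N = a N^(p-1) u_(N-q-1), and 0 for 0 < N < q + 1. At N =
  (q+1)(j+1) the factor is a (q+1)^(p-1) (j+1)^(p-1), whence the power and the factorial.\<close>

lemma formal_solution_lacunary:
  assumes u: "formal_solution p q a R \<phi> u" and z: "z \<in> ball 0 R" and p: "p \<ge> 1"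
  shows "u N z = lacunary (Suc q) \<phi> (\<lambda>j. (a * of_nat (Suc q) ^ (p - 1)) ^ j * fact j ^ (p - 1)) N z"
proof (induction N rule: less_induct)
  case (less N)
  define U where "U = Abs_fps (\<lambda>n. u n z)"
  have U: "fps_deriv U = fps_const a * ((\<lambda>f. fps_deriv (fps_X * f)) ^^ p) (fps_X ^ q * U)" "fps_nth U 0 = \<phi> z"
    using u z unfolding formal_solution_def U_def by blast+
  show ?case
  proof (cases N)
    case 0
    then show ?thesis using U(2) by (simp add: U_def lacunary_def)
  next
    case (Suc m)
    have "fps_nth (fps_deriv U) m = fps_nth (fps_const a * ((\<lambda>f. fps_deriv (fps_X * f)) ^^ p) (fps_X ^ q * U)) m"
      by (simp only: U(1))
    then have "of_nat (Suc m) * u (Suc m) z = a * (of_nat (Suc m) ^ p * (if m < q then 0 else u (m - q) z))"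
      by (simp only: fps_mult_left_const_nth fps_deriv_X_mult_power_nth fps_X_power_mult_nth fps_deriv_nth U_def fps_nth_Abs_fps Suc_eq_plus1)
    moreover have "of_nat (Suc m) ^ p = (of_nat (Suc m) * of_nat (Suc m) ^ (p - 1) :: complex)"
      using p by (simp flip: power_Suc)
    ultimately have "of_nat (Suc m) * u (Suc m) z = of_nat (Suc m) * (a * of_nat (Suc m) ^ (p - 1) * (if m < q then 0 else u (m - q) z))"
      by (simp only: mult_ac)
    then have rec: "u N z = a * of_nat N ^ (p - 1) * (if m < q then 0 else u (m - q) z)"
      unfolding Suc by (subst (asm) mult_cancel_left) (simp del: of_nat_Suc)
    show ?thesis
    proof (cases "m < q")
      case True
      then have "\<not> Suc q dvd N" using Suc by (auto dest: dvd_imp_le)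
      then show ?thesis using rec True by (simp add: lacunary_def)
    next
      case False
      define M where "M = m - q"
      have N: "N = M + Suc q" using Suc False by (simp add: M_def)
      have IH: "u M z = lacunary (Suc q) \<phi> (\<lambda>j. (a * of_nat (Suc q) ^ (p - 1)) ^ j * fact j ^ (p - 1)) M z"
        by (rule less.IH) (simp add: N)
      have rec': "u N z = a * of_nat N ^ (p - 1) * u M z" using rec False by (simp add: M_def)
      show ?thesis
      proof (cases "Suc q dvd M")
        case False
        then have "\<not> Suc q dvd N" unfolding N by (simp del: add_Suc_right)
        then show ?thesis using rec' IH False by (simp add: lacunary_def)
      next
        case True
        then obtain j where j: "M = Suc q * j" by blast
        have Nj: "N = Suc q * Suc j" by (simp add: N j)
        have uM: "u M z = \<phi> z * ((a * of_nat (Suc q) ^ (p - 1)) ^ j * fact j ^ (p - 1))"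
          unfolding IH lacunary_def using True by (simp add: j del: mult_Suc)
        have l: "lacunary (Suc q) \<phi> b N z = \<phi> z * b (Suc j)" for b
          unfolding lacunary_def Nj by (simp del: mult_Suc mult_Suc_right)
        show ?thesis
          unfolding rec' uM l unfolding Nj of_nat_mult power_mult_distrib fact_Suc
          by (simp add: mult_ac del: of_nat_Suc)
      qed
    qed
  qed
qed

lemma continuations_cong:
  assumes "\<And>n z. z \<in> cball 0 \<rho> \<Longrightarrow> c n z = c' n z"
  shows "continuations \<rho> \<kappa> d \<alpha> c = continuations \<rho> \<kappa> d \<alpha> c'"
proof -
  have "uniform_limit (cball 0 \<rho>) (\<lambda>N z. \<Sum>n<N. c n z * s ^ n) l sequentially
    \<longleftrightarrow> uniform_limit (cball 0 \<rho>) (\<lambda>N z. \<Sum>n<N. c' n z * s ^ n) l sequentially" for s l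
    by (rule uniform_limit_cong') (use assms in auto)
  then show ?thesis unfolding continuations_def by simp
qed

lemma continuable_cong:
  assumes "\<And>n z. z \<in> cball 0 \<rho> \<Longrightarrow> c n z = c' n z"
  shows "continuable \<rho> \<kappa> d c = continuable \<rho> \<kappa> d c'"
    and "continuation \<rho> \<kappa> d c = continuation \<rho> \<kappa> d c'"
  using continuations_cong[of \<rho> c c'] assms by (simp_all add: continuable_def continuation_def)

section \<open>The geometric function\<close>

text \<open>The Borel transform with respect to \<open>m\<close>, without its factor \<phi>, in the
  logarithmic coordinate.\<close>

definition geometric :: "real \<Rightarrow> complex \<Rightarrow> complex \<Rightarrow> complex" where
  "geometric n c w = 1 / (1 - c * exp (of_real n * w))"

lemma exp_series_geometric:
  assumes "c \<noteq> 0"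
  shows "exp_series n (1 / norm c) (\<lambda>j. c ^ j) (geometric n c)"
  unfolding exp_series_def
proof (intro allI impI)
  fix w :: complex assume "norm (exp (of_real n * w)) < 1 / norm c"
  then have "norm (c * exp (of_real n * w)) < 1" using assms by (simp add: norm_mult field_simps)
  then show "(\<lambda>j. c ^ j * exp (of_real n * w) ^ j) sums geometric n c w"
    using geometric_sums[of "c * exp (of_real n * w)"] by (simp add: geometric_def power_mult_distrib)
qed

text \<open>The distance from 1 to a ray at a given angle is at least the sine of that angle;
  algebraically, the square is at least (r - \<gamma>)^2 + (1 - \<gamma>^2).\<close>

lemma norm_one_minus_ge:
  assumes r: "0 \<le> r" and \<gamma>: "0 \<le> \<gamma>" "\<gamma> \<le> 1" "cos \<theta> \<le> \<gamma>"
  shows "sqrt (1 - \<gamma>\<^sup>2) \<le> norm (1 - of_real r * cis \<theta>)"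
proof -
  have "(norm (1 - of_real r * cis \<theta>))\<^sup>2 = (1 - r * cos \<theta>)\<^sup>2 + (r * sin \<theta>)\<^sup>2"
    by (simp add: cmod_power2)
  also have "\<dots> = 1 - 2 * r * cos \<theta> + r\<^sup>2 * ((cos \<theta>)\<^sup>2 + (sin \<theta>)\<^sup>2)"
  proof -
    have "(1 - r * C)\<^sup>2 + (r * S)\<^sup>2 = 1 - 2 * r * C + r\<^sup>2 * (C\<^sup>2 + S\<^sup>2)" for C S :: real
      by (simp add: power2_eq_square algebra_simps)
    then show ?thesis .
  qed
  also have "\<dots> = 1 - 2 * r * cos \<theta> + r\<^sup>2" by simp
  also have "\<dots> \<ge> 1 - 2 * r * \<gamma> + r\<^sup>2" using mult_left_mono[OF \<gamma>(3) r] by simp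
  also have "1 - 2 * r * \<gamma> + r\<^sup>2 = (r - \<gamma>)\<^sup>2 + (1 - \<gamma>\<^sup>2)" by (simp add: power2_eq_square algebra_simps)
  finally have "1 - \<gamma>\<^sup>2 \<le> (norm (1 - of_real r * cis \<theta>))\<^sup>2" using zero_le_power2[of "r - \<gamma>"] by linarith
  then show ?thesis by (rule real_le_lsqrt[OF norm_ge_zero])
qed

text \<open>All poles lie at the heights (2 k pi - \<theta>) / n. Strictly between two consecutive
  ones the argument of c exp(n w) stays away from multiples of 2 pi.\<close>

lemma moderate_geometric:
  fixes k :: int
  assumes n: "0 < n" and c: "c = of_real (norm c) * cis \<theta>"
  shows "moderate 0 ((2 * of_int k * pi - \<theta>) / n) ((2 * of_int (k + 1) * pi - \<theta>) / n) (geometric n c)"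
proof -
  define lo where "lo = (2 * of_int k * pi - \<theta>) / n"
  define hi where "hi = (2 * of_int (k + 1) * pi - \<theta>) / n"
  have bound: "\<exists>A>0. \<forall>w. a' \<le> Im w \<and> Im w \<le> b' \<longrightarrow> c * exp (of_real n * w) \<noteq> 1 \<and> norm (geometric n c w) \<le> A"
    if ab: "lo < a'" "b' < hi" for a' b'
  proof -
    \<comment> \<open>The angular distance of the substrip from the two pole rays, capped at pi/2 so
      that its cosine is nonnegative.\<close>
    define \<eta> where "\<eta> = min (min (n * (a' - lo)) (n * (hi - b'))) (pi / 2)"
    have \<eta>: "0 < \<eta>" "\<eta> \<le> pi / 2" "\<eta> \<le> n * (a' - lo)" "\<eta> \<le> n * (hi - b')" using ab n by (auto simp: \<eta>_def)
    define \<gamma> where "\<gamma> = cos \<eta>"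
    have \<gamma>: "0 \<le> \<gamma>" "\<gamma> < 1"
      using \<eta> cos_monotone_0_pi[of 0 \<eta>] pi_gt_zero by (auto simp: \<gamma>_def intro!: cos_ge_zero)
    define s where "s = sqrt (1 - \<gamma>\<^sup>2)"
    have s: "0 < s" using \<gamma> by (simp add: s_def abs_square_less_1)
    have "s \<le> norm (1 - c * exp (of_real n * w))" if w: "a' \<le> Im w" "Im w \<le> b'" for w
    proof -
      \<comment> \<open>The representative in (0, 2 pi) of the argument of c exp(n w).\<close>
      let ?x = "\<theta> + n * Im w - 2 * pi * of_int k"
      have "n * (a' - lo) \<le> n * (Im w - lo)" "n * (hi - b') \<le> n * (hi - Im w)" using w n by auto
      moreover have "n * (Im w - lo) = ?x" "n * (hi - Im w) = 2 * pi - ?x"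
        using n by (simp_all add: lo_def hi_def field_simps)
      ultimately have x: "\<eta> \<le> ?x" "?x \<le> 2 * pi - \<eta>" using \<eta> by linarith+
      have "cos ?x \<le> \<gamma>"
      proof (cases "?x \<le> pi")
        case True
        then show ?thesis unfolding \<gamma>_def using x \<eta> by (intro cos_monotone_0_pi_le) auto
      next
        case False
        then have "cos (2 * pi - ?x) \<le> \<gamma>" unfolding \<gamma>_def using x \<eta> by (intro cos_monotone_0_pi_le) auto
        then show ?thesis by (simp only: cos_2pi_minus)
      qed
      moreover have "cos ?x = cos (\<theta> + n * Im w)"
        by (subst cos_diff) (simp add: cos_integer_2pi sin_integer_2pi)
      ultimately have "cos (\<theta> + n * Im w) \<le> \<gamma>" by simp
      then have "s \<le> norm (1 - of_real (norm c * exp (n * Re w)) * cis (\<theta> + n * Im w))"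
        unfolding s_def using \<gamma> by (intro norm_one_minus_ge) auto
      moreover have "c * exp (of_real n * w) = of_real (norm c * exp (n * Re w)) * cis (\<theta> + n * Im w)"
        by (subst c) (simp add: exp_eq_polar[of "of_real n * w"] cis_mult[symmetric] exp_of_real)
      ultimately show ?thesis by simp
    qed
    then have "c * exp (of_real n * w) \<noteq> 1 \<and> norm (geometric n c w) \<le> 1 / s" if "a' \<le> Im w \<and> Im w \<le> b'" for w
      using s that by (force simp: geometric_def norm_divide intro!: divide_left_mono mult_pos_pos)
    then show ?thesis using s by (intro exI[of _ "1 / s"]) auto
  qed
  have "geometric n c holomorphic_on hstrip lo hi"
    unfolding geometric_def
  proof (intro holomorphic_intros)
    fix w assume w: "w \<in> hstrip lo hi"
    from w have "lo < Im w" "Im w < hi" by (auto simp: hstrip_def)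
    from bound[OF this] show "1 - c * exp (of_real n * w) \<noteq> 0" by auto
  qed
  then show ?thesis using bound unfolding moderate_def lo_def[symmetric] hi_def[symmetric] by (simp, blast)
qed

lemma root_gap:
  assumes n: "0 < (n::real)" and d: "\<And>k::int. d \<noteq> (2 * of_int k * pi - \<theta>) / n"
  obtains k :: int where "(2 * of_int k * pi - \<theta>) / n < d" "d < (2 * of_int (k + 1) * pi - \<theta>) / n"
proof
  let ?y = "(n * d + \<theta>) / (2 * pi)"
  have "of_int \<lfloor>?y\<rfloor> * (2 * pi) \<le> ?y * (2 * pi)" "?y * (2 * pi) < of_int (\<lfloor>?y\<rfloor> + 1) * (2 * pi)"
    by (intro mult_right_mono mult_strict_right_mono; simp; linarith)+
  moreover have "?y * (2 * pi) = n * d + \<theta>" by simp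
  ultimately have "2 * of_int \<lfloor>?y\<rfloor> * pi \<le> n * d + \<theta>" "n * d + \<theta> < 2 * of_int (\<lfloor>?y\<rfloor> + 1) * pi"
    by (simp_all only: mult_ac)
  then show "d < (2 * of_int (\<lfloor>?y\<rfloor> + 1) * pi - \<theta>) / n" "(2 * of_int \<lfloor>?y\<rfloor> * pi - \<theta>) / n < d"
    using n d[of "\<lfloor>?y\<rfloor>"] by (auto simp: field_simps)
qed

section \<open>Laplace integrals\<close>

definition line_laplace :: "(complex \<Rightarrow> complex) \<Rightarrow> (complex \<Rightarrow> complex) \<Rightarrow> real \<Rightarrow> complex \<Rightarrow> complex" where
  "line_laplace e f d t = (\<integral>x. e (Complex x d - t) * f (Complex x d) \<partial>lborel)"

lemma line_laplace_ray:
  assumes e: "flat \<kappa> \<alpha> e" and f: "moderate 0 lo hi f" and \<kappa>: "0 < \<kappa>"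
    and d: "lo < d" "d < hi" "\<bar>d - Im t\<bar> < \<alpha>"
    and F: "\<And>x. F (Complex x d) = k * (e (Complex x d - t) * f (Complex x d))"
  shows "ray_integrable d F" "ray_integral d F = k * line_laplace e f d t"
proof -
  have dec: "decaying (max lo (Im t - \<alpha>)) (min hi (Im t + \<alpha>)) (\<lambda>w. e (w - t) * f w)"
    by (rule decaying_flat_mult_moderate[OF e f \<kappa>]) simp
  have int: "integrable lborel (\<lambda>x. e (Complex x d - t) * f (Complex x d))"
    by (rule decaying_integrable[OF dec]) (use d in auto)
  then have meas: "(\<lambda>x. F (Complex x d)) \<in> borel_measurable borel"
    unfolding F using borel_measurable_integrable[OF int] by simp
  show "ray_integrable d F" "ray_integral d F = k * line_laplace e f d t"
    unfolding ray_line[OF meas] F line_laplace_def using int by simp_all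
qed

text \<open>Only the kernel depends on \<open>t\<close>. For \<open>t\<close> in a unit ball its
  decay is uniform up to a constant, and \<open>f\<close> is bounded on the line, so differentiation
  under the integral applies.\<close>

lemma holomorphic_line_laplace:
  assumes e: "flat \<kappa> \<alpha> e" and f: "moderate 0 lo hi f" and \<kappa>: "0 < \<kappa>"
    and d: "lo < d" "d < hi"
  shows "line_laplace e f d holomorphic_on hstrip (d - \<alpha>) (d + \<alpha>)"
proof (subst holomorphic_on_open[OF open_hstrip], intro ballI)
  fix t assume t: "t \<in> hstrip (d - \<alpha>) (d + \<alpha>)"
  have ehol: "e holomorphic_on hstrip (- \<alpha>) \<alpha>" using e by (simp add: flat_def)
  have fhol: "f holomorphic_on hstrip lo hi" using f by (simp add: moderate_def)
  have one: "moderate 0 (- \<alpha>) \<alpha> (\<lambda>w. 1)"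
    unfolding moderate_def by (auto intro!: exI[of _ 1])
  have dec: "decaying (- \<alpha>) \<alpha> e"
    using decaying_flat_mult_moderate[OF e one \<kappa>, of 0] by simp
  define \<alpha>' where "\<alpha>' = (\<bar>d - Im t\<bar> + \<alpha>) / 2"
  have \<alpha>': "\<bar>d - Im t\<bar> < \<alpha>'" "\<alpha>' < \<alpha>" using t by (auto simp: \<alpha>'_def hstrip_def abs_less_iff)
  obtain A \<delta> where A: "A > 0" "\<delta> > 0" "\<And>w. - \<alpha>' \<le> Im w \<Longrightarrow> Im w \<le> \<alpha>' \<Longrightarrow> norm (e w) \<le> A * exp (- \<delta> * \<bar>Re w\<bar>)"
    using decayingD[OF dec, of "- \<alpha>'" \<alpha>'] \<alpha>' by auto
  obtain B where B: "B > 0" "\<And>w. d \<le> Im w \<Longrightarrow> Im w \<le> d \<Longrightarrow> norm (f w) \<le> B * exp (0 * Re w)"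
    using moderateD[OF f d] by metis
  define S where "S = hstrip (d - \<alpha>') (d + \<alpha>') \<inter> ball t 1"
  let ?g = "\<lambda>x. A * B * exp (\<delta> * (\<bar>Re t\<bar> + 1)) * exp (- \<delta> * \<bar>x\<bar>)"
  have "((\<lambda>t. \<integral>x. e (Complex x d - t) * f (Complex x d) \<partial>lborel) has_field_derivative
      (\<integral>x. deriv (\<lambda>t. e (Complex x d - t) * f (Complex x d)) t \<partial>lborel)) (at t)"
  proof (rule has_field_derivative_parameter_integral(2))
    show "open S" unfolding S_def by (intro open_Int open_hstrip open_ball)
    show "t \<in> S" using \<alpha>' by (auto simp: S_def hstrip_def abs_less_iff)
    show "(\<lambda>x. e (Complex x d - s) * f (Complex x d)) \<in> borel_measurable lborel" if s: "s \<in> S" for s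
    proof -
      have "decaying (max lo (Im s - \<alpha>)) (min hi (Im s + \<alpha>)) (\<lambda>w. e (w - s) * f w)"
        by (rule decaying_flat_mult_moderate[OF e f \<kappa>]) simp
      from decaying_integrable[OF this, of d] show ?thesis
        using s d \<alpha>' by (auto simp: S_def hstrip_def)
    qed
    show "(\<lambda>s. e (Complex x d - s) * f (Complex x d)) holomorphic_on S" for x
    proof -
      have "(e \<circ> (\<lambda>s. Complex x d - s)) holomorphic_on S"
        by (rule holomorphic_on_compose_gen[OF _ ehol])
           (use \<alpha>' in \<open>auto simp: S_def hstrip_def intro!: holomorphic_intros\<close>)
      then show ?thesis by (auto simp: o_def intro!: holomorphic_intros)
    qed
    show "integrable lborel ?g" using integrable_exp_minus_abs[OF A(2)] by simp
    fix s x assume s: "s \<in> S"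
    have "\<bar>Re s - Re t\<bar> < 1"
      using s abs_Re_le_cmod[of "s - t"] by (auto simp: S_def dist_norm norm_minus_commute)
    then have "\<bar>x\<bar> - (\<bar>Re t\<bar> + 1) \<le> \<bar>x - Re s\<bar>" by linarith
    then have "- \<delta> * \<bar>x - Re s\<bar> \<le> \<delta> * (\<bar>Re t\<bar> + 1) + - \<delta> * \<bar>x\<bar>"
      using mult_left_mono[of "\<bar>x\<bar> - (\<bar>Re t\<bar> + 1)" "\<bar>x - Re s\<bar>" \<delta>] A(2) by (simp add: algebra_simps)
    then have "A * exp (- \<delta> * \<bar>x - Re s\<bar>) \<le> A * (exp (\<delta> * (\<bar>Re t\<bar> + 1)) * exp (- \<delta> * \<bar>x\<bar>))"
      using A(1) unfolding exp_add[symmetric] by simp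
    moreover have "norm (e (Complex x d - s)) \<le> A * exp (- \<delta> * \<bar>x - Re s\<bar>)"
      using A(3)[of "Complex x d - s"] s by (auto simp: S_def hstrip_def)
    ultimately have 1: "norm (e (Complex x d - s)) \<le> A * (exp (\<delta> * (\<bar>Re t\<bar> + 1)) * exp (- \<delta> * \<bar>x\<bar>))" by linarith
    have 2: "norm (f (Complex x d)) \<le> B" using B(2)[of "Complex x d"] by simp
    show "norm (e (Complex x d - s) * f (Complex x d)) \<le> ?g x"
      using mult_mono[OF 1 2] A(1) by (simp add: norm_mult mult_ac)
  qed
  then show "\<exists>f'. (line_laplace e f d has_field_derivative f') (at t)"
    unfolding line_laplace_def by blast
qed

lemma holomorphic2_on_product:
  assumes \<phi>: "\<phi> holomorphic_on B" "open B" and U: "U holomorphic_on S" "open S"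
    and f: "\<And>t z. t \<in> S \<Longrightarrow> z \<in> B \<Longrightarrow> f t z = \<phi> z * U t"
  shows "holomorphic2_on f (S \<times> B)"
  unfolding holomorphic2_on_def
proof (intro ballI)
  fix x assume x: "x \<in> S \<times> B"
  obtain t z where tz: "x = (t, z)" "t \<in> S" "z \<in> B" using x by auto
  have dU: "(U has_derivative (\<lambda>h. deriv U t * h)) (at t)"
    using holomorphic_derivI[OF U tz(2)] by (simp add: has_field_derivative_def)
  have d\<phi>: "(\<phi> has_derivative (\<lambda>h. deriv \<phi> z * h)) (at z)"
    using holomorphic_derivI[OF \<phi> tz(3)] by (simp add: has_field_derivative_def)
  have 1: "((\<lambda>x. U (fst x)) has_derivative (\<lambda>h. deriv U t * fst h)) (at x)"
    by (rule has_derivative_compose[of fst fst x UNIV U, simplified]) (use dU tz in \<open>auto intro: derivative_intros\<close>)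
  have 2: "((\<lambda>x. \<phi> (snd x)) has_derivative (\<lambda>h. deriv \<phi> z * snd h)) (at x)"
    by (rule has_derivative_compose[of snd snd x UNIV \<phi>, simplified]) (use d\<phi> tz in \<open>auto intro: derivative_intros\<close>)
  have "((\<lambda>x. \<phi> (snd x) * U (fst x)) has_derivative
      (\<lambda>h. \<phi> z * (deriv U t * fst h) + deriv \<phi> z * snd h * U t)) (at x)"
    using has_derivative_mult[OF 2 1] by (simp add: tz)
  then have "((\<lambda>(t, z). f t z) has_derivative (\<lambda>h. \<phi> z * (deriv U t * fst h) + deriv \<phi> z * snd h * U t)) (at x)"
    by (rule has_derivative_transform_within_open[OF _ open_Times[OF U(2) \<phi>(2)] x]) (auto simp: f)
  then have "((\<lambda>(t, z). f t z) has_derivative (\<lambda>(h, k). (\<phi> z * deriv U t) * h + (deriv \<phi> z * U t) * k)) (at x)"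
    by (simp add: case_prod_unfold algebra_simps)
  then show "\<exists>A B. ((\<lambda>(w, z). f w z) has_derivative (\<lambda>(h, k). A * h + B * k)) (at x)" by blast
qed

section \<open>The jump across a pole\<close>

text \<open>The part between the tails lies in a compact rectangle, where continuity bounds the
  function. This allows poles, removable ones included, to be ignored in estimates.\<close>

lemma decaying_from_tail:
  assumes hol: "H holomorphic_on hstrip a b"
    and tail: "\<And>a' b'. a < a' \<Longrightarrow> b' < b \<Longrightarrow>
      \<exists>A \<delta> R. 0 < \<delta> \<and> (\<forall>w. a' \<le> Im w \<and> Im w \<le> b' \<and> R \<le> \<bar>Re w\<bar> \<longrightarrow> norm (H w) \<le> A * exp (- \<delta> * \<bar>Re w\<bar>))"
  shows "decaying a b H"
  unfolding decaying_def
proof (intro conjI allI impI hol)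
  fix a' b' assume ab: "a < a' \<and> b' < b"
  then obtain A \<delta> R where A: "0 < \<delta>"
    "\<And>w. a' \<le> Im w \<and> Im w \<le> b' \<and> R \<le> \<bar>Re w\<bar> \<Longrightarrow> norm (H w) \<le> A * exp (- \<delta> * \<bar>Re w\<bar>)"
    using tail by metis
  define K where "K = cbox (Complex (- \<bar>R\<bar>) a') (Complex \<bar>R\<bar> b')"
  have "K \<subseteq> hstrip a b" using ab by (auto simp: K_def in_cbox_complex_iff hstrip_def)
  then have "compact (H ` K)"
    using hol by (intro compact_continuous_image) (auto simp: K_def intro: holomorphic_on_imp_continuous_on holomorphic_on_subset)
  then obtain B where B: "B > 0" "\<And>w. w \<in> K \<Longrightarrow> norm (H w) \<le> B"
    using compact_imp_bounded bounded_pos by (metis imageI)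
  define C where "C = \<bar>A\<bar> + B * exp (\<delta> * \<bar>R\<bar>)"
  have "norm (H w) \<le> C * exp (- \<delta> * \<bar>Re w\<bar>)" if w: "a' \<le> Im w \<and> Im w \<le> b'" for w
  proof (cases "R \<le> \<bar>Re w\<bar>")
    case True
    then have "norm (H w) \<le> A * exp (- \<delta> * \<bar>Re w\<bar>)" using A(2) w by blast
    also have "\<dots> \<le> C * exp (- \<delta> * \<bar>Re w\<bar>)"
    proof (rule mult_right_mono)
      have "0 \<le> B * exp (\<delta> * \<bar>R\<bar>)" using B by simp
      then show "A \<le> C" unfolding C_def by linarith
    qed simp
    finally show ?thesis .
  next
    case False
    then have "w \<in> K" using w by (auto simp: K_def in_cbox_complex_iff)
    then have "norm (H w) \<le> B * 1" using B by simp
    also have "\<dots> \<le> B * exp (\<delta> * \<bar>R\<bar> + - \<delta> * \<bar>Re w\<bar>)"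
      using False A(1) B(1) by (intro mult_left_mono) (auto simp flip: right_diff_distrib)
    also have "\<dots> = (B * exp (\<delta> * \<bar>R\<bar>)) * exp (- \<delta> * \<bar>Re w\<bar>)" unfolding exp_add by simp
    also have "\<dots> \<le> C * exp (- \<delta> * \<bar>Re w\<bar>)" by (intro mult_right_mono) (auto simp: C_def)
    finally show ?thesis .
  qed
  moreover have "C > 0" using B by (auto simp: C_def intro: add_nonneg_pos)
  ultimately show "\<exists>A>0. \<exists>\<delta>>0. \<forall>w. a' \<le> Im w \<and> Im w \<le> b' \<longrightarrow> norm (H w) \<le> A * exp (- \<delta> * \<bar>Re w\<bar>)"
    using A(1) by blast
qed

text \<open>With r = exp x the integral becomes that of 2 / (1 + r^2) over the half line.\<close>

lemma integral_sech:
  "integrable lborel (\<lambda>x::real. complex_of_real (2 * exp x / (1 + (exp x)\<^sup>2)))"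
  "(\<integral>x. complex_of_real (2 * exp x / (1 + (exp x)\<^sup>2)) \<partial>lborel) = of_real pi"
proof -
  let ?g = "\<lambda>x::real. complex_of_real (2 * exp x / (1 + (exp x)\<^sup>2))"
  have [measurable]: "?g \<in> borel_measurable borel" by measurable
  have g: "?g (ln r) / of_real r = of_real (2 * (1 / (1 + r\<^sup>2)))" if "r \<in> {0<..}" for r
  proof -
    have "2 * r / (1 + r\<^sup>2) / r = 2 * (1 / (1 + r\<^sup>2))" using that by simp
    then have "complex_of_real (2 * r / (1 + r\<^sup>2)) / of_real r = of_real (2 * (1 / (1 + r\<^sup>2)))"
      by (metis of_real_divide)
    then show ?thesis using that by simp
  qed
  have i: "set_integrable lborel {0<..} (\<lambda>r::real. 1 / (1 + r\<^sup>2))"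
    and v: "(LINT r:{0<..}|lborel. 1 / (1 + r\<^sup>2)) = pi / 2"
    using integrable_I0i_1_div_plus_square LBINT_I0i_1_div_plus_square
    unfolding zero_ereal_def interval_integral_to_infinity_eq interval_integrable_to_infinity_eq by auto
  have v2: "(LINT r:{0<..}|lborel. 2 * (1 / (1 + r\<^sup>2))) = pi" using v by (subst set_integral_mult_right) simp
  have "set_integrable lborel {0<..} (\<lambda>r. complex_of_real (2 * (1 / (1 + r\<^sup>2))))"
  proof -
    have "integrable lborel (\<lambda>r. complex_of_real (indicat_real {0<..} r *\<^sub>R (2 * (1 / (1 + r\<^sup>2)))))"
      using integrable_mult_right[OF i[unfolded set_integrable_def], of 2]
      unfolding complex_of_real_integrable_eq by (simp add: mult_ac)
    then show ?thesis unfolding set_integrable_def by (simp add: scaleR_conv_of_real)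
  qed
  then have "set_integrable lborel {0<..} (\<lambda>r. ?g (ln r) / of_real r)"
    by (subst set_integrable_cong[OF refl refl g])
  then show "integrable lborel ?g" using integral_ln_substitution(1)[of ?g] by simp
  have "(\<integral>x. ?g x \<partial>lborel) = (LINT r:{0<..}|lborel. ?g (ln r) / of_real r)"
    using integral_ln_substitution(2)[of ?g] by simp
  also have "\<dots> = (LINT r:{0<..}|lborel. complex_of_real (2 * (1 / (1 + r\<^sup>2))))"
    by (rule set_lebesgue_integral_cong) (use g in auto)
  also have "\<dots> = complex_of_real (LINT r:{0<..}|lborel. 2 * (1 / (1 + r\<^sup>2)))"
  proof -
    have "(LINT r:{0<..}|lborel. complex_of_real (2 * (1 / (1 + r\<^sup>2))))
        = (\<integral>r. complex_of_real (indicat_real {0<..} r *\<^sub>R (2 * (1 / (1 + r\<^sup>2)))) \<partial>lborel)"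
      unfolding set_lebesgue_integral_def by (simp add: scaleR_conv_of_real)
    also have "\<dots> = complex_of_real (LINT r:{0<..}|lborel. 2 * (1 / (1 + r\<^sup>2)))"
      unfolding set_lebesgue_integral_def by (rule integral_complex_of_real)
    finally show ?thesis .
  qed
  also have "\<dots> = of_real pi" by (simp only: v2)
  finally show "(\<integral>x. ?g x \<partial>lborel) = of_real pi" .
qed

text \<open>A model function with the same simple pole as 1 / (1 - exp (n (w - v))) and known line integrals:
  it is - 1 / sinh (n (w - v)), odd about v, and reduces to sech on the line at height Im v + pi / (2 n).\<close>

definition pole_model :: "real \<Rightarrow> complex \<Rightarrow> complex \<Rightarrow> complex" where
  "pole_model n v w = 2 * exp (of_real n * (w - v)) / (1 - (exp (of_real n * (w - v)))\<^sup>2)"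

lemma exp_square_eq_1:
  assumes n: "0 < n" and 1: "(exp (of_real n * (w - v)))\<^sup>2 = 1"
  obtains m :: int where "Re w = Re v" "n * (Im w - Im v) = of_int m * pi"
proof -
  have "exp (2 * (of_real n * (w - v))) = 1" using 1 by (simp add: exp_double)
  then show ?thesis using n that by (auto simp: exp_eq_1)
qed

text \<open>At horizontal distance at least 1 from \<open>v\<close> the modulus of X = exp(n (w -
  v)) is at least exp n or at most exp(-n), so X and X^2 keep away from 1. The quotient X / (1 -
  X^2) decays like the smaller of |X| and 1/|X|.\<close>

lemma exp_tail_bounds:
  assumes n: "0 < n" and w: "1 \<le> \<bar>Re w - Re v\<bar>"
  shows "norm (1 / (1 - exp (of_real n * (w - v)))) \<le> 1 / (1 - exp (- n))"
    and "norm (pole_model n v w) \<le> 2 / (1 - exp (- n)) * exp (- n * \<bar>Re w - Re v\<bar>)"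
proof -
  define X where "X = exp (of_real n * (w - v))"
  define x where "x = Re w - Re v"
  have nX: "norm X = exp (n * x)" by (simp add: X_def x_def)
  define s where "s = 1 - exp (- n)"
  have s: "0 < s" using n by (simp add: s_def)
  have tri: "norm X - 1 \<le> norm (1 - X)" "1 - norm X \<le> norm (1 - X)"
    "(norm X)\<^sup>2 - 1 \<le> norm (1 - X\<^sup>2)" "1 - (norm X)\<^sup>2 \<le> norm (1 - X\<^sup>2)"
    using norm_triangle_ineq2[of X 1] norm_triangle_ineq2[of 1 X] norm_triangle_ineq2[of "X\<^sup>2" 1] norm_triangle_ineq2[of 1 "X\<^sup>2"]
    by (simp_all add: norm_minus_commute norm_power)
  have "s \<le> norm (1 - X) \<and> s * (norm X * exp (n * \<bar>x\<bar>)) \<le> norm (1 - X\<^sup>2)"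
  proof (cases "x \<ge> 1")
    case True
    have en: "exp n \<le> norm X" unfolding nX using True n by simp
    have "(exp n - 1)\<^sup>2 \<ge> 0" by simp
    then have "2 \<le> exp n + exp (- n)" by (simp add: power2_eq_square exp_minus field_simps)
    moreover have "exp n - 1 \<le> norm (1 - X)" using en tri(1) by linarith
    ultimately have 1: "s \<le> norm (1 - X)" by (simp add: s_def)
    have "1 = exp (- n) * exp n" by (simp add: exp_minus)
    also have "\<dots> \<le> exp (- n) * (norm X)\<^sup>2"
    proof (rule mult_left_mono)
      have "1 \<le> exp n" using n by simp
      then have "1 \<le> norm X" using en by linarith
      then have "norm X * 1 \<le> norm X * norm X" by (intro mult_left_mono) auto
      then show "exp n \<le> (norm X)\<^sup>2" using en by (simp add: power2_eq_square)
    qed simp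
    finally have "s * (norm X)\<^sup>2 \<le> (norm X)\<^sup>2 - 1" by (simp add: s_def algebra_simps)
    moreover have "norm X * exp (n * \<bar>x\<bar>) = (norm X)\<^sup>2" using True by (simp add: nX power2_eq_square)
    ultimately show ?thesis using 1 tri(3) by simp
  next
    case False
    then have x: "x \<le> -1" using w by (auto simp: x_def)
    have en: "norm X \<le> exp (- n)" unfolding nX using mult_left_mono[OF x, of n] n by simp
    have 1: "s \<le> norm (1 - X)" using en tri(2) by (simp add: s_def)
    have "norm X * exp (n * \<bar>x\<bar>) = 1" using x by (simp add: nX flip: exp_add)
    moreover have "(norm X)\<^sup>2 \<le> norm X"
    proof -
      have "exp (- n) \<le> 1" using n by simp
      then have "norm X \<le> 1" using en by linarith
      then have "norm X * norm X \<le> norm X * 1" by (intro mult_left_mono) auto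
      then show ?thesis by (simp add: power2_eq_square)
    qed
    ultimately show ?thesis using 1 en tri(4) by (simp add: s_def)
  qed
  then have b: "s \<le> norm (1 - X)" "s * (norm X * exp (n * \<bar>x\<bar>)) \<le> norm (1 - X\<^sup>2)" by auto
  show "norm (1 / (1 - exp (of_real n * (w - v)))) \<le> 1 / (1 - exp (- n))"
    using b(1) s unfolding X_def[symmetric] s_def[symmetric] by (auto simp: norm_divide intro!: divide_left_mono mult_pos_pos)
  have nX0: "0 < norm X" by (simp add: nX)
  have p: "0 < s * (norm X * exp (n * \<bar>x\<bar>))" using s nX0 by simp
  have pd: "0 < norm (1 - X\<^sup>2)" using b(2) p by linarith
  have "norm (pole_model n v w) = 2 * norm X / norm (1 - X\<^sup>2)"
    by (simp add: pole_model_def X_def norm_divide norm_mult)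
  also have "\<dots> \<le> 2 * norm X / (s * (norm X * exp (n * \<bar>x\<bar>)))"
    by (intro divide_left_mono[OF b(2)] mult_pos_pos pd p) simp
  also have "\<dots> = 2 / s * exp (- n * \<bar>x\<bar>)" using nX0 by (simp add: exp_minus field_simps)
  finally show "norm (pole_model n v w) \<le> 2 / (1 - exp (- n)) * exp (- n * \<bar>Re w - Re v\<bar>)"
    by (simp add: s_def x_def)
qed

lemma exp_shift_abs:
  assumes "0 < (n::real)"
  shows "exp (- n * \<bar>x - y\<bar>) \<le> exp (n * \<bar>y\<bar>) * exp (- n * \<bar>x\<bar>)"
proof -
  have "n * (\<bar>x\<bar> - \<bar>y\<bar>) \<le> n * \<bar>x - y\<bar>" using assms by (intro mult_left_mono) auto
  then show ?thesis unfolding exp_add[symmetric] by (simp add: algebra_simps)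
qed

text \<open>The square adds poles where X = -1, so the rows of poles are pi/n apart, half the
  spacing of the geometric poles; the strip lies between two rows.\<close>

lemma decaying_pole_model:
  assumes n: "0 < n"
  shows "decaying (Im v) (Im v + pi / n) (pole_model n v)"
proof (rule decaying_from_tail)
  show "pole_model n v holomorphic_on hstrip (Im v) (Im v + pi / n)"
    unfolding pole_model_def
  proof (intro holomorphic_intros)
    fix w assume w: "w \<in> hstrip (Im v) (Im v + pi / n)"
    show "1 - (exp (of_real n * (w - v)))\<^sup>2 \<noteq> 0"
    proof
      assume "1 - (exp (of_real n * (w - v)))\<^sup>2 = 0"
      then have "(exp (of_real n * (w - v)))\<^sup>2 = 1" by simp
      then obtain m where m: "n * (Im w - Im v) = of_int m * pi" using exp_square_eq_1[OF n] by metis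
      have "0 < n * (Im w - Im v)" "n * (Im w - Im v) < pi" using w n by (auto simp: hstrip_def field_simps)
      then have "0 < of_int m * pi" "of_int m * pi < 1 * pi" unfolding m by auto
      then have "0 < m" "m < 1" using pi_gt_zero by (auto simp: zero_less_mult_iff mult_less_cancel_right)
      then show False by simp
    qed
  qed
  fix a' b'
  show "\<exists>A \<delta> R. 0 < \<delta> \<and> (\<forall>w. a' \<le> Im w \<and> Im w \<le> b' \<and> R \<le> \<bar>Re w\<bar> \<longrightarrow> norm (pole_model n v w) \<le> A * exp (- \<delta> * \<bar>Re w\<bar>))"
  proof (rule exI[of _ "2 / (1 - exp (- n)) * exp (n * \<bar>Re v\<bar>)"], rule exI[of _ n], rule exI[of _ "\<bar>Re v\<bar> + 1"],
      intro conjI allI impI n)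
    fix w assume "a' \<le> Im w \<and> Im w \<le> b' \<and> \<bar>Re v\<bar> + 1 \<le> \<bar>Re w\<bar>"
    then have "1 \<le> \<bar>Re w - Re v\<bar>" by linarith
    from exp_tail_bounds(2)[OF n this]
    have "norm (pole_model n v w) \<le> 2 / (1 - exp (- n)) * exp (- n * \<bar>Re w - Re v\<bar>)" .
    also have "\<dots> \<le> 2 / (1 - exp (- n)) * (exp (n * \<bar>Re v\<bar>) * exp (- n * \<bar>Re w\<bar>))"
      using exp_shift_abs[OF n] n by (intro mult_left_mono) auto
    finally show "norm (pole_model n v w) \<le> 2 / (1 - exp (- n)) * exp (n * \<bar>Re v\<bar>) * exp (- n * \<bar>Re w\<bar>)"
      by (simp only: mult.assoc)
  qed
qed

text \<open>Halfway between the rows X is purely imaginary and the model becomes i sech; the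
  integral is moved to that height.\<close>

lemma pole_model_above:
  assumes n: "0 < n" and \<theta>: "0 < \<theta>" "\<theta> < pi / n"
  shows "integrable lborel (\<lambda>x. pole_model n v (Complex x (Im v + \<theta>)))"
    and "(\<integral>x. pole_model n v (Complex x (Im v + \<theta>)) \<partial>lborel) = \<i> * pi / n"
proof -
  note dec = decaying_pole_model[OF n, of v]
  show "integrable lborel (\<lambda>x. pole_model n v (Complex x (Im v + \<theta>)))"
    by (rule decaying_integrable[OF dec]) (use \<theta> in auto)
  let ?s = "\<lambda>x::real. complex_of_real (2 * exp x / (1 + (exp x)\<^sup>2))"
  have mid: "pole_model n v (Complex x (Im v + pi / (2 * n))) = \<i> * ?s (- (n * Re v) + n * x)" for x
  proof -
    have "of_real n * (Complex x (Im v + pi / (2 * n)) - v) = of_real (- (n * Re v) + n * x) + \<i> * of_real (pi / 2)"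
      using n by (simp add: complex_eq_iff field_simps)
    then have "exp (of_real n * (Complex x (Im v + pi / (2 * n)) - v)) = \<i> * of_real (exp (- (n * Re v) + n * x))"
      by (simp only: exp_add exp_of_real) (simp add: exp_eq_polar cis_conv_exp[symmetric] del: of_real_add)
    then show ?thesis unfolding pole_model_def by (simp add: power_mult_distrib)
  qed
  have "(\<integral>x. pole_model n v (Complex x (Im v + \<theta>)) \<partial>lborel) = (\<integral>x. pole_model n v (Complex x (Im v + pi / (2 * n))) \<partial>lborel)"
    by (rule line_integral_shift[OF dec]) (use \<theta> n in \<open>auto simp: field_simps\<close>)
  also have "\<dots> = \<i> * (\<integral>x. ?s (- (n * Re v) + n * x) \<partial>lborel)"
    unfolding mid by (rule integral_mult_right_zero)
  also have "(\<integral>x. ?s (- (n * Re v) + n * x) \<partial>lborel) = pi / n"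
    using lborel_integral_real_affine[of n ?s "- (n * Re v)"] n integral_sech(2)
    by (simp add: scaleR_conv_of_real field_simps)
  finally show "(\<integral>x. pole_model n v (Complex x (Im v + \<theta>)) \<partial>lborel) = \<i> * pi / n" by simp
qed

lemma pole_model_odd: "pole_model n v (2 * v - w) = - pole_model n v w"
proof -
  define X where "X = exp (of_real n * (w - v))"
  have "of_real n * (2 * v - w - v) = - (of_real n * (w - v))" by (simp add: algebra_simps)
  then have "exp (of_real n * (2 * v - w - v)) = inverse X" unfolding X_def by (simp only: exp_minus)
  moreover have "X \<noteq> 0" by (simp add: X_def)
  then have "2 * inverse X / (1 - (inverse X)\<^sup>2) = - (2 * X / (1 - X\<^sup>2))"
    by (cases "X\<^sup>2 = 1") (simp_all add: divide_simps power2_eq_square, simp_all add: algebra_simps)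
  ultimately show ?thesis unfolding pole_model_def X_def by simp
qed

text \<open>The reflection w to 2 v - w exchanges the heights above and below \<open>v\<close> and
  changes the sign of the model.\<close>

lemma pole_model_below:
  assumes n: "0 < n" and \<theta>: "0 < \<theta>" "\<theta> < pi / n"
  shows "integrable lborel (\<lambda>x. pole_model n v (Complex x (Im v - \<theta>)))"
    and "(\<integral>x. pole_model n v (Complex x (Im v - \<theta>)) \<partial>lborel) = - (\<i> * pi / n)"
proof -
  have eq: "pole_model n v (Complex (2 * Re v + (-1) * x) (Im v - \<theta>)) = - pole_model n v (Complex x (Im v + \<theta>))" for x
  proof -
    have "Complex (2 * Re v + (-1) * x) (Im v - \<theta>) = 2 * v - Complex x (Im v + \<theta>)" by (simp add: complex_eq_iff)
    then show ?thesis by (simp only: pole_model_odd)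
  qed
  show "integrable lborel (\<lambda>x. pole_model n v (Complex x (Im v - \<theta>)))"
    using lborel_integrable_real_affine_iff[of "-1" "\<lambda>x. pole_model n v (Complex x (Im v - \<theta>))" "2 * Re v"]
      pole_model_above(1)[OF assms] unfolding eq by simp
  show "(\<integral>x. pole_model n v (Complex x (Im v - \<theta>)) \<partial>lborel) = - (\<i> * pi / n)"
    using lborel_integral_real_affine[of "-1" "\<lambda>x. pole_model n v (Complex x (Im v - \<theta>))" "2 * Re v"]
      pole_model_above(2)[OF assms] unfolding eq by simp
qed

text \<open>Subtracting e(v - t) times the model removes the pole at \<open>v\<close>, and what
  remains has equal integrals on both lines. The model contributes i pi/n above and -i pi/n below.
  The bounds on \<delta> keep further poles out of the strip and the kernel inside its
  domain.\<close>

lemma line_laplace_jump: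
  assumes e: "flat \<kappa> \<alpha> e" and \<kappa>: "0 < \<kappa>" and n: "0 < n" and v: "c * exp (of_real n * v) = 1"
    and \<delta>: "0 < \<delta>" "\<delta> \<le> pi / (2 * n)" "\<bar>Im t - Im v\<bar> + \<delta> \<le> \<alpha>"
    and dp: "Im v < dp" "dp < Im v + \<delta>" and dm: "Im v - \<delta> < dm" "dm < Im v"
  shows "line_laplace e (geometric n c) dp t - line_laplace e (geometric n c) dm t
      = 2 * of_real pi * \<i> / of_real n * e (v - t)"
proof -
  define X where "X = (\<lambda>w. exp (of_real n * (w - v)))"
  let ?S = "hstrip (Im v - \<delta>) (Im v + \<delta>)"
  have geo: "geometric n c w = 1 / (1 - X w)" for w
  proof -
    have "c * exp (of_real n * w) = c * exp (of_real n * v) * X w"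
      by (simp add: X_def mult.assoc flip: exp_add) (simp add: algebra_simps)
    then show ?thesis by (simp add: geometric_def v)
  qed
  have pm: "pole_model n v w = 2 * X w / (1 - (X w)\<^sup>2)" for w by (simp add: pole_model_def X_def)
  \<comment> \<open>Numerator and denominator of the difference over the common denominator 1 - X^2
    = (1 - X)(1 + X). Both vanish at \<open>v\<close>, the denominator simply, so dividing each by w
    - v exhibits a holomorphic quotient.\<close>
  define N where "N = (\<lambda>w. e (w - t) * (1 + X w) - e (v - t) * (2 * X w))"
  define D where "D = (\<lambda>w. 1 - (X w)\<^sup>2)"
  have Xv: "X v = 1" by (simp add: X_def)
  have e_hol: "e holomorphic_on hstrip (- \<alpha>) \<alpha>" using e by (simp add: flat_def)
  have et: "(\<lambda>w. e (w - t)) holomorphic_on ?S"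
  proof -
    have "(e \<circ> (\<lambda>w. w - t)) holomorphic_on ?S"
      by (rule holomorphic_on_compose_gen[OF _ e_hol])
         (use \<delta>(3) in \<open>auto simp: hstrip_def intro!: holomorphic_intros\<close>)
    then show ?thesis by (simp add: o_def)
  qed
  have N: "N holomorphic_on ?S" unfolding N_def X_def by (intro holomorphic_intros et)
  have D: "D holomorphic_on ?S" unfolding D_def X_def by (intro holomorphic_intros)
  have D0: "w = v" if w: "w \<in> ?S" "D w = 0" for w
  proof -
    have "(exp (of_real n * (w - v)))\<^sup>2 = 1" using w(2) by (simp add: D_def X_def)
    then obtain m where m: "Re w = Re v" "n * (Im w - Im v) = of_int m * pi" using exp_square_eq_1[OF n] by metis
    have "\<bar>Im w - Im v\<bar> < pi / (2 * n)" using w(1) \<delta>(2) by (auto simp: hstrip_def)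
    then have "n * \<bar>Im w - Im v\<bar> < pi / 2" using n by (simp add: field_simps)
    moreover have "n * \<bar>Im w - Im v\<bar> = \<bar>of_int m\<bar> * pi"
      using m(2) n by (metis abs_mult abs_of_pos pi_gt_zero)
    ultimately have "\<bar>real_of_int m\<bar> * pi < 1 * pi" using pi_gt_zero by linarith
    then have "\<bar>real_of_int m\<bar> < 1" using pi_gt_zero by simp
    then have "m = 0" by linarith
    then show ?thesis using m n by (simp add: complex_eq_iff)
  qed
  define N' where "N' = (\<lambda>w. if w = v then deriv N v else (N w - N v) / (w - v))"
  define D' where "D' = (\<lambda>w. if w = v then deriv D v else (D w - D v) / (w - v))"
  have N': "N' holomorphic_on ?S" unfolding N'_def by (rule pole_lemma_open[OF N open_hstrip])
  have D': "D' holomorphic_on ?S" unfolding D'_def by (rule pole_lemma_open[OF D open_hstrip])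
  have "(D has_field_derivative (- 2 * of_real n)) (at v)"
    unfolding D_def X_def by (auto intro!: derivative_eq_intros)
  then have dD: "deriv D v = - 2 * of_real n" by (rule DERIV_imp_deriv)
  have D'0: "D' w \<noteq> 0" if "w \<in> ?S" for w
  proof (cases "w = v")
    case True
    then show ?thesis using n by (simp add: D'_def dD)
  next
    case False
    then have "D w \<noteq> 0" using D0[OF that] by blast
    moreover have "D v = 0" by (simp add: D_def Xv)
    ultimately show ?thesis using False by (simp add: D'_def)
  qed
  define H where "H = (\<lambda>w. N' w / D' w)"
  have H_hol: "H holomorphic_on ?S" unfolding H_def using N' D' D'0 by (intro holomorphic_intros) auto
  have H_eq: "H w = e (w - t) * geometric n c w - e (v - t) * pole_model n v w" if w: "w \<in> ?S" "w \<noteq> v" for w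
  proof -
    have "D w \<noteq> 0" using D0 w by blast
    moreover have DX: "D w = (1 - X w) * (1 + X w)" by (simp add: D_def power2_eq_square algebra_simps)
    ultimately have X1: "1 - X w \<noteq> 0" "1 + X w \<noteq> 0" by (metis mult_eq_0_iff)+
    have "N v = 0" "D v = 0" by (simp_all add: N_def D_def Xv)
    then have "H w = N w / D w" using w(2) by (simp add: H_def N'_def D'_def)
    also have "\<dots> = e (w - t) * (1 + X w) / ((1 - X w) * (1 + X w)) - e (v - t) * (2 * X w) / D w"
      by (simp add: N_def diff_divide_distrib DX)
    also have "\<dots> = e (w - t) * geometric n c w - e (v - t) * pole_model n v w"
      using X1 by (simp add: geo pm D_def)
    finally show ?thesis .
  qed
  have one: "moderate 0 (Im v - \<delta>) (Im v + \<delta>) (\<lambda>w. 1)"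
    unfolding moderate_def by (auto intro!: exI[of _ 1])
  have edec: "decaying (Im v - \<delta>) (Im v + \<delta>) (\<lambda>w. e (w - t))"
  proof -
    have "max (Im v - \<delta>) (Im t - \<alpha>) = Im v - \<delta>" "min (Im v + \<delta>) (Im t + \<alpha>) = Im v + \<delta>"
      using \<delta>(3) by auto
    with decaying_flat_mult_moderate[OF e one \<kappa>, of t] show ?thesis by simp
  qed
  have H_dec: "decaying (Im v - \<delta>) (Im v + \<delta>) H"
  proof (rule decaying_from_tail[OF H_hol])
    fix a' b' assume ab: "Im v - \<delta> < a'" "b' < Im v + \<delta>"
    obtain A \<epsilon> where A: "A > 0" "\<epsilon> > 0" "\<And>w. a' \<le> Im w \<Longrightarrow> Im w \<le> b' \<Longrightarrow> norm (e (w - t)) \<le> A * exp (- \<epsilon> * \<bar>Re w\<bar>)"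
      using decayingD[OF edec ab] by metis
    define s where "s = 1 / (1 - exp (- n))"
    have s: "0 < s" using n by (simp add: s_def)
    \<comment> \<open>The slower of the two rates: that of the kernel and that of the model.\<close>
    define \<zeta> where "\<zeta> = min \<epsilon> n"
    have \<zeta>: "0 < \<zeta>" using A n by (simp add: \<zeta>_def)
    have mono: "exp (- \<epsilon> * \<bar>x\<bar>) \<le> exp (- \<zeta> * \<bar>x\<bar>)" "exp (- n * \<bar>x\<bar>) \<le> exp (- \<zeta> * \<bar>x\<bar>)" for x :: real
      by (auto simp: \<zeta>_def mult_right_mono)
    show "\<exists>A \<delta> R. 0 < \<delta> \<and> (\<forall>w. a' \<le> Im w \<and> Im w \<le> b' \<and> R \<le> \<bar>Re w\<bar> \<longrightarrow> norm (H w) \<le> A * exp (- \<delta> * \<bar>Re w\<bar>))"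
    proof (rule exI[of _ "A * s + norm (e (v - t)) * (2 * s * exp (n * \<bar>Re v\<bar>))"], rule exI[of _ \<zeta>],
        rule exI[of _ "\<bar>Re v\<bar> + 1"], intro conjI allI impI \<zeta>)
      fix w assume w: "a' \<le> Im w \<and> Im w \<le> b' \<and> \<bar>Re v\<bar> + 1 \<le> \<bar>Re w\<bar>"
      then have tail: "1 \<le> \<bar>Re w - Re v\<bar>" by linarith
      have "w \<noteq> v" "w \<in> ?S" using w ab by (auto simp: hstrip_def)
      then have "norm (H w) \<le> norm (e (w - t)) * norm (geometric n c w) + norm (e (v - t)) * norm (pole_model n v w)"
        using norm_triangle_ineq4[of "e (w - t) * geometric n c w" "e (v - t) * pole_model n v w"]
        by (simp add: H_eq norm_mult)
      also have "\<dots> \<le> (A * exp (- \<zeta> * \<bar>Re w\<bar>)) * s + norm (e (v - t)) * (2 * s * exp (n * \<bar>Re v\<bar>) * exp (- \<zeta> * \<bar>Re w\<bar>))"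
      proof (intro add_mono mult_mono order_refl)
        have "norm (e (w - t)) \<le> A * exp (- \<epsilon> * \<bar>Re w\<bar>)" using A(3) w by blast
        also have "\<dots> \<le> A * exp (- \<zeta> * \<bar>Re w\<bar>)" using mono(1) A(1) by (intro mult_left_mono) auto
        finally show "norm (e (w - t)) \<le> A * exp (- \<zeta> * \<bar>Re w\<bar>)" .
        show "norm (geometric n c w) \<le> s"
          unfolding geo s_def X_def by (rule exp_tail_bounds(1)[OF n tail])
        have "norm (pole_model n v w) \<le> 2 * s * exp (- n * \<bar>Re w - Re v\<bar>)"
          using exp_tail_bounds(2)[OF n tail] by (simp add: s_def)
        also have "\<dots> \<le> 2 * s * (exp (n * \<bar>Re v\<bar>) * exp (- \<zeta> * \<bar>Re w\<bar>))"
        proof (rule mult_left_mono)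
          have "exp (- n * \<bar>Re w - Re v\<bar>) \<le> exp (n * \<bar>Re v\<bar>) * exp (- n * \<bar>Re w\<bar>)" by (rule exp_shift_abs[OF n])
          also have "\<dots> \<le> exp (n * \<bar>Re v\<bar>) * exp (- \<zeta> * \<bar>Re w\<bar>)" by (intro mult_left_mono mono) simp
          finally show "exp (- n * \<bar>Re w - Re v\<bar>) \<le> exp (n * \<bar>Re v\<bar>) * exp (- \<zeta> * \<bar>Re w\<bar>)" .
        qed (use s in simp)
        finally show "norm (pole_model n v w) \<le> 2 * s * exp (n * \<bar>Re v\<bar>) * exp (- \<zeta> * \<bar>Re w\<bar>)"
          by (simp only: mult.assoc)
      qed (use A s in auto)
      finally show "norm (H w) \<le> (A * s + norm (e (v - t)) * (2 * s * exp (n * \<bar>Re v\<bar>))) * exp (- \<zeta> * \<bar>Re w\<bar>)"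
        by (simp add: algebra_simps)
    qed
  qed
  have pn: "\<delta> < pi / n" 
  proof -
    have "pi / (2 * n) < pi / n" using n by (intro divide_strict_left_mono) auto
    then show ?thesis using \<delta>(2) by linarith
  qed
  have line: "line_laplace e (geometric n c) d t = (\<integral>x. H (Complex x d) \<partial>lborel) + e (v - t) * I"
    if d: "Im v - \<delta> < d" "d < Im v + \<delta>" "d \<noteq> Im v"
      and i: "integrable lborel (\<lambda>x. pole_model n v (Complex x d))"
      and I: "(\<integral>x. pole_model n v (Complex x d) \<partial>lborel) = I" for d I
  proof -
    have "Complex x d \<in> ?S" "Complex x d \<noteq> v" for x using d by (auto simp: hstrip_def)
    then have "e (Complex x d - t) * geometric n c (Complex x d) = H (Complex x d) + e (v - t) * pole_model n v (Complex x d)" for x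
      by (simp add: H_eq)
    then have "line_laplace e (geometric n c) d t = (\<integral>x. H (Complex x d) + e (v - t) * pole_model n v (Complex x d) \<partial>lborel)"
      by (simp add: line_laplace_def)
    also have "\<dots> = (\<integral>x. H (Complex x d) \<partial>lborel) + e (v - t) * I"
      using i I decaying_integrable[OF H_dec d(1,2)] by simp
    finally show ?thesis .
  qed
  have Lp: "line_laplace e (geometric n c) dp t = (\<integral>x. H (Complex x dp) \<partial>lborel) + e (v - t) * (\<i> * pi / n)"
    using pole_model_above[OF n, of "dp - Im v" v] dp pn \<delta>(1) by (intro line) auto
  have Lm: "line_laplace e (geometric n c) dm t = (\<integral>x. H (Complex x dm) \<partial>lborel) + e (v - t) * (- (\<i> * pi / n))"
    using pole_model_below[OF n, of "Im v - dm" v] dm pn \<delta>(1) by (intro line) auto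
  have "(\<integral>x. H (Complex x dp) \<partial>lborel) = (\<integral>x. H (Complex x dm) \<partial>lborel)"
    by (rule line_integral_shift[OF H_dec]) (use dp dm \<delta>(1) in auto)
  then show ?thesis unfolding Lp Lm by (simp add: algebra_simps)
qed

section \<open>The singular directions\<close>

lemma fact_add_le: "fact (a + b) \<le> (fact a * (a + b) ^ b :: nat)"
proof (induction b)
  case (Suc b)
  have "fact (a + Suc b) = (a + Suc b) * fact (a + b)" by simp
  also have "\<dots> \<le> (a + Suc b) * (fact a * (a + b) ^ b)" using Suc.IH by (rule mult_left_mono) simp
  also have "\<dots> \<le> (a + Suc b) * (fact a * (a + Suc b) ^ b)"
    by (intro mult_left_mono power_mono) auto
  finally show ?case by (simp add: mult_ac)
qed simp

lemma fact_add_ge: "fact a * (a + 1) ^ b \<le> (fact (a + b) :: nat)"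
proof (induction b)
  case (Suc b)
  have "fact a * (a + 1) ^ Suc b = (a + 1) * (fact a * (a + 1) ^ b)" by (simp add: algebra_simps)
  also have "\<dots> \<le> (a + Suc b) * fact (a + b)" using Suc.IH by (intro mult_mono) auto
  finally show ?case by (simp add: algebra_simps)
qed simp

text \<open>The quotient of (k j)! by the k-th power of j! is a multinomial coefficient, hence at
  most k^(k j). In the induction the new factor is at most (k (j+1))^k.\<close>

lemma fact_mult_le: "fact (k * j) \<le> (fact j ^ k * k ^ (k * j) :: nat)"
proof (induction j)
  case (Suc j)
  have "fact (k * Suc j) = (fact (k * j + k) :: nat)" by (simp add: add.commute)
  also have "\<dots> \<le> fact (k * j) * (k * j + k) ^ k" by (rule fact_add_le)
  also have "\<dots> \<le> (fact j ^ k * k ^ (k * j)) * (k * j + k) ^ k" by (intro mult_right_mono Suc.IH) simp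
  also have "k * j + k = k * Suc j" by simp
  also have "(fact j ^ k * k ^ (k * j)) * (k * Suc j) ^ k = fact (Suc j) ^ k * k ^ (k * Suc j)"
  proof -
    have 1: "k ^ (k * Suc j) = k ^ (k * j) * k ^ k" by (simp add: power_add)
    have 2: "fact (Suc j) ^ k = (Suc j ^ k * fact j ^ k :: nat)" by (simp only: fact_Suc power_mult_distrib of_nat_id)
    show ?thesis unfolding 1 2 power_mult_distrib by (simp only: mult_ac)
  qed
  finally show ?case .
qed simp

lemma borel_coefficient_ge:
  assumes "k \<ge> 1"
  shows "(1 / real k ^ k) ^ j \<le> fact j ^ k / fact (k * j)"
proof -
  have "real (fact (k * j)) \<le> real (fact j ^ k * k ^ (k * j))" by (intro of_nat_mono fact_mult_le)
  then have G: "fact (k * j) \<le> fact j ^ k * (real k ^ k) ^ j" by (simp add: power_mult)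
  define X where "X = (real k ^ k) ^ j"
  have "0 < X" using assms by (simp add: X_def)
  then show ?thesis
    using G unfolding power_one_over X_def[symmetric] by (simp add: pos_le_divide_eq pos_divide_le_eq mult.commute)
qed

text \<open>By \<open>fact_add_ge\<close> the ratio of consecutive coefficients is at most ((j+1) /
  (k j + 1))^k, which tends to k^(-k).\<close>

lemma borel_coefficient_summable:
  assumes k: "k \<ge> 1" and y: "0 \<le> y" "y < real k ^ k"
  shows "summable (\<lambda>j. fact j ^ k / fact (k * j) * y ^ j)"
proof -
  \<comment> \<open>The midpoint between the limiting ratio and 1.\<close>
  define c where "c = (1 + y / real k ^ k) / 2"
  have c: "y / real k ^ k < c" "c < 1" using y k by (auto simp: c_def field_simps)
  have "(\<lambda>j. (real j + 1) / (real k * real j + 1)) \<longlonglongrightarrow> inverse (real k)"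
    using k by real_asymp
  then have "(\<lambda>j. ((real j + 1) / (real k * real j + 1)) ^ k * y) \<longlonglongrightarrow> inverse (real k) ^ k * y"
    by (intro tendsto_intros)
  moreover have "inverse (real k) ^ k * y < c" using c by (simp add: power_inverse divide_inverse mult.commute)
  ultimately have "eventually (\<lambda>j. ((real j + 1) / (real k * real j + 1)) ^ k * y < c) sequentially"
    by (rule order_tendstoD)
  then obtain M where M: "\<And>j. j \<ge> M \<Longrightarrow> ((real j + 1) / (real k * real j + 1)) ^ k * y < c"
    by (auto simp: eventually_sequentially)
  show ?thesis
  proof (rule summable_ratio_test[OF c(2)])
    fix j assume "M \<le> j"
    have "real (fact (k * j) * (k * j + 1) ^ k) \<le> real (fact (k * j + k))" by (intro of_nat_mono fact_add_ge)
    then have f: "fact (k * j) * (real k * real j + 1) ^ k \<le> fact (k * Suc j)" by (simp add: add_ac)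
    have pos: "0 < (real k * real j + 1) ^ k" by (intro zero_less_power add_nonneg_pos) auto
    have "fact (Suc j) ^ k / fact (k * Suc j) * y ^ Suc j \<le> fact (Suc j) ^ k / (fact (k * j) * (real k * real j + 1) ^ k) * y ^ Suc j"
      using f pos y by (intro mult_right_mono divide_left_mono mult_pos_pos) auto
    also have "\<dots> = (((real j + 1) / (real k * real j + 1)) ^ k * y) * (fact j ^ k / fact (k * j) * y ^ j)"
    proof -
      have "fact (Suc j) ^ k = (real j + 1) ^ k * (fact j ^ k :: real)"
        by (simp add: power_mult_distrib[symmetric] algebra_simps)
      then show ?thesis by (simp only: power_Suc power_divide times_divide_eq_left times_divide_eq_right divide_divide_eq_left mult_ac)
    qed
    also have "\<dots> \<le> c * (fact j ^ k / fact (k * j) * y ^ j)"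
      using M[OF \<open>M \<le> j\<close>] y by (intro mult_right_mono) auto
    finally show "norm (fact (Suc j) ^ k / fact (k * Suc j) * y ^ Suc j) \<le> c * norm (fact j ^ k / fact (k * j) * y ^ j)"
      using y by (simp del: fact_Suc mult_Suc_right)
  qed
qed

text \<open>On the ray through the pole the Borel transform is a power series with positive coefficients
  that diverges at the finite radius of convergence, so it has no continuation across that point.\<close>

lemma not_continuable_lacunary:
  assumes n: "n \<ge> 1" and k: "k \<ge> 1" and c: "c \<noteq> 0"
    and ray: "\<And>x. c * exp (of_nat n * Complex x d) = of_real (norm c * exp (real n * x))"
    and z: "z \<in> cball 0 \<rho>" "\<phi> z \<noteq> 0"
  shows "\<not> continuable \<rho> \<kappa> d (lacunary n \<phi> (\<lambda>j. c ^ j * (fact j ^ k / fact (k * j))))"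
proof
  let ?b = "\<lambda>j. c ^ j * (fact j ^ k / fact (k * j))"
  assume "continuable \<rho> \<kappa> d (lacunary n \<phi> ?b)"
  then obtain v \<alpha> where \<alpha>: "0 < \<alpha>" and v: "v \<in> continuations \<rho> \<kappa> d \<alpha> (lacunary n \<phi> ?b)"
    unfolding continuable_def by blast
  have n0: "0 < real n" using n by simp
  \<comment> \<open>The radius of convergence in the variable X = s^n.\<close>
  define L where "L = real k ^ k / norm c"
  define g where "g = (\<lambda>w. \<Sum>j. ?b j * exp (of_real (real n) * w) ^ j)"
  have L: "0 < L" using k c by (simp add: L_def)
  have g: "exp_series (real n) L ?b g"
    unfolding exp_series_def
  proof (intro allI impI)
    fix w :: complex assume w: "norm (exp (of_real (real n) * w)) < L"
    define X where "X = exp (of_real (real n) * w)"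
    have "norm c * norm X < real k ^ k" using w c by (simp add: L_def X_def field_simps)
    then have "summable (\<lambda>j. fact j ^ k / fact (k * j) * (norm c * norm X) ^ j)"
      by (intro borel_coefficient_summable[OF k]) auto
    moreover have "norm (?b j * X ^ j) = fact j ^ k / fact (k * j) * (norm c * norm X) ^ j" for j
      by (simp add: norm_mult norm_divide norm_power power_mult_distrib mult_ac)
    ultimately have "summable (\<lambda>j. norm (?b j * X ^ j))" by simp
    then have "summable (\<lambda>j. ?b j * X ^ j)" by (rule summable_norm_cancel)
    then show "(\<lambda>j. ?b j * exp (of_real (real n) * w) ^ j) sums g w"
      unfolding g_def X_def by (rule summable_sums)
  qed
  obtain r where r: "0 < r" "\<And>w. w \<in> sector d \<alpha> r \<Longrightarrow> v w z = \<phi> z * g w"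
    using continuations_lacunary_near_0[OF v z(1) n g L] by metis
  define x0 where "x0 = ln L / real n"
  have x0: "exp (real n * x0) = L" using L n by (simp add: x0_def)
  have nL: "norm (exp (of_real (real n) * w)) < L \<longleftrightarrow> Re w < x0" for w
    unfolding x0[symmetric] using n by simp
  \<comment> \<open>The part of the sector inside the disc of convergence; it is convex, so the
    identity theorem carries the agreement from near the origin up to its boundary.\<close>
  define T where "T = unbounded_sector d \<alpha> \<inter> {w. Re w < x0}"
  have vhol: "(\<lambda>w. v w z) holomorphic_on unbounded_sector d \<alpha>" by (rule continuations_holomorphic[OF v z(1)])
  have vg: "v w z = \<phi> z * g w" if w: "w \<in> T" for w
  proof (rule analytic_continuation_open[of "sector d \<alpha> (min r (exp x0))" T "\<lambda>w. v w z" "\<lambda>w. \<phi> z * g w"])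
    show "sector d \<alpha> (min r (exp x0)) \<noteq> {}" using r(1) by (intro sector_nonempty[OF \<alpha>]) simp
    show "open T" unfolding T_def unbounded_sector_hstrip by (intro open_Int open_hstrip open_halfspace_Re_lt)
    show "connected T" unfolding T_def unbounded_sector_hstrip
      by (intro convex_connected convex_Int convex_hstrip convex_halfspace_Re_lt)
    show "sector d \<alpha> (min r (exp x0)) \<subseteq> T" by (auto simp: T_def sector_def)
    show "(\<lambda>w. v w z) holomorphic_on T" by (rule holomorphic_on_subset[OF vhol]) (auto simp: T_def)
    have "g holomorphic_on T"
      unfolding holomorphic_on_def field_differentiable_def
    proof
      fix w assume "w \<in> T"
      then have "norm (exp (of_real (real n) * w)) < L" unfolding nL by (simp add: T_def)
      note exp_series_has_field_derivative[OF g n0 this]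
      from has_field_derivative_at_within[OF this] show "\<exists>f'. (g has_field_derivative f') (at w within T)" by (rule exI)
    qed
    then show "(\<lambda>w. \<phi> z * g w) holomorphic_on T" by (intro holomorphic_intros)
    show "v w z = \<phi> z * g w" if "w \<in> sector d \<alpha> (min r (exp x0))" for w
      using r(2)[of w] that by (auto simp: sector_def)
  qed (use w open_sector in auto)
  \<comment> \<open>At distance \<open>s\<close> before the critical point the coefficients dominate
    those of the geometric series with sum 1 / (1 - e), and 1 - e is at most n s: the continuation
    would grow at least like |\<phi> z| / (n s).\<close>
  have blow: "norm (\<phi> z) \<le> norm (v (Complex (x0 - s) d) z) * (real n * s)" if s: "0 < s" for s
  proof -
    define y where "y = norm c * exp (real n * (x0 - s))"
    define e where "e = exp (- (real n * s))"
    have e: "0 < e" "e < 1" "1 - e \<le> real n * s"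
      using s n exp_ge_add_one_self[of "- (real n * s)"] by (auto simp: e_def)
    have ye: "y = real k ^ k * e"
    proof -
      have "exp (real n * (x0 - s)) = L * e" unfolding x0[symmetric] e_def by (simp add: exp_add[symmetric] algebra_simps)
      then show ?thesis using c by (simp add: y_def L_def)
    qed
    have w: "Complex (x0 - s) d \<in> T" using s \<alpha> by (simp add: T_def unbounded_sector_def)
    have "real k ^ k * e < real k ^ k * 1" using e k by (intro mult_strict_left_mono) auto
    then have y: "0 \<le> y" "y < real k ^ k" using e ye by auto
    note sm = borel_coefficient_summable[OF k y]
    have "?b j * exp (of_real (real n) * Complex (x0 - s) d) ^ j = of_real (fact j ^ k / fact (k * j) * y ^ j)" for j
    proof -
      have "?b j * exp (of_real (real n) * Complex (x0 - s) d) ^ j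
          = (fact j ^ k / fact (k * j)) * (c * exp (of_nat n * Complex (x0 - s) d)) ^ j"
        by (simp add: power_mult_distrib)
      also have "\<dots> = of_real (fact j ^ k / fact (k * j) * y ^ j)" unfolding ray y_def by simp
      finally show ?thesis .
    qed
    then have "g (Complex (x0 - s) d) = (\<Sum>j. of_real (fact j ^ k / fact (k * j) * y ^ j))"
      unfolding g_def by (rule suminf_cong)
    also have "\<dots> = of_real (\<Sum>j. fact j ^ k / fact (k * j) * y ^ j)"
      by (rule suminf_of_real[OF sm, symmetric])
    finally have "g (Complex (x0 - s) d) = of_real (\<Sum>j. fact j ^ k / fact (k * j) * y ^ j)" .
    moreover have "1 / (1 - e) \<le> (\<Sum>j. fact j ^ k / fact (k * j) * y ^ j)"
    proof -
      have ge: "summable (\<lambda>j. e ^ j)" "(\<Sum>j. e ^ j) = 1 / (1 - e)"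
        using e by (auto intro!: summable_geometric suminf_geometric)
      have "e ^ j \<le> fact j ^ k / fact (k * j) * y ^ j" for j
      proof -
        have "e ^ j = (1 / real k ^ k) ^ j * y ^ j" using k by (simp add: ye flip: power_mult_distrib)
        also have "\<dots> \<le> fact j ^ k / fact (k * j) * y ^ j"
          using borel_coefficient_ge[OF k] y by (intro mult_right_mono) auto
        finally show ?thesis .
      qed
      then show ?thesis using suminf_le[OF _ ge(1) sm] ge(2) by simp
    qed
    ultimately have "1 / (1 - e) \<le> norm (g (Complex (x0 - s) d))" by simp
    then have "norm (\<phi> z) * (1 / (1 - e)) \<le> norm (v (Complex (x0 - s) d) z)"
      unfolding vg[OF w] norm_mult by (rule mult_left_mono) simp
    then have "norm (\<phi> z) \<le> norm (v (Complex (x0 - s) d) z) * (1 - e)"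
      using e by (simp add: field_simps)
    also have "\<dots> \<le> norm (v (Complex (x0 - s) d) z) * (real n * s)"
      using e by (intro mult_left_mono) auto
    finally show ?thesis .
  qed
  have "isCont (\<lambda>w. v w z) (Complex x0 d)"
  proof -
    have "Complex x0 d \<in> unbounded_sector d \<alpha>" using \<alpha> by (simp add: unbounded_sector_def)
    then show ?thesis
      using holomorphic_on_imp_continuous_on[OF vhol] unfolding unbounded_sector_hstrip
      by (simp add: continuous_on_eq_continuous_at)
  qed
  then have "\<exists>\<delta>>0. \<forall>w. dist w (Complex x0 d) < \<delta> \<longrightarrow> dist (v w z) (v (Complex x0 d) z) < 1"
    unfolding continuous_at_eps_delta by (rule allE[of _ 1]) simp
  then obtain \<delta> where \<delta>: "0 < \<delta>" "\<And>w. dist w (Complex x0 d) < \<delta> \<Longrightarrow> dist (v w z) (v (Complex x0 d) z) < 1"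
    by blast
  define B where "B = norm (v (Complex x0 d) z) + 1"
  have B: "0 < B" by (simp add: B_def add_nonneg_pos)
  \<comment> \<open>Small enough for the continuity bound \<open>B\<close>, and for the blow-up
    estimate to yield |\<phi> z| at most half of itself.\<close>
  define s where "s = min (\<delta> / 2) (norm (\<phi> z) / (2 * B * real n))"
  have s: "0 < s" "s < \<delta>" "s \<le> norm (\<phi> z) / (2 * B * real n)" using \<delta>(1) B n z by (auto simp: s_def min_less_iff_disj)
  have "dist (Complex (x0 - s) d) (Complex x0 d) = s" using s(1) by (simp add: dist_norm cmod_def)
  then have "dist (v (Complex (x0 - s) d) z) (v (Complex x0 d) z) < 1" using \<delta>(2) s(2) by simp
  then have "norm (v (Complex (x0 - s) d) z) \<le> B"
    using norm_triangle_ineq2[of "v (Complex (x0 - s) d) z" "v (Complex x0 d) z"] by (simp add: B_def dist_norm)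
  then have "norm (v (Complex (x0 - s) d) z) * (real n * s) \<le> B * (real n * s)"
    using s(1) by (intro mult_right_mono) auto
  then have "norm (\<phi> z) \<le> B * (real n * s)" using blow[OF s(1)] by linarith
  also have "\<dots> \<le> B * (real n * (norm (\<phi> z) / (2 * B * real n)))"
    using s(3) B by (intro mult_left_mono) auto
  also have "\<dots> = norm (\<phi> z) / 2" using B n by simp
  finally show False using z(2) by simp
qed

section \<open>The Cauchy problem\<close>

locale cauchy_problem =
  fixes p q :: nat and a :: complex and arga \<kappa> R \<rho> :: real
    and \<phi> :: "complex \<Rightarrow> complex" and u :: "nat \<Rightarrow> complex \<Rightarrow> complex"
  assumes p: "p \<ge> 2"
    and a: "a \<noteq> 0" "a = of_real (cmod a) * cis arga"
    and \<rho>: "0 < \<rho>" "\<rho> < R"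
    and \<phi>: "\<phi> holomorphic_on ball 0 R"
    and u: "formal_solution p q a R \<phi> u"
    and \<kappa>: "\<kappa> = (real q + 1) / (real p - 1)"
begin

definition n :: real where "n = real q + 1"
definition k :: nat where "k = p - 1"
definition c :: complex where "c = a * (of_nat q + 1) ^ k"
definition m :: "complex \<Rightarrow> complex" where "m = (\<lambda>x. Gamma (1 + x / (of_nat q + 1)) ^ k)"
text \<open>After i steps the product kernel carries i + 1 Gamma factors, so \<open>p - 2\<close>
  steps give the exponent k = p - 1 of \<open>m\<close>.\<close>

definition K :: "complex \<Rightarrow> complex" where "K = product_kernel n \<kappa> (p - 2)"
definition G :: "complex \<Rightarrow> complex" where "G = product_function n (p - 2) (geometric n c)"

lemma n_pos: "0 < n" and n_Suc: "n = real (Suc q)" and k_pos: "k \<ge> 1" and Suc_p: "Suc (p - 2) = k"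
  and real_k: "real p - 1 = real k" and n_complex: "of_real n = (of_nat q + 1 :: complex)"
  using p by (auto simp: n_def k_def)

lemma \<kappa>_eq: "\<kappa> = n / real k"
  unfolding \<kappa> n_def real_k ..

lemma \<kappa>_pos: "0 < \<kappa>"
  unfolding \<kappa>_eq using n_pos k_pos by simp

lemma kappa_opening: "pi * (real p - 1) / (real q + 1) = pi / \<kappa>"
  unfolding \<kappa>_eq n_def real_k by simp

lemma c_nz: "c \<noteq> 0"
  using a n_pos unfolding c_def n_complex[symmetric] by simp

lemma norm_c: "norm c = norm a * n ^ k"
  unfolding c_def n_complex[symmetric] using n_pos by (simp add: norm_mult norm_power)

lemma c_polar: "c = of_real (norm c) * cis arga"
proof -
  have "c = of_real (norm a) * cis arga * of_real n ^ k"
    unfolding c_def n_complex[symmetric] using a(2) by simp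
  then show ?thesis unfolding norm_c by simp
qed

lemma K_flat: "flat \<kappa> (pi / (2 * \<kappa>)) K"
  unfolding K_def by (rule flat_product_kernel[OF \<kappa>_pos n_pos])

lemma kernel_m: "\<bar>Im w\<bar> < pi / \<kappa> / 2 \<Longrightarrow> kernel_fun \<kappa> m w = K w"
  using kernel_fun_eq_product_kernel[OF n_pos, of \<kappa> "p - 2" w]
  unfolding m_def K_def n_complex Suc_p by (simp add: \<kappa>_eq)

lemma kernel_Gamma:
  assumes "\<bar>Im w\<bar> < pi / \<kappa> / 2"
  shows "kernel_fun \<kappa> (Gamma_moment \<kappa>) w = stretched_kernel \<kappa> w"
proof -
  have "Gamma_moment \<kappa> = (\<lambda>u. Gamma (1 + u / of_real \<kappa>) ^ Suc 0)"
    by (simp add: fun_eq_iff Gamma_moment_def)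
  then show ?thesis using kernel_fun_eq_product_kernel[OF \<kappa>_pos, of \<kappa> 0 w] assms by simp
qed

lemma \<phi>_disc: "\<phi> \<in> disc_space \<rho>"
  unfolding disc_space_def using \<rho>
  by (auto intro!: holomorphic_on_subset[OF \<phi>] holomorphic_on_imp_continuous_on)

text \<open>At N = (q+1) j the moment is the k-th power of j!, cancelling the factorials of the
  formal solution and leaving a geometric series.\<close>

lemma borel_m:
  assumes "z \<in> cball 0 \<rho>"
  shows "moment_borel m u N z = lacunary (Suc q) \<phi> (\<lambda>j. c ^ j) N z"
proof -
  have z: "z \<in> ball 0 R" using assms \<rho> by auto
  have uN: "u N z = lacunary (Suc q) \<phi> (\<lambda>j. c ^ j * fact j ^ k) N z"
    using formal_solution_lacunary[OF u z, of N] p by (simp add: c_def k_def add.commute)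
  show ?thesis
  proof (cases "Suc q dvd N")
    case True
    then obtain j where j: "N = Suc q * j" by blast
    have "of_nat N / (of_nat q + 1 :: complex) = of_nat j"
      unfolding j of_nat_mult by (simp add: add.commute flip: n_complex) (use n_pos n_complex in \<open>auto simp: field_simps\<close>)
    then have "m (of_nat N) = fact j ^ k" by (simp add: m_def Gamma_fact)
    then show ?thesis unfolding moment_borel_def uN by (simp add: lacunary_def j del: mult_Suc)
  qed (simp add: moment_borel_def uN lacunary_def)
qed

text \<open>At N = (q+1) j the moment Gamma(1 + N/\<kappa>) is (k j)!, so the quotient of factorials
  remains in the coefficients.\<close>

lemma borel_Gamma:
  assumes "z \<in> cball 0 \<rho>"
  shows "moment_borel (Gamma_moment \<kappa>) u N z = lacunary (Suc q) \<phi> (\<lambda>j. c ^ j * (fact j ^ k / fact (k * j))) N z"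
proof -
  have z: "z \<in> ball 0 R" using assms \<rho> by auto
  have uN: "u N z = lacunary (Suc q) \<phi> (\<lambda>j. c ^ j * fact j ^ k) N z"
    using formal_solution_lacunary[OF u z, of N] p by (simp add: c_def k_def add.commute)
  show ?thesis
  proof (cases "Suc q dvd N")
    case True
    then obtain j where j: "N = Suc q * j" by blast
    have "of_nat N / of_real \<kappa> = (of_nat (k * j) :: complex)"
      unfolding j of_nat_mult \<kappa>_eq using n_pos k_pos unfolding n_Suc by (simp del: of_nat_Suc)
    then have "Gamma_moment \<kappa> (of_nat N) = fact (k * j)" by (simp add: Gamma_moment_def Gamma_fact flip: of_nat_mult)
    then show ?thesis unfolding moment_borel_def uN by (simp add: lacunary_def j del: mult_Suc)
  qed (simp add: moment_borel_def uN lacunary_def)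
qed

lemma continuable_borel_m:
  "continuable \<rho> \<kappa> d (moment_borel m u) = continuable \<rho> \<kappa> d (lacunary (Suc q) \<phi> (\<lambda>j. c ^ j))"
  "continuation \<rho> \<kappa> d (moment_borel m u) = continuation \<rho> \<kappa> d (lacunary (Suc q) \<phi> (\<lambda>j. c ^ j))"
  by (rule continuable_cong; rule borel_m; assumption)+

lemma continuable_borel_Gamma:
  "continuable \<rho> \<kappa> d (moment_borel (Gamma_moment \<kappa>) u)
    = continuable \<rho> \<kappa> d (lacunary (Suc q) \<phi> (\<lambda>j. c ^ j * (fact j ^ k / fact (k * j))))"
  "continuation \<rho> \<kappa> d (moment_borel (Gamma_moment \<kappa>) u)
    = continuation \<rho> \<kappa> d (lacunary (Suc q) \<phi> (\<lambda>j. c ^ j * (fact j ^ k / fact (k * j))))"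
  by (rule continuable_cong; rule borel_Gamma; assumption)+

lemma root_direction_eq: "root_direction q arga j = (2 * of_int j * pi - arga) / n"
  by (simp add: root_direction_def n_def)

lemma series_geometric: "exp_series (real (Suc q)) (1 / norm c) (\<lambda>j. c ^ j) (geometric n c)"
  unfolding n_Suc by (rule exp_series_geometric[OF c_nz])

lemma series_G: "exp_series (real (Suc q)) (1 / norm c) (\<lambda>j. c ^ j * (fact j ^ k / fact (k * j))) G"
  using exp_series_product_function[OF exp_series_geometric[OF c_nz] n_pos, of "p - 2"]
  unfolding G_def Suc_p unfolding n_Suc .

text \<open>A direction other than the root directions lies between two consecutive ones. There
  \<open>geometric\<close> is bounded, hence so is its image \<open>G\<close>, and both Borel
  transforms continue. All integrals reduce to one line integral, by
  \<open>pairing_product\<close>.\<close>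

lemma regular:
  assumes d: "\<And>j::int. d \<noteq> root_direction q arga j"
  shows "summable_in_direction \<rho> \<kappa> u d"
    and "continuable \<rho> \<kappa> d (moment_borel m u)"
    and "\<And>t z. z \<in> cball 0 \<rho> \<Longrightarrow> \<bar>Im t - d\<bar> < pi / \<kappa> / 2 \<Longrightarrow>
      sum_converges \<rho> \<kappa> u d t z \<and>
      laplace_converges \<kappa> m d (continuation \<rho> \<kappa> d (moment_borel m u)) t z \<and>
      ray_integrable d (\<lambda>s. kernel_fun \<kappa> m (s - t) * (\<phi> z / (1 - a * (of_nat q + 1) ^ (p - 1) * exp s ^ (q + 1)))) \<and>
      sum_in_direction \<rho> \<kappa> u d t z = \<phi> z * line_laplace K (geometric n c) d t \<and>
      moment_laplace \<kappa> m d (continuation \<rho> \<kappa> d (moment_borel m u)) t z = \<phi> z * line_laplace K (geometric n c) d t \<and>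
      ray_integral d (\<lambda>s. kernel_fun \<kappa> m (s - t) * (\<phi> z / (1 - a * (of_nat q + 1) ^ (p - 1) * exp s ^ (q + 1))))
        = \<phi> z * line_laplace K (geometric n c) d t"
    and "line_laplace K (geometric n c) d holomorphic_on hstrip (d - pi / (2 * \<kappa>)) (d + pi / (2 * \<kappa>))"
proof -
  obtain j where j: "(2 * of_int j * pi - arga) / n < d" "d < (2 * of_int (j + 1) * pi - arga) / n"
    using root_gap[OF n_pos, of d arga] d unfolding root_direction_eq by metis
  define lo where "lo = (2 * of_int j * pi - arga) / n"
  define hi where "hi = (2 * of_int (j + 1) * pi - arga) / n"
  have ld: "lo < d" "d < hi" using j by (simp_all add: lo_def hi_def)
  have v0: "moderate 0 lo hi (geometric n c)"
    unfolding lo_def hi_def by (rule moderate_geometric[OF n_pos c_polar])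
  have G: "moderate 0 lo hi G" unfolding G_def by (rule moderate_product_function[OF v0 order_refl n_pos])
  have L: "0 < 1 / norm c" using c_nz by simp
  have Sq: "Suc q \<ge> 1" by simp
  note C1 = continuation_lacunary[OF \<phi>_disc Sq series_G L G ld, where \<kappa> = \<kappa>]
  note C2 = continuation_lacunary[OF \<phi>_disc Sq series_geometric L v0 ld, where \<kappa> = \<kappa>]
  note cong1 = continuable_borel_Gamma[of d] and cong2 = continuable_borel_m[of d]
  show "summable_in_direction \<rho> \<kappa> u d"
    unfolding summable_in_direction_def cong1 by (rule C1)
  show "continuable \<rho> \<kappa> d (moment_borel m u)" unfolding cong2 by (rule C2)
  show "line_laplace K (geometric n c) d holomorphic_on hstrip (d - pi / (2 * \<kappa>)) (d + pi / (2 * \<kappa>))"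
    by (rule holomorphic_line_laplace[OF K_flat v0 \<kappa>_pos ld])
  fix t z :: complex assume z: "z \<in> cball 0 \<rho>" and t: "\<bar>Im t - d\<bar> < pi / \<kappa> / 2"
  have dt: "\<bar>d - Im t\<bar> < pi / (2 * \<kappa>)" using t by (simp add: abs_minus_commute mult.commute)
  have im: "\<bar>Im (Complex x d - t)\<bar> < pi / \<kappa> / 2" for x using t by (simp add: abs_minus_commute)
  have F1: "kernel_fun \<kappa> (Gamma_moment \<kappa>) (Complex x d - t) * continuation \<rho> \<kappa> d (moment_borel (Gamma_moment \<kappa>) u) (Complex x d) z
      = \<phi> z * (stretched_kernel \<kappa> (Complex x d - t) * G (Complex x d))" for x
    unfolding cong1 kernel_Gamma[OF im] using C1(2)[of "Complex x d" z] z by simp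
  have F2: "kernel_fun \<kappa> m (Complex x d - t) * continuation \<rho> \<kappa> d (moment_borel m u) (Complex x d) z
      = \<phi> z * (K (Complex x d - t) * geometric n c (Complex x d))" for x
    unfolding cong2 kernel_m[OF im] using C2(2)[of "Complex x d" z] z by simp
  have ex: "exp s ^ (q + 1) = exp (of_real n * s)" for s :: complex
    unfolding n_Suc by (simp only: exp_of_nat_mult of_real_of_nat_eq Suc_eq_plus1)
  have F3: "kernel_fun \<kappa> m (Complex x d - t) * (\<phi> z / (1 - a * (of_nat q + 1) ^ (p - 1) * exp (Complex x d) ^ (q + 1)))
      = \<phi> z * (K (Complex x d - t) * geometric n c (Complex x d))" for x
    unfolding ex kernel_m[OF im] geometric_def c_def k_def by simp
  note S1 = line_laplace_ray[OF flat_stretched_kernel[OF \<kappa>_pos] G \<kappa>_pos ld dt, OF F1]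
  note S2 = line_laplace_ray[OF K_flat v0 \<kappa>_pos ld dt, OF F2]
  note S3 = line_laplace_ray[OF K_flat v0 \<kappa>_pos ld dt, OF F3]
  have pair: "line_laplace (stretched_kernel \<kappa>) G d t = line_laplace K (geometric n c) d t"
    unfolding line_laplace_def G_def K_def
    by (rule pairing_product[OF v0 \<kappa>_pos order_refl n_pos ld dt, symmetric])
  show "sum_converges \<rho> \<kappa> u d t z \<and>
      laplace_converges \<kappa> m d (continuation \<rho> \<kappa> d (moment_borel m u)) t z \<and>
      ray_integrable d (\<lambda>s. kernel_fun \<kappa> m (s - t) * (\<phi> z / (1 - a * (of_nat q + 1) ^ (p - 1) * exp s ^ (q + 1)))) \<and>
      sum_in_direction \<rho> \<kappa> u d t z = \<phi> z * line_laplace K (geometric n c) d t \<and>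
      moment_laplace \<kappa> m d (continuation \<rho> \<kappa> d (moment_borel m u)) t z = \<phi> z * line_laplace K (geometric n c) d t \<and>
      ray_integral d (\<lambda>s. kernel_fun \<kappa> m (s - t) * (\<phi> z / (1 - a * (of_nat q + 1) ^ (p - 1) * exp s ^ (q + 1))))
        = \<phi> z * line_laplace K (geometric n c) d t"
    unfolding sum_converges_def laplace_converges_def sum_in_direction_def moment_laplace_def
    using S1 S2 S3 t pair by (simp only: simp_thms)
qed

section \<open>Singular directions and jumps of the formal solution\<close>

lemma singular_iff: "summable_in_direction \<rho> \<kappa> u d \<or> (\<exists>j. d = root_direction q arga j)"
  using regular(1)[of d] by blast

lemma root_direction_mod:
  "root_direction q arga j = root_direction q arga (j mod int (Suc q)) + 2 * pi * of_int (j div int (Suc q))"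
proof -
  have "real_of_int j = real_of_int (int (Suc q) * (j div int (Suc q)) + j mod int (Suc q))"
    by (simp only: mult_div_mod_eq)
  then have "real_of_int j = n * of_int (j div int (Suc q)) + of_int (j mod int (Suc q))"
    unfolding n_Suc by (simp only: of_int_add of_int_mult of_int_of_nat_eq)
  then show ?thesis unfolding root_direction_eq using n_pos by (simp add: field_simps)
qed

lemma kappa_summable: "kappa_summable \<rho> \<kappa> u"
  unfolding kappa_summable_def
proof (intro exI[of _ "root_direction q arga ` {0..int q}"] conjI allI impI)
  fix d assume "\<not> summable_in_direction \<rho> \<kappa> u d"
  then obtain j where j: "d = root_direction q arga j" using singular_iff by blast
  have "j mod int (Suc q) \<in> {0..int q}"
    using pos_mod_bound[of "int (Suc q)" j] pos_mod_sign[of "int (Suc q)" j]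
    unfolding atLeastAtMost_iff by linarith
  then show "\<exists>f\<in>root_direction q arga ` {0..int q}. \<exists>k::int. d = f + 2 * pi * of_int k"
    unfolding j using root_direction_mod[of j] by blast
qed simp

text \<open>Over a root direction c s^n is positive: the ray hits the pole of the geometric
  function, and the Borel series has positive terms there up to \<phi>.\<close>

lemma exp_root_direction: "c * exp (of_real n * Complex x (root_direction q arga j)) = of_real (norm c * exp (n * x))"
proof -
  have "exp (of_real n * Complex x (root_direction q arga j)) = of_real (exp (n * x)) * cis (n * root_direction q arga j)"
    by (simp add: exp_eq_polar)
  also have "n * root_direction q arga j = - arga + 2 * pi * of_int j"
    unfolding root_direction_eq using n_pos by simp
  also have "cis (- arga + 2 * pi * of_int j) = cis (- arga)"
    unfolding cis_mult[symmetric] by (simp add: cis_multiple_2pi)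
  finally have e: "exp (of_real n * Complex x (root_direction q arga j)) = of_real (exp (n * x)) * cis (- arga)" .
  have "c * (of_real (exp (n * x)) * cis (- arga)) = of_real (norm c * exp (n * x)) * (cis arga * cis (- arga))"
    by (subst c_polar) simp
  also have "cis arga * cis (- arga) = 1" by (simp add: cis_mult)
  finally show ?thesis unfolding e by simp
qed

lemma not_summable_root_direction:
  assumes "\<exists>z\<in>ball 0 R. \<phi> z \<noteq> 0"
  shows "\<not> summable_in_direction \<rho> \<kappa> u (root_direction q arga j)"
proof -
  \<comment> \<open>By the identity theorem \<phi> cannot vanish on the smaller disc without
    vanishing on the larger one.\<close>
  obtain z where z: "z \<in> ball 0 \<rho>" "\<phi> z \<noteq> 0"
  proof (rule ccontr)
    assume "\<not> thesis"
    then have "\<And>z. z \<in> ball 0 \<rho> \<Longrightarrow> \<phi> z = 0" using that by blast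
    moreover have "ball 0 \<rho> \<subseteq> (ball 0 R :: complex set)" using \<rho> by (intro subset_ball) auto
    ultimately have "\<phi> z = 0" if "z \<in> ball 0 R" for z
      using analytic_continuation_open[of "ball 0 \<rho>" "ball 0 R" \<phi> "\<lambda>_. 0" z] \<rho> \<phi> that by auto
    then show False using assms by blast
  qed
  have "\<not> continuable \<rho> \<kappa> (root_direction q arga j) (lacunary (Suc q) \<phi> (\<lambda>j. c ^ j * (fact j ^ k / fact (k * j))))"
  proof (rule not_continuable_lacunary[OF _ k_pos c_nz])
    fix x
    show "c * exp (of_nat (Suc q) * Complex x (root_direction q arga j)) = of_real (norm c * exp (real (Suc q) * x))"
      using exp_root_direction[of x j] unfolding n_Suc of_real_of_nat_eq .
  qed (use z in auto)
  then show ?thesis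
    unfolding summable_in_direction_def continuable_borel_Gamma .
qed

lemma exp_root_point: "c * exp (of_real n * root_point p q a arga j) = 1"
proof -
  define X where "X = cmod a powr (- (1 / n)) * n powr (- (real k / n))"
  have X: "0 < X" using a n_pos by (simp add: X_def)
  have e: "n * ln X = - (ln (cmod a) + real k * ln n)"
    using a n_pos by (simp add: X_def ln_mult ln_powr field_simps)
  have "exp (n * ln X) = inverse (cmod a * n ^ k)"
    unfolding e exp_minus exp_add exp_of_nat_mult using a n_pos by simp
  moreover have "root_point p q a arga j = Complex (ln X) (root_direction q arga j)"
    unfolding root_point_def cpoint_def X_def n_def real_k ..
  moreover have "norm c * inverse (cmod a * n ^ k) = 1" unfolding norm_c using a n_pos by (intro right_inverse) simp
  ultimately show ?thesis using exp_root_direction[of "ln X" j] by (simp only: of_real_1)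
qed

text \<open>Both sums are \<phi> times line integrals of the same kernel and geometric function, so
  \<open>line_laplace_jump\<close> applies at the root. The radius \<open>r\<close> is arbitrary
  because these integrals converge for every modulus of t.\<close>

lemma jump:
  assumes \<epsilon>: "0 < \<epsilon>"
  shows "has_jump \<rho> \<kappa> u (root_direction q arga j) (sector (root_direction q arga j) (pi / \<kappa> - \<epsilon>) r)
     (\<lambda>t z. 2 * of_real pi * \<i> * (\<phi> z / (of_nat q + 1)) * kernel_fun \<kappa> m (root_point p q a arga j - t))"
proof -
  let ?d = "root_direction q arga j" and ?v = "root_point p q a arga j"
  have v: "Im ?v = ?d" by (simp add: root_point_def cpoint_def)
  \<comment> \<open>The bound \<epsilon>/2 keeps \<open>t\<close> in the domain of both sums and of
    the kernel at every intermediate height; pi/(2n) excludes the other root directions, which are 2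
    pi/n apart, and the extra poles of the model.\<close>
  define \<delta> where "\<delta> = min (\<epsilon> / 2) (pi / (2 * n))"
  have \<delta>: "0 < \<delta>" "\<delta> \<le> \<epsilon> / 2" "\<delta> \<le> pi / (2 * n)" using \<epsilon> n_pos by (auto simp: \<delta>_def)
  have reg: "d \<noteq> root_direction q arga l" if d: "0 < \<bar>d - ?d\<bar>" "\<bar>d - ?d\<bar> < \<delta>" for d l
  proof
    assume l: "d = root_direction q arga l"
    have "d - ?d = 2 * pi * of_int (l - j) / n" unfolding l root_direction_eq
      by (simp add: diff_divide_distrib algebra_simps)
    then have "n * \<bar>d - ?d\<bar> = 2 * pi * \<bar>of_int (l - j)\<bar>" using n_pos by (simp add: abs_mult)
    moreover have "n * \<bar>d - ?d\<bar> < n * (pi / (2 * n))" using d(2) \<delta>(3) n_pos by (intro mult_strict_left_mono) auto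
    moreover have "n * (pi / (2 * n)) = pi / 2" using n_pos by simp
    ultimately have "2 * pi * \<bar>real_of_int (l - j)\<bar> < 2 * pi * 1" using pi_gt_zero by linarith
    then have "\<bar>real_of_int (l - j)\<bar> < 1" by simp
    then have "l = j" by linarith
    then show False using d(1) l by simp
  qed
  show ?thesis
    unfolding has_jump_def
  proof (intro exI[of _ \<delta>] conjI ballI \<delta>(1))
    fix dp dm assume dp: "dp \<in> {?d<..<?d + \<delta>}" and dm: "dm \<in> {?d - \<delta><..<?d}"
    have rp: "dp \<noteq> root_direction q arga l" for l by (rule reg) (use dp in auto)
    have rm: "dm \<noteq> root_direction q arga l" for l by (rule reg) (use dm in auto)
    show "summable_in_direction \<rho> \<kappa> u dp" "summable_in_direction \<rho> \<kappa> u dm"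
      using regular(1)[OF rp] regular(1)[OF rm] by auto
    fix t z :: complex assume t: "t \<in> sector ?d (pi / \<kappa> - \<epsilon>) r" and z: "z \<in> ball 0 \<rho>"
    have t': "\<bar>Im t - ?d\<bar> < pi / \<kappa> / 2 - \<epsilon> / 2"
      using t by (auto simp: sector_def unbounded_sector_def abs_less_iff diff_divide_distrib)
    have zc: "z \<in> cball 0 \<rho>" using z by simp
    have "\<bar>Im t - dp\<bar> < pi / \<kappa> / 2" "\<bar>Im t - dm\<bar> < pi / \<kappa> / 2" using t' \<delta>(2) dp dm by auto
    note P = regular(3)[OF rp zc this(1)] and M = regular(3)[OF rm zc this(2)]
    show "sum_converges \<rho> \<kappa> u dp t z" "sum_converges \<rho> \<kappa> u dm t z" using P M by blast+
    have "line_laplace K (geometric n c) dp t - line_laplace K (geometric n c) dm t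
      = 2 * of_real pi * \<i> / of_real n * K (?v - t)"
    proof (rule line_laplace_jump[OF K_flat \<kappa>_pos n_pos exp_root_point \<delta>(1,3)])
      show "\<bar>Im t - Im ?v\<bar> + \<delta> \<le> pi / (2 * \<kappa>)" unfolding v using t' \<delta>(2) by (simp add: mult.commute)
    qed (use dp dm v in auto)
    moreover have "kernel_fun \<kappa> m (?v - t) = K (?v - t)"
      by (rule kernel_m) (use t' v \<epsilon> in \<open>simp add: abs_minus_commute\<close>)
    ultimately have J: "2 * of_real pi * \<i> * (\<phi> z / (of_nat q + 1)) * kernel_fun \<kappa> m (?v - t)
        = \<phi> z * (line_laplace K (geometric n c) dp t - line_laplace K (geometric n c) dm t)"
      by (simp add: n_complex)
    show "2 * of_real pi * \<i> * (\<phi> z / (of_nat q + 1)) * kernel_fun \<kappa> m (?v - t)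
        = sum_in_direction \<rho> \<kappa> u dp t z - sum_in_direction \<rho> \<kappa> u dm t z"
      unfolding J using P M by (simp add: right_diff_distrib)
  qed
qed

lemma holomorphic2_sum:
  assumes d: "\<And>j::int. d \<noteq> root_direction q arga j" and \<epsilon>: "0 < \<epsilon>"
  shows "holomorphic2_on (sum_in_direction \<rho> \<kappa> u d) (sector d (pi / \<kappa> - \<epsilon>) r \<times> ball 0 \<rho>)"
proof (rule holomorphic2_on_product)
  show "\<phi> holomorphic_on ball 0 \<rho>" using \<rho> by (intro holomorphic_on_subset[OF \<phi>]) auto
  have im: "\<bar>Im t - d\<bar> < pi / \<kappa> / 2" if "t \<in> sector d (pi / \<kappa> - \<epsilon>) r" for t
    using that \<epsilon> by (auto simp: sector_def unbounded_sector_def abs_less_iff diff_divide_distrib)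
  have "Im t - d < pi / \<kappa> / 2" "d - Im t < pi / \<kappa> / 2" if "t \<in> sector d (pi / \<kappa> - \<epsilon>) r" for t
    using im[OF that] by (auto simp: abs_less_iff)
  moreover have "pi / (2 * \<kappa>) = pi / \<kappa> / 2" by simp
  ultimately show "line_laplace K (geometric n c) d holomorphic_on sector d (pi / \<kappa> - \<epsilon>) r"
    by (intro holomorphic_on_subset[OF regular(4)[OF d]]) (force simp: hstrip_def)
  show "sum_in_direction \<rho> \<kappa> u d t z = \<phi> z * line_laplace K (geometric n c) d t"
    if "t \<in> sector d (pi / \<kappa> - \<epsilon>) r" "z \<in> ball 0 \<rho>" for t z
    using regular(3)[OF d _ im[OF that(1)], of z] that(2) by simp
qed (auto simp: open_sector)

end

theorem theorem1:
  fixes p q :: nat and a :: complex and arga \<kappa> R \<rho> :: real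
    and \<phi> :: "complex \<Rightarrow> complex" and u :: "nat \<Rightarrow> complex \<Rightarrow> complex"
    and m e\<^sub>m :: "complex \<Rightarrow> complex"
  assumes "p \<ge> 2"
    and "a \<noteq> 0" and "a = of_real (cmod a) * cis arga"
    and "0 < \<rho>" and "\<rho> < R"
    and "\<phi> holomorphic_on ball 0 R"
    and "formal_solution p q a R \<phi> u"
    and "\<kappa> = (real q + 1) / (real p - 1)"
    and "m = (\<lambda>x. Gamma (1 + x / (of_nat q + 1)) ^ (p - 1))"
    and "e\<^sub>m = kernel_fun \<kappa> m"
  shows
    "(\<forall>d. (\<forall>k::int. d \<noteq> root_direction q arga k) \<longrightarrow>
        summable_in_direction \<rho> \<kappa> u d \<and>
        continuable \<rho> \<kappa> d (moment_borel m u) \<and>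
        (\<forall>\<epsilon>>0. \<exists>r>0.
           holomorphic2_on (sum_in_direction \<rho> \<kappa> u d)
             (sector d (pi * (real p - 1) / (real q + 1) - \<epsilon>) r \<times> ball 0 \<rho>) \<and>
           (\<forall>t\<in>sector d (pi * (real p - 1) / (real q + 1) - \<epsilon>) r. \<forall>z\<in>ball 0 \<rho>.
              sum_converges \<rho> \<kappa> u d t z \<and>
              laplace_converges \<kappa> m d (continuation \<rho> \<kappa> d (moment_borel m u)) t z \<and>
              ray_integrable d
                (\<lambda>s. e\<^sub>m (s - t) * (\<phi> z / (1 - a * (of_nat q + 1) ^ (p - 1) * exp s ^ (q + 1)))) \<and>
              sum_in_direction \<rho> \<kappa> u d t z =
                moment_laplace \<kappa> m d (continuation \<rho> \<kappa> d (moment_borel m u)) t z \<and>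
              sum_in_direction \<rho> \<kappa> u d t z =
                ray_integral d
                  (\<lambda>s. e\<^sub>m (s - t) * (\<phi> z / (1 - a * (of_nat q + 1) ^ (p - 1) * exp s ^ (q + 1))))))) \<and>
     (\<forall>k\<in>{0..int q}.
        ((\<exists>z\<in>ball 0 R. \<phi> z \<noteq> 0) \<longrightarrow>
           stokes_line \<rho> \<kappa> u (direction_line (root_direction q arga k))) \<and>
        (\<forall>\<epsilon>>0. \<exists>r>0.
           has_jump \<rho> \<kappa> u (root_direction q arga k)
             (sector (root_direction q arga k) (pi * (real p - 1) / (real q + 1) - \<epsilon>) r)
             (\<lambda>t z. 2 * of_real pi * \<i> * (\<phi> z / (of_nat q + 1)) *
                    e\<^sub>m (root_point p q a arga k - t))))"
proof -
  interpret cauchy_problem p q a arga \<kappa> R \<rho> \<phi> u by standard fact+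
  have m: "m = cauchy_problem.m p q" using assms(9) by (simp add: m_def k_def)
  show ?thesis
    unfolding kappa_opening assms(10) m
  proof (intro conjI allI impI ballI)
    fix d assume "\<forall>k. d \<noteq> root_direction q arga k"
    then have d: "\<And>k. d \<noteq> root_direction q arga k" by blast
    show "summable_in_direction \<rho> \<kappa> u d" by (rule regular(1)[OF d])
    show "continuable \<rho> \<kappa> d (moment_borel (cauchy_problem.m p q) u)" by (rule regular(2)[OF d])
    fix \<epsilon> :: real assume \<epsilon>: "0 < \<epsilon>"
    have im: "\<bar>Im t - d\<bar> < pi / \<kappa> / 2" if "t \<in> sector d (pi / \<kappa> - \<epsilon>) 1" for t
      using that \<epsilon> by (auto simp: sector_def unbounded_sector_def abs_less_iff diff_divide_distrib)
    show "\<exists>r>0. holomorphic2_on (sum_in_direction \<rho> \<kappa> u d) (sector d (pi / \<kappa> - \<epsilon>) r \<times> ball 0 \<rho>) \<and>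
           (\<forall>t\<in>sector d (pi / \<kappa> - \<epsilon>) r. \<forall>z\<in>ball 0 \<rho>.
              sum_converges \<rho> \<kappa> u d t z \<and>
              laplace_converges \<kappa> (cauchy_problem.m p q) d (continuation \<rho> \<kappa> d (moment_borel (cauchy_problem.m p q) u)) t z \<and>
              ray_integrable d
                (\<lambda>s. kernel_fun \<kappa> (cauchy_problem.m p q) (s - t) * (\<phi> z / (1 - a * (of_nat q + 1) ^ (p - 1) * exp s ^ (q + 1)))) \<and>
              sum_in_direction \<rho> \<kappa> u d t z =
                moment_laplace \<kappa> (cauchy_problem.m p q) d (continuation \<rho> \<kappa> d (moment_borel (cauchy_problem.m p q) u)) t z \<and>
              sum_in_direction \<rho> \<kappa> u d t z =
                ray_integral d
                  (\<lambda>s. kernel_fun \<kappa> (cauchy_problem.m p q) (s - t) * (\<phi> z / (1 - a * (of_nat q + 1) ^ (p - 1) * exp s ^ (q + 1)))))"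
    \<comment> \<open>Any radius would do: the Borel transforms are bounded along the ray, so the
      Laplace integrals converge for all moduli of t, and the sum is holomorphic on the whole
      narrowed sector.\<close>
    proof (intro exI[of _ 1] conjI ballI holomorphic2_sum[OF d \<epsilon>])
      fix t z :: complex assume t: "t \<in> sector d (pi / \<kappa> - \<epsilon>) 1" and "z \<in> ball 0 \<rho>"
      then have "z \<in> cball 0 \<rho>" by simp
      note R = regular(3)[OF d this im[OF t]]
      show "sum_converges \<rho> \<kappa> u d t z"
        "laplace_converges \<kappa> (cauchy_problem.m p q) d (continuation \<rho> \<kappa> d (moment_borel (cauchy_problem.m p q) u)) t z"
        "ray_integrable d (\<lambda>s. kernel_fun \<kappa> (cauchy_problem.m p q) (s - t) * (\<phi> z / (1 - a * (of_nat q + 1) ^ (p - 1) * exp s ^ (q + 1))))"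
        using R by blast+
      show "sum_in_direction \<rho> \<kappa> u d t z = moment_laplace \<kappa> (cauchy_problem.m p q) d (continuation \<rho> \<kappa> d (moment_borel (cauchy_problem.m p q) u)) t z"
        "sum_in_direction \<rho> \<kappa> u d t z = ray_integral d
           (\<lambda>s. kernel_fun \<kappa> (cauchy_problem.m p q) (s - t) * (\<phi> z / (1 - a * (of_nat q + 1) ^ (p - 1) * exp s ^ (q + 1))))"
        using R by metis+
    qed simp
  next
    fix k :: int
    assume "\<exists>z\<in>ball 0 R. \<phi> z \<noteq> 0"
    then show "stokes_line \<rho> \<kappa> u (direction_line (root_direction q arga k))"
      unfolding stokes_line_def singular_direction_def
      using not_summable_root_direction kappa_summable by blast
  next
    fix k :: int and \<epsilon> :: real assume "0 < \<epsilon>"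
    from jump[OF this, of k 1]
    show "\<exists>r>0. has_jump \<rho> \<kappa> u (root_direction q arga k) (sector (root_direction q arga k) (pi / \<kappa> - \<epsilon>) r)
       (\<lambda>t z. 2 * of_real pi * \<i> * (\<phi> z / (of_nat q + 1)) * kernel_fun \<kappa> (cauchy_problem.m p q) (root_point p q a arga k - t))"
      by (intro exI[of _ 1]) simp
  qed
qed

end
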